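(* Suppose $V$ is an $L^2$-sparse potential. Then the absolutely continuous part $\mu_{ac}$ of the spectral measure of the operator $T=-\frac{d^2}{dx^2}+V$ acting in $L^2(0,\infty)$ with Dirichlet boundary condition at $x=0$ is supported in $\mathbb{R}^+$; that is, $\mu_{ac}(A)=0$ for every Borel set $A\subset(-\infty,0)$.
   Context: A real-valued function $V$ on $[0,\infty)$, integrable over every finite subinterval, is an $L^2$-sparse potential if for all $\delta,N>0$ there is a subinterval $(a,b)$ of $[0,\infty)$ with $b-a=N$ and $\int_a^b V(x)^2\,dx<\delta$. For such $V$ the expression $-\frac{d^2}{dx^2}+V$ is in the limit-point case at infinity, so $T$ is a uniquely defined self-adjoint operator. Its spectral measure $\mu$ is the measure in the Herglotz representation of the Weyl $m$-function $m(z)=F'(0,z)/F(0,z)$ ($\operatorname{Im} z>0$), where $F(\cdot,z)$ is any non-trivial $L^2(0,\infty)$ solution of $-F''+VF=zF$; $\mu_{ac}$ is the part of $\mu$ absolutely continuous with respect to Lebesgue measure. *)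

theory Defs
  imports "HOL-Analysis.Analysis"
begin

text \<open>
  Functions on \<open>[0, \<infinity>)\<close> are total functions on \<^typ>\<open>real\<close> whose values at negative arguments
  are never inspected.
\<close>

(* V is not assumed locally square integrable, so the integral of V^2 is taken in [0, \<infinity>]. *)
definition L2_sparse :: "(real \<Rightarrow> real) \<Rightarrow> bool" where
  "L2_sparse V \<longleftrightarrow>
     (\<forall>c\<ge>0. V absolutely_integrable_on {0..c}) \<and>
     (\<forall>\<delta>>0. \<forall>N>0. \<exists>a b. 0 \<le> a \<and> b - a = N \<and>
        (\<integral>\<^sup>+ x\<in>{a<..<b}. ennreal ((V x)\<^sup>2) \<partial>lebesgue) < ennreal \<delta>)"

(* V is only locally integrable, so -F'' + V F = z F is meant in the Caratheodory sense: F' is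
   locally absolutely continuous and the equation holds almost everywhere. This is the integrated
   equation for F', whose integrand is absolutely integrable since F is continuous. *)
definition schrodinger_solution ::
    "(real \<Rightarrow> real) \<Rightarrow> complex \<Rightarrow> (real \<Rightarrow> complex) \<Rightarrow> (real \<Rightarrow> complex) \<Rightarrow> bool" where
  "schrodinger_solution V z F F' \<longleftrightarrow>
     (\<forall>x\<ge>0. (F has_vector_derivative F' x) (at x within {0..})) \<and>
     (\<forall>x\<ge>0. ((\<lambda>t. (complex_of_real (V t) - z) * F t) has_integral (F' x - F' 0)) {0..x})"

definition weyl_solution ::
    "(real \<Rightarrow> real) \<Rightarrow> complex \<Rightarrow> (real \<Rightarrow> complex) \<Rightarrow> (real \<Rightarrow> complex) \<Rightarrow> bool" where
  "weyl_solution V z F F' \<longleftrightarrow>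
     schrodinger_solution V z F F' \<and>
     (\<exists>x\<ge>0. F x \<noteq> 0) \<and>
     (\<lambda>x. (cmod (F x))\<^sup>2) absolutely_integrable_on {0<..}"

(* In the limit-point case the Weyl solution is unique up to a constant factor, so for Im z > 0
   the quotient does not depend on its choice. *)
definition weyl_m :: "(real \<Rightarrow> real) \<Rightarrow> complex \<Rightarrow> complex" where
  "weyl_m V z = (THE w. \<exists>F F'. weyl_solution V z F F' \<and> w = F' 0 / F 0)"

definition herglotz_measure :: "(complex \<Rightarrow> complex) \<Rightarrow> real measure \<Rightarrow> bool" where
  "herglotz_measure m \<mu> \<longleftrightarrow>
     sets \<mu> = sets borel \<and>
     integrable \<mu> (\<lambda>t. 1 / (1 + t\<^sup>2)) \<and>
     (\<exists>(\<alpha>::real) (\<beta>::real). 0 \<le> \<beta> \<and>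
        (\<forall>z. Im z > 0 \<longrightarrow>
           m z = of_real \<alpha> + of_real \<beta> * z +
             (\<integral>t. (1 / (of_real t - z) - of_real (t / (1 + t\<^sup>2))) \<partial>\<mu>)))"

definition dirichlet_spectral_measure :: "(real \<Rightarrow> real) \<Rightarrow> real measure \<Rightarrow> bool" where
  "dirichlet_spectral_measure V \<mu> \<longleftrightarrow> herglotz_measure (weyl_m V) \<mu>"

(* \<nu> is the absolutely continuous component in the Lebesgue decomposition \<mu> = \<nu> + \<sigma>. *)
definition ac_part :: "real measure \<Rightarrow> real measure \<Rightarrow> bool" where
  "ac_part \<mu> \<nu> \<longleftrightarrow>
     sets \<nu> = sets borel \<and> absolutely_continuous lborel \<nu> \<and>
     (\<exists>\<sigma>. sets \<sigma> = sets borel \<and>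
        (\<exists>S\<in>sets borel. emeasure lborel S = 0 \<and> emeasure \<sigma> (- S) = 0) \<and>
        (\<forall>A\<in>sets borel. emeasure \<mu> A = emeasure \<nu> A + emeasure \<sigma> A))"

end

(* The Green functions of the Dirichlet and the Neumann problem at a point x are built from the
   fundamental solutions and the Weyl m-function; for x inside an interval with little potential they
   are at most C / Im z, uniformly in x. Cauchy's theorem turns this into bounds, uniform down to the
   real axis, for the integral of their imaginary parts along horizontal lines. If mu had an absolutely
   continuous part on the negative axis, then on a set of energies of measure bounded below Im m would be
   bounded below and |m| bounded above (a weak-type estimate), and there these imaginary parts control
   the squares of both fundamental solutions at the ends of long intervals with little potential. At
   negative energies every solution is exponentially small in the middle of such an interval relative
   to its ends, which contradicts the Wronskian of the fundamental solutions being 1. *)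

theory Submission
  imports Defs "HOL-Complex_Analysis.Complex_Analysis"
begin

text \<open>Every estimate lives on one horizontal line at height \<open>e\<close>, with constants
  that do not involve \<open>e\<close>. This dictates the order of choices: the measure of the set
  of energies, the lower bound for Im m and the upper bound for |m| fix the smallness
  \<open>\<tau>\<close> demanded of a good interval; then the interval is chosen; only then
  \<open>e\<close>, because the flux lost between 0 and the interval is Im z times a constant
  depending on the interval. Each Green function controls one solution: the Dirichlet one the
  solution vanishing at 0, the Neumann one the solution with vanishing derivative, and a Wronskian
  needs both. In the Neumann case the flux is divided by |m|^2, so |m| must be bounded above. Since
  the equation is integrated against a merely locally integrable V, the hypothesis is first turned
  into smallness of the integral of |V|.\<close>

section \<open>Indefinite integrals\<close>


text \<open>Telescoping over a fine partition bounds the total increment of \<open>H\<close> by e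
  times that of \<open>\<Phi>\<close>, for every e > 0. This stands in for the principle that an
  absolutely continuous function whose derivative vanishes almost everywhere is constant.\<close>

lemma small_increments_imp_eq:
  fixes H :: "real \<Rightarrow> 'a::real_normed_vector" and \<Phi> :: "real \<Rightarrow> real"
  assumes ab: "a \<le> b"
    and small: "\<And>e. e > 0 \<Longrightarrow> \<exists>d>0. \<forall>x y. a \<le> x \<and> x \<le> y \<and> y \<le> b \<and> y - x < d \<longrightarrow>
            norm (H y - H x) \<le> e * (\<Phi> y - \<Phi> x)"
  shows "H b = H a"
proof -
  have *: "norm (H b - H a) \<le> e * (\<Phi> b - \<Phi> a)" if e: "e > 0" for e
  proof -
    obtain d where d: "d > 0" and D: "\<And>x y. a \<le> x \<Longrightarrow> x \<le> y \<Longrightarrow> y \<le> b \<Longrightarrow> y - x < d \<Longrightarrow>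
            norm (H y - H x) \<le> e * (\<Phi> y - \<Phi> x)"
      using small[OF e] by metis
    obtain n :: nat where n: "(b - a) / d < real n"
      using reals_Archimedean2 by blast
    have n0: "n > 0"
      using n d ab by (cases n) (auto simp: divide_less_eq)
    define X where "X i = a + (b - a) * (real i / real n)" for i
    have X: "a \<le> X i" "X i \<le> X (Suc i)" "X (Suc i) \<le> b" "X (Suc i) - X i < d" if "i < n" for i
    proof -
      show "a \<le> X i" using ab by (simp add: X_def)
      show "X i \<le> X (Suc i)" unfolding X_def using ab
        by (intro add_left_mono mult_left_mono divide_right_mono) auto
      have "(b - a) * (real (Suc i) / real n) \<le> (b - a) * 1"
        using that n0 ab by (intro mult_left_mono) auto
      then show "X (Suc i) \<le> b" by (simp add: X_def)
      have "X (Suc i) - X i = (b - a) / real n"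
        using n0 by (simp add: X_def field_simps)
      also have "\<dots> < d" using n d n0 by (simp add: field_simps)
      finally show "X (Suc i) - X i < d" .
    qed
    have X0: "X 0 = a" and Xn: "X n = b" using n0 by (auto simp: X_def)
    have "H b - H a = (\<Sum>i<n. H (X (Suc i)) - H (X i))"
      using sum_lessThan_telescope[of "\<lambda>i. H (X i)" n] X0 Xn by simp
    then have "norm (H b - H a) \<le> (\<Sum>i<n. norm (H (X (Suc i)) - H (X i)))"
      by (simp add: norm_sum)
    also have "\<dots> \<le> (\<Sum>i<n. e * (\<Phi> (X (Suc i)) - \<Phi> (X i)))"
      using X by (intro sum_mono D) auto
    also have "\<dots> = e * (\<Phi> b - \<Phi> a)"
      using sum_lessThan_telescope[of "\<lambda>i. \<Phi> (X i)" n] X0 Xn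
      by (simp add: sum_distrib_left[symmetric])
    finally show ?thesis .
  qed
  have "norm (H b - H a) \<le> 0"
  proof (rule field_le_epsilon)
    fix r :: real assume r: "r > 0"
    have "norm (H b - H a) \<le> r / (\<bar>\<Phi> b - \<Phi> a\<bar> + 1) * (\<Phi> b - \<Phi> a)"
      using r by (intro *) simp
    also have "\<dots> \<le> r / (\<bar>\<Phi> b - \<Phi> a\<bar> + 1) * (\<bar>\<Phi> b - \<Phi> a\<bar> + 1)"
      using r by (intro mult_left_mono) auto
    also have "\<dots> = r" by auto
    finally show "norm (H b - H a) \<le> 0 + r" by simp
  qed
  then show ?thesis by simp
qed

text \<open>Encodes absolute continuity of \<open>F\<close> with almost-everywhere derivative
  \<open>f\<close> through integrals over all subintervals, the form in which the differential
  equation is given.\<close>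

definition indef_integral :: "real \<Rightarrow> real \<Rightarrow> (real \<Rightarrow> 'a::euclidean_space) \<Rightarrow> (real \<Rightarrow> 'a) \<Rightarrow> bool" where
  "indef_integral a b F f \<longleftrightarrow> f absolutely_integrable_on {a..b} \<and>
     (\<forall>x y. a \<le> x \<and> x \<le> y \<and> y \<le> b \<longrightarrow> (f has_integral (F y - F x)) {x..y})"

lemma indef_integral_abs_int:
  "indef_integral a b F f \<Longrightarrow> a \<le> x \<Longrightarrow> y \<le> b \<Longrightarrow> f absolutely_integrable_on {x..y}"
  unfolding indef_integral_def
  by (metis absolutely_integrable_on_subinterval atLeastatMost_subset_iff)

lemma indef_integral_has_integral:
  "indef_integral a b F f \<Longrightarrow> a \<le> x \<Longrightarrow> x \<le> y \<Longrightarrow> y \<le> b \<Longrightarrow> (f has_integral (F y - F x)) {x..y}"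
  unfolding indef_integral_def by blast

lemma indef_integral_subinterval:
  assumes F: "indef_integral a b F f" and "a \<le> a'" "b' \<le> b"
  shows "indef_integral a' b' F f"
  unfolding indef_integral_def
proof (intro conjI allI impI)
  show "f absolutely_integrable_on {a'..b'}"
    by (rule indef_integral_abs_int[OF assms])
  fix x y assume "a' \<le> x \<and> x \<le> y \<and> y \<le> b'"
  then show "(f has_integral (F y - F x)) {x..y}"
    using assms(2,3) by (intro indef_integral_has_integral[OF F]) linarith+
qed

lemma indef_integralI:
  assumes f: "f absolutely_integrable_on {a..b}"
    and F: "\<And>x. a \<le> x \<Longrightarrow> x \<le> b \<Longrightarrow> (f has_integral (F x - c)) {a..x}"
  shows "indef_integral a b F f"
  unfolding indef_integral_def
proof (intro conjI allI impI)
  fix x y assume xy: "a \<le> x \<and> x \<le> y \<and> y \<le> b"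
  have "f integrable_on {x..y}"
    using absolutely_integrable_on_subinterval[OF f, of x y] xy
    by (auto simp: absolutely_integrable_on_def)
  then obtain I where I: "(f has_integral I) {x..y}" by (auto simp: integrable_on_def)
  have "(f has_integral (F x - c + I)) {a..y}"
    using xy I F[of x] by (intro has_integral_combine[of a x y]) auto
  moreover have "(f has_integral (F y - c)) {a..y}" using F xy by auto
  ultimately have "F x - c + I = F y - c" by (rule has_integral_unique)
  then have "I = F y - F x" by (simp add: algebra_simps)
  then show "(f has_integral (F y - F x)) {x..y}" using I by simp
qed (rule f)

lemma indef_integral_continuous:
  assumes "indef_integral a b F f" shows "continuous_on {a..b} F"
proof (cases "a \<le> b")
  case True
  have "continuous_on {a..b} (\<lambda>x. F a + integral {a..x} f)"
    using indef_integral_abs_int[OF assms, of a b]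
    by (intro continuous_intros indefinite_integral_continuous_1)
       (auto simp: absolutely_integrable_on_def)
  moreover have "F a + integral {a..x} f = F x" if "x \<in> {a..b}" for x
    using integral_unique[OF indef_integral_has_integral[OF assms, of a x]] that by simp
  ultimately show ?thesis by (rule continuous_on_eq)
qed simp

lemma indef_integral_vector_derivative:
  assumes F: "\<And>x. x \<in> {a..b} \<Longrightarrow> (F has_vector_derivative f x) (at x within {a..b})"
    and f: "continuous_on {a..b} f"
  shows "indef_integral a b F f"
  unfolding indef_integral_def
proof (intro conjI allI impI)
  show "f absolutely_integrable_on {a..b}"
    using absolutely_integrable_continuous[of a b f] f by simp
  fix x y assume xy: "a \<le> x \<and> x \<le> y \<and> y \<le> b"
  have "(F has_vector_derivative f t) (at t within {x..y})" if "t \<in> {x..y}" for t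
    using that xy by (intro has_vector_derivative_within_subset[OF F]) auto
  then show "(f has_integral (F y - F x)) {x..y}"
    using xy by (intro fundamental_theorem_of_calculus) auto
qed

lemma indef_integral_norm:
  fixes f :: "real \<Rightarrow> 'a::euclidean_space"
  assumes f: "f absolutely_integrable_on {a..b}"
  shows "indef_integral a b (\<lambda>x. integral {a..x} (\<lambda>t. norm (f t))) (\<lambda>t. norm (f t))"
proof (rule indef_integralI[where c = 0])
  show n: "(\<lambda>t. norm (f t)) absolutely_integrable_on {a..b}"
    using absolutely_integrable_norm[OF f] by (simp add: o_def)
  fix x assume "a \<le> x" "x \<le> b"
  then have "(\<lambda>t. norm (f t)) integrable_on {a..x}"
    using n absolutely_integrable_on_subinterval[OF n, of a x] by (auto simp: absolutely_integrable_on_def)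
  then show "((\<lambda>t. norm (f t)) has_integral (integral {a..x} (\<lambda>t. norm (f t)) - 0)) {a..x}"
    by (simp add: has_integral_integral)
qed

lemma abs_int_mult_continuous:
  fixes f g :: "real \<Rightarrow> 'a::{euclidean_space,real_normed_field}"
  assumes f: "f absolutely_integrable_on {a..b}" and g: "continuous_on {a..b} g"
  shows "(\<lambda>t. f t * g t) absolutely_integrable_on {a..b}"
proof -
  have "(\<lambda>x. g x * f x) absolutely_integrable_on {a..b}"
  proof (rule absolutely_integrable_bounded_measurable_product[OF bilinear_times])
    show "g \<in> borel_measurable (lebesgue_on {a..b})"
      by (intro continuous_imp_measurable_on_sets_lebesgue g) auto
    show "bounded (g ` {a..b})"
      using compact_continuous_image[OF g] compact_imp_bounded by blast
  qed (auto intro: f)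
  then show ?thesis by (simp add: mult.commute)
qed

lemma integral_bound_sup:
  fixes f :: "real \<Rightarrow> 'a::euclidean_space"
  assumes "(f has_integral I) {x..y}" "g integrable_on {x..y}" "\<And>t. t \<in> {x..y} \<Longrightarrow> norm (f t) \<le> e * g t"
  shows "norm I \<le> e * integral {x..y} g"
proof -
  have "norm (integral {x..y} f) \<le> integral {x..y} (\<lambda>t. e * g t)"
    using assms by (intro integral_norm_bound_integral) (auto simp: integrable_on_def intro: has_integral_mult_right)
  then show ?thesis using assms(1) by (simp add: integral_unique)
qed

text \<open>Integration by parts for two absolutely continuous factors. \<open>H\<close>, the
  product minus the integral of the expected derivative, has increments of size e times those of
  \<open>\<Phi>\<close>, by uniform continuity of \<open>F\<close> and \<open>G\<close>.\<close>

lemma indef_integral_mult: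
  fixes F f G g :: "real \<Rightarrow> 'a::{euclidean_space,real_normed_field}"
  assumes F: "indef_integral a b F f" and G: "indef_integral a b G g"
  shows "indef_integral a b (\<lambda>t. F t * G t) (\<lambda>t. f t * G t + F t * g t)"
proof (rule indef_integralI[where c = "F a * G a"])
  have cF: "continuous_on {a..b} F" and cG: "continuous_on {a..b} G"
    using indef_integral_continuous F G by blast+
  let ?h = "\<lambda>t. f t * G t + F t * g t"
  have fG: "(\<lambda>t. f t * G t) absolutely_integrable_on {a..b}"
    using F cG by (intro abs_int_mult_continuous) (auto simp: indef_integral_def)
  have Fg: "(\<lambda>t. F t * g t) absolutely_integrable_on {a..b}"
    using abs_int_mult_continuous[OF _ cF, of g] G by (auto simp: indef_integral_def mult.commute)
  show h: "?h absolutely_integrable_on {a..b}"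
    using fG Fg by (rule set_integral_add)
  fix c assume c: "a \<le> c" "c \<le> b"
  have hi: "?h integrable_on {x..y}" if "a \<le> x" "y \<le> b" for x y
    using absolutely_integrable_on_subinterval[OF h, of x y] that by (auto simp: absolutely_integrable_on_def)
  define H where "H x = F x * G x - integral {a..x} ?h" for x
  define \<Phi> where "\<Phi> x = integral {a..x} (\<lambda>t. norm (f t)) + integral {a..x} (\<lambda>t. norm (g t))" for x
  have nf: "indef_integral a b (\<lambda>x. integral {a..x} (\<lambda>t. norm (f t))) (\<lambda>t. norm (f t))"
    and ng: "indef_integral a b (\<lambda>x. integral {a..x} (\<lambda>t. norm (g t))) (\<lambda>t. norm (g t))"
    using F G by (intro indef_integral_norm; simp add: indef_integral_def)+
  have "H c = H a"
  proof (rule small_increments_imp_eq[where \<Phi> = \<Phi>, OF c(1)])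
    fix e :: real assume e: "e > 0"
    have "uniformly_continuous_on {a..b} F" "uniformly_continuous_on {a..b} G"
      using compact_uniformly_continuous cF cG by blast+
    then obtain d1 d2 where d1: "d1 > 0" "\<And>x y. x \<in> {a..b} \<Longrightarrow> y \<in> {a..b} \<Longrightarrow> dist y x < d1 \<Longrightarrow> dist (F y) (F x) < e"
      and d2: "d2 > 0" "\<And>x y. x \<in> {a..b} \<Longrightarrow> y \<in> {a..b} \<Longrightarrow> dist y x < d2 \<Longrightarrow> dist (G y) (G x) < e"
      using e unfolding uniformly_continuous_on_def by metis
    show "\<exists>d>0. \<forall>x y. a \<le> x \<and> x \<le> y \<and> y \<le> c \<and> y - x < d \<longrightarrow> norm (H y - H x) \<le> e * (\<Phi> y - \<Phi> x)"
    proof (intro exI conjI allI impI)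
      show "min d1 d2 > 0" using d1 d2 by simp
      fix x y assume xy: "a \<le> x \<and> x \<le> y \<and> y \<le> c \<and> y - x < min d1 d2"
      have x: "a \<le> x" "x \<le> y" "y \<le> b" using xy c by auto
      have If: "(f has_integral (F y - F x)) {x..y}" and Ig: "(g has_integral (G y - G x)) {x..y}"
        using indef_integral_has_integral F G x by blast+
      have comb: "integral {a..x} ?h + integral {x..y} ?h = integral {a..y} ?h"
        using x by (intro Henstock_Kurzweil_Integration.integral_combine hi) auto
      then have "integral {a..y} ?h - integral {a..x} ?h = integral {x..y} ?h"
        by (simp only: add_diff_cancel_left' flip: comb)
      then have "(?h has_integral (integral {a..y} ?h - integral {a..x} ?h)) {x..y}"
        using integrable_integral[OF hi[OF x(1) x(3)]] by (simp only:)
      \<comment> \<open>Freezing \<open>G\<close> at the right end and \<open>F\<close> at the left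
        end makes the integral exactly the increment of the product. The error against
        \<open>?h\<close> is f(t) (G y - G t) + (F x - F t) g(t).\<close>
      moreover have "((\<lambda>t. f t * G y + F x * g t) has_integral ((F y - F x) * G y + F x * (G y - G x))) {x..y}"
        using If Ig by (intro has_integral_add has_integral_mult_left has_integral_mult_right)
      ultimately have "((\<lambda>t. (f t * G y + F x * g t) - ?h t) has_integral (((F y - F x) * G y + F x * (G y - G x))
           - (integral {a..y} ?h - integral {a..x} ?h))) {x..y}"
        by (rule has_integral_diff[rotated])
      then have D: "((\<lambda>t. (f t * G y + F x * g t) - ?h t) has_integral (H y - H x)) {x..y}"
        by (simp add: H_def algebra_simps)
      have nfi: "(\<lambda>t. norm (f t)) integrable_on {x..y}" "(\<lambda>t. norm (g t)) integrable_on {x..y}"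
        using indef_integral_abs_int[OF F x(1) x(3)] indef_integral_abs_int[OF G x(1) x(3)]
        by (auto simp: absolutely_integrable_on_def)
      have "norm (H y - H x) \<le> e * integral {x..y} (\<lambda>t. norm (f t) + norm (g t))"
      proof (rule integral_bound_sup[OF D])
        show "(\<lambda>t. norm (f t) + norm (g t)) integrable_on {x..y}"
          using nfi by (rule integrable_add)
        fix t assume t: "t \<in> {x..y}"
        have "(f t * G y + F x * g t) - ?h t = f t * (G y - G t) + (F x - F t) * g t"
          by (simp add: algebra_simps)
        also have "norm \<dots> \<le> norm (f t) * norm (G y - G t) + norm (F x - F t) * norm (g t)"
          by (intro norm_triangle_mono) (auto simp: norm_mult)
        also have "\<dots> \<le> norm (f t) * e + e * norm (g t)"
        proof (intro add_mono mult_left_mono mult_right_mono)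
          show "norm (G y - G t) \<le> e"
            using d2(2)[of t y] t x xy by (auto simp: dist_norm)
          show "norm (F x - F t) \<le> e"
            using d1(2)[of t x] t x xy by (auto simp: dist_norm)
        qed auto
        finally show "norm ((f t * G y + F x * g t) - ?h t) \<le> e * (norm (f t) + norm (g t))"
          by (simp add: algebra_simps)
      qed
      also have "integral {x..y} (\<lambda>t. norm (f t) + norm (g t)) = \<Phi> y - \<Phi> x"
        using indef_integral_has_integral[OF nf x] indef_integral_has_integral[OF ng x] nfi
        by (simp add: \<Phi>_def integral_add integral_unique)
      finally show "norm (H y - H x) \<le> e * (\<Phi> y - \<Phi> x)" .
    qed
  qed
  then have "integral {a..c} ?h = F c * G c - F a * G a"
    by (simp add: H_def algebra_simps)
  then show "(?h has_integral (F c * G c - F a * G a)) {a..c}"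
    using hi[of a c] c by (metis integrable_integral order_refl)
qed

lemma indef_integral_add:
  "indef_integral a b F f \<Longrightarrow> indef_integral a b G g \<Longrightarrow> indef_integral a b (\<lambda>t. F t + G t) (\<lambda>t. f t + g t)"
  unfolding indef_integral_def
  by (auto simp: add_diff_add intro!: set_integral_add has_integral_add)

lemma indef_integral_diff:
  "indef_integral a b F f \<Longrightarrow> indef_integral a b G g \<Longrightarrow> indef_integral a b (\<lambda>t. F t - G t) (\<lambda>t. f t - g t)"
  unfolding indef_integral_def
proof safe
  fix x y assume "\<forall>x y. a \<le> x \<and> x \<le> y \<and> y \<le> b \<longrightarrow> (f has_integral F y - F x) {x..y}"
   "\<forall>x y. a \<le> x \<and> x \<le> y \<and> y \<le> b \<longrightarrow> (g has_integral G y - G x) {x..y}"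
   "a \<le> x" "x \<le> y" "y \<le> b"
  then have "((\<lambda>t. f t - g t) has_integral (F y - F x) - (G y - G x)) {x..y}"
    by (intro has_integral_diff) auto
  then show "((\<lambda>t. f t - g t) has_integral (F y - G y - (F x - G x))) {x..y}"
    by (simp add: algebra_simps)
qed auto

lemma indef_integral_cmult:
  fixes F f :: "real \<Rightarrow> 'a::{euclidean_space,real_normed_field}"
  shows "indef_integral a b F f \<Longrightarrow> indef_integral a b (\<lambda>t. c * F t) (\<lambda>t. c * f t)"
  unfolding indef_integral_def
  by (auto simp: right_diff_distrib[symmetric] intro!: has_integral_mult_right)

lemma indef_integral_cnj:
  "indef_integral a b F f \<Longrightarrow> indef_integral a b (\<lambda>t. cnj (F t)) (\<lambda>t. cnj (f t))"
  unfolding indef_integral_def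
  by (auto simp: absolutely_integrable_on_def integrable_on_cnj_iff has_integral_cnj[unfolded o_def] complex_cnj_diff[symmetric]
      simp del: complex_cnj_diff)

lemma indef_integral_eq:
  assumes "indef_integral a b F f" "\<And>t. t \<in> {a..b} \<Longrightarrow> F t = G t" "\<And>t. t \<in> {a..b} \<Longrightarrow> f t = g t"
  shows "indef_integral a b G g"
proof -
  have "g absolutely_integrable_on {a..b}"
    using assms by (metis (mono_tags, lifting) absolutely_integrable_spike empty_iff negligible_empty Diff_iff indef_integral_def)
  moreover have "(g has_integral (G y - G x)) {x..y}" if "a \<le> x" "x \<le> y" "y \<le> b" for x y
  proof -
    have "(g has_integral (F y - F x)) {x..y}"
      using indef_integral_has_integral[OF assms(1) that] assms(3) that by (subst has_integral_cong[of _ g f]) auto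
    then show ?thesis using assms(2) that by auto
  qed
  ultimately show ?thesis by (auto simp: indef_integral_def)
qed

section \<open>Solutions of the Schroedinger equation\<close>


definition locally_integrable :: "(real \<Rightarrow> real) \<Rightarrow> bool" where
  "locally_integrable V \<longleftrightarrow> (\<forall>c\<ge>0. V absolutely_integrable_on {0..c})"

text \<open>The equation as a first-order system for the pair (p, p') in integrated form on a
  compact interval. This form passes to subintervals and linear combinations, and conjugation turns
  z into its conjugate.\<close>

definition solution_on ::
    "(real \<Rightarrow> real) \<Rightarrow> complex \<Rightarrow> real \<Rightarrow> real \<Rightarrow> (real \<Rightarrow> complex) \<Rightarrow> (real \<Rightarrow> complex) \<Rightarrow> bool" where
  "solution_on V z a b p p' \<longleftrightarrow> indef_integral a b p p' \<and>
     indef_integral a b p' (\<lambda>t. (complex_of_real (V t) - z) * p t)"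

lemma locally_integrable_abs_int:
  "locally_integrable V \<Longrightarrow> 0 \<le> a \<Longrightarrow> V absolutely_integrable_on {a..b}"
proof (cases "b \<ge> 0")
  case True
  assume "locally_integrable V" "0 \<le> a"
  then show ?thesis using True absolutely_integrable_on_subinterval[where f = V and S = "{0..b}" and a = a and b = b]
    by (auto simp: locally_integrable_def)
qed (auto simp: absolutely_integrable_on_def)

lemma locally_integrable_abs_integrable:
  "locally_integrable V \<Longrightarrow> 0 \<le> a \<Longrightarrow> (\<lambda>t. \<bar>V t\<bar>) integrable_on {a..b}"
  using locally_integrable_abs_int[of V a b] by (simp add: absolutely_integrable_on_def)

lemma abs_int_of_real_diff:
  fixes V :: "real \<Rightarrow> real"
  assumes "V absolutely_integrable_on {a..b}"
  shows "(\<lambda>t. complex_of_real (V t) - z) absolutely_integrable_on {a..b}"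
proof (rule set_integral_diff)
  show "(\<lambda>t. complex_of_real (V t)) absolutely_integrable_on {a..b}"
    using absolutely_integrable_linear[OF assms bounded_linear_of_real] by (simp add: o_def)
  show "(\<lambda>_. z) absolutely_integrable_on {a..b}"
    by (simp add: absolutely_integrable_on_const)
qed

text \<open>Differentiability makes \<open>F\<close> continuous, hence the integrand absolutely
  integrable; then \<open>F'\<close> is continuous as a primitive, and the fundamental theorem of
  calculus gives the first component.\<close>

lemma schrodinger_solution_on:
  assumes V: "locally_integrable V" and F: "schrodinger_solution V z F F'" and a: "0 \<le> a"
  shows "solution_on V z a b F F'"
proof (cases "0 \<le> b")
  case True
  have cF: "continuous_on {0..b} F"
  proof (rule continuous_on_vector_derivative)
    fix x assume "x \<in> {0..b}"
    then show "(F has_vector_derivative F' x) (at x within {0..b})"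
      using F unfolding schrodinger_solution_def
      by (auto intro: has_vector_derivative_within_subset[where S = "{0..}"])
  qed
  have "(\<lambda>t. (complex_of_real (V t) - z) * F t) absolutely_integrable_on {0..b}"
    by (intro abs_int_mult_continuous abs_int_of_real_diff cF locally_integrable_abs_int[OF V]) simp
  then have F': "indef_integral 0 b F' (\<lambda>t. (complex_of_real (V t) - z) * F t)"
    using F by (intro indef_integralI[where c = "F' 0"]) (auto simp: schrodinger_solution_def)
  have "indef_integral 0 b F F'"
  proof (rule indef_integral_vector_derivative)
    fix x assume "x \<in> {0..b}"
    then show "(F has_vector_derivative F' x) (at x within {0..b})"
      using F unfolding schrodinger_solution_def
      by (auto intro: has_vector_derivative_within_subset[where S = "{0..}"])
  qed (rule indef_integral_continuous[OF F'])
  then show ?thesis using F' a indef_integral_subinterval[OF _ a]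
    unfolding solution_on_def by blast
next
  case False
  then have "{a..b} = {}" using a by auto
  then have "indef_integral a b G g" for G g :: "real \<Rightarrow> complex" using a False
    by (auto simp: indef_integral_def absolutely_integrable_on_def)
  then show ?thesis by (simp add: solution_on_def)
qed

text \<open>\<open>p'\<close> is a primitive, hence continuous, so its own primitive
  \<open>p\<close> is differentiable at every point.\<close>

lemma solution_on_schrodinger:
  assumes p: "\<And>b. 0 \<le> b \<Longrightarrow> solution_on V z 0 b p p'"
  shows "schrodinger_solution V z p p'"
  unfolding schrodinger_solution_def
proof (intro conjI allI impI)
  fix x :: real assume x: "0 \<le> x"
  show "((\<lambda>t. (complex_of_real (V t) - z) * p t) has_integral p' x - p' 0) {0..x}"
    using p[OF x] x unfolding solution_on_def
    by (metis indef_integral_has_integral order_refl)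
  have P: "indef_integral 0 (x+1) p p'" "indef_integral 0 (x+1) p' (\<lambda>t. (complex_of_real (V t) - z) * p t)"
    using p[of "x+1"] x by (auto simp: solution_on_def)
  have "((\<lambda>u. integral {0..u} p') has_vector_derivative p' x) (at x within {0..x+1})"
    using indef_integral_continuous[OF P(2)] x by (intro integral_has_vector_derivative) auto
  then have "((\<lambda>u. p 0 + integral {0..u} p') has_vector_derivative p' x) (at x within {0..x+1})"
    using has_vector_derivative_add[OF has_vector_derivative_const[of "p 0"]] by fastforce
  then have "(p has_vector_derivative p' x) (at x within {0..x+1})"
  proof (rule has_vector_derivative_transform[rotated 2])
    show "x \<in> {0..x+1}" using x by simp
    fix t assume "t \<in> {0..x+1}"
    then show "p t = p 0 + integral {0..t} p'"
      using integral_unique[OF indef_integral_has_integral[OF P(1), of 0 t]] by simp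
  qed
  moreover have "at x within {0..x+1} = at x within {0..}"
    by (rule at_within_nhd[where S = "{..<x+1}"]) auto
  ultimately show "(p has_vector_derivative p' x) (at x within {0..})" by simp
qed

lemma solution_on_subinterval:
  "solution_on V z a b p p' \<Longrightarrow> a \<le> a' \<Longrightarrow> b' \<le> b \<Longrightarrow> solution_on V z a' b' p p'"
  unfolding solution_on_def using indef_integral_subinterval by blast

lemma solution_on_linear:
  assumes "solution_on V z a b p p'" "solution_on V z a b q q'"
  shows "solution_on V z a b (\<lambda>t. c * p t + d * q t) (\<lambda>t. c * p' t + d * q' t)"
  unfolding solution_on_def
proof
  have *: "indef_integral a b p p'" "indef_integral a b p' (\<lambda>t. (complex_of_real (V t) - z) * p t)"
   "indef_integral a b q q'" "indef_integral a b q' (\<lambda>t. (complex_of_real (V t) - z) * q t)"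
    using assms by (auto simp: solution_on_def)
  show "indef_integral a b (\<lambda>t. c * p t + d * q t) (\<lambda>t. c * p' t + d * q' t)"
    by (intro indef_integral_add indef_integral_cmult *)
  show "indef_integral a b (\<lambda>t. c * p' t + d * q' t) (\<lambda>t. (complex_of_real (V t) - z) * (c * p t + d * q t))"
    using indef_integral_add[OF indef_integral_cmult[OF *(2), of c] indef_integral_cmult[OF *(4), of d]]
    by (simp add: algebra_simps)
qed

lemma solution_on_continuous:
  assumes "solution_on V z a b p p'"
  shows "continuous_on {a..b} p" "continuous_on {a..b} p'"
  using assms indef_integral_continuous by (auto simp: solution_on_def)

lemma solution_on_cnj:
  "solution_on V z a b p p' \<Longrightarrow> solution_on V (cnj z) a b (\<lambda>t. cnj (p t)) (\<lambda>t. cnj (p' t))"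
  unfolding solution_on_def using indef_integral_cnj[of a b p p']
    indef_integral_cnj[of a b p' "\<lambda>t. (complex_of_real (V t) - z) * p t"] by simp

text \<open>In (p q' - p' q)' the products p' q' cancel and so does V p q; only the difference of
  the energies survives.\<close>

lemma wronskian_indef_integral:
  assumes "solution_on V z a b p p'" "solution_on V w a b q q'"
  shows "indef_integral a b (\<lambda>t. p t * q' t - p' t * q t) (\<lambda>t. (z - w) * (p t * q t))"
proof -
  have *: "indef_integral a b p p'" "indef_integral a b p' (\<lambda>t. (complex_of_real (V t) - z) * p t)"
   "indef_integral a b q q'" "indef_integral a b q' (\<lambda>t. (complex_of_real (V t) - w) * q t)"
    using assms by (auto simp: solution_on_def)
  show ?thesis
    by (rule indef_integral_eq[OF indef_integral_diff[OF indef_integral_mult[OF *(1) *(4)]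
       indef_integral_mult[OF *(2) *(3)]]]) (auto simp: algebra_simps)
qed

lemma wronskian_constant:
  assumes p: "solution_on V z a b p p'" and q: "solution_on V z a b q q'" and x: "a \<le> x" "x \<le> b"
  shows "p x * q' x - p' x * q x = p a * q' a - p' a * q a"
proof -
  have "((\<lambda>t. (z - z) * (p t * q t)) has_integral (p x * q' x - p' x * q x - (p a * q' a - p' a * q a))) {a..x}"
    using indef_integral_has_integral[OF wronskian_indef_integral[OF p q], of a x] x by auto
  then show ?thesis using has_integral_unique[OF _ has_integral_0] by fastforce
qed

lemma solution_on_norm_sq_integrable:
  assumes "solution_on V z a b p p'" "a \<le> x" "y \<le> b"
  shows "(\<lambda>t. (cmod (p t))\<^sup>2) integrable_on {x..y}"
  using solution_on_continuous(1)[OF assms(1)] assms(2,3)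
  by (intro integrable_continuous_interval continuous_intros) (auto intro: continuous_on_subset)

text \<open>The Wronskian identity for \<open>p\<close> and its conjugate, which solves the equation
  at \<open>cnj z\<close>. The quantity Im (cnj p p') acts as a flux: for Im z > 0 it does not
  increase with x, and its loss over an interval is Im z times the mass of |p|^2 there.\<close>

lemma green_identity:
  assumes p: "solution_on V z a b p p'" and x: "a \<le> x" "x \<le> y" "y \<le> b"
  shows "Im z * integral {x..y} (\<lambda>t. (cmod (p t))\<^sup>2) = Im (cnj (p x) * p' x) - Im (cnj (p y) * p' y)"
proof -
  let ?W = "\<lambda>t. p t * cnj (p' t) - p' t * cnj (p t)"
  have W: "?W t = - 2 * \<i> * of_real (Im (cnj (p t) * p' t))" for t
    by (simp add: complex_eq_iff)
  have i: "(\<lambda>t. (cmod (p t))\<^sup>2) integrable_on {x..y}"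
    using solution_on_norm_sq_integrable[OF p x(1) x(3)] .
  have "((\<lambda>t. (z - cnj z) * (p t * cnj (p t))) has_integral (?W y - ?W x)) {x..y}"
    using indef_integral_has_integral[OF wronskian_indef_integral[OF p solution_on_cnj[OF p]]] x by auto
  moreover have "(z - cnj z) * (p t * cnj (p t)) = (2 * \<i> * of_real (Im z)) * of_real ((cmod (p t))\<^sup>2)" for t
    using complex_norm_square[of "p t"] by (simp add: complex_diff_cnj)
  ultimately have "((\<lambda>t. (2 * \<i> * of_real (Im z)) * of_real ((cmod (p t))\<^sup>2)) has_integral (?W y - ?W x)) {x..y}"
    by simp
  moreover have "((\<lambda>t. (2 * \<i> * of_real (Im z)) * of_real ((cmod (p t))\<^sup>2)) has_integral
      ((2 * \<i> * of_real (Im z)) * of_real (integral {x..y} (\<lambda>t. (cmod (p t))\<^sup>2)))) {x..y}"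
    using has_integral_linear[OF integrable_integral[OF i] bounded_linear_of_real]
    by (intro has_integral_mult_right) (simp add: o_def)
  ultimately have "?W y - ?W x = (2 * \<i> * of_real (Im z)) * of_real (integral {x..y} (\<lambda>t. (cmod (p t))\<^sup>2))"
    by (rule has_integral_unique)
  then show ?thesis unfolding W by (simp add: complex_eq_iff)
qed

section \<open>Pointwise control of a solution on a short interval with little potential\<close>

lemma derivative_variation_bound:
  assumes V: "(\<lambda>t. \<bar>V t\<bar>) integrable_on {x..y}" and p: "solution_on V z a b p p'"
    and x: "a \<le> x" "x \<le> y" "y \<le> b" and z: "cmod z \<le> R"
    and M: "\<And>t. t \<in> {x..y} \<Longrightarrow> cmod (p t) \<le> M"
  shows "cmod (p' y - p' x) \<le> M * (integral {x..y} (\<lambda>t. \<bar>V t\<bar>) + R * (y - x))"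
proof -
  have P: "((\<lambda>t. (complex_of_real (V t) - z) * p t) has_integral (p' y - p' x)) {x..y}"
    using p x indef_integral_has_integral unfolding solution_on_def by blast
  have "cmod (p' y - p' x) \<le> M * integral {x..y} (\<lambda>t. \<bar>V t\<bar> + R)"
  proof (rule integral_bound_sup[OF P])
    show "(\<lambda>t. \<bar>V t\<bar> + R) integrable_on {x..y}"
      using V by (intro integrable_add) auto
    fix t assume t: "t \<in> {x..y}"
    have "cmod (complex_of_real (V t) - z) \<le> \<bar>V t\<bar> + R"
      using norm_triangle_ineq4[of "complex_of_real (V t)" z] z by simp
    then have "cmod ((complex_of_real (V t) - z) * p t) \<le> (\<bar>V t\<bar> + R) * M"
      unfolding norm_mult using M[OF t] order_trans[OF norm_ge_zero z]
      by (intro mult_mono) auto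
    then show "cmod ((complex_of_real (V t) - z) * p t) \<le> M * (\<bar>V t\<bar> + R)"
      by (simp add: mult.commute)
  qed
  also have "integral {x..y} (\<lambda>t. \<bar>V t\<bar> + R) = integral {x..y} (\<lambda>t. \<bar>V t\<bar>) + R * (y - x)"
    using V x by (subst integral_add) auto
  finally show ?thesis .
qed

text \<open>On a short interval with little potential a solution is nearly affine, so two of its values
  control it together with its derivative.\<close>

lemma two_point_bound:
  assumes V: "(\<lambda>t. \<bar>V t\<bar>) integrable_on {s..s+l}" "integral {s..s+l} (\<lambda>t. \<bar>V t\<bar>) \<le> 1 / 4"
    and R: "R \<ge> 1" "cmod z \<le> R" "l = 1 / (4 * R)"
    and p: "solution_on V z s (s+l) p p'"
    and t: "s \<le> t1" "t1 + l / 3 \<le> t2" "t2 \<le> s + l"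
    and B: "cmod (p t1) \<le> B" "cmod (p t2) \<le> B"
    and r: "r \<in> {s..s+l}"
  shows "cmod (p r) \<le> 14 * B" "cmod (p' r) \<le> 13 * B / l"
proof -
  have l: "0 < l" "R * l = 1/4" "l \<le> 1/4" using R(1) unfolding R(3) by (auto simp: field_simps)
  have c: "continuous_on {s..s+l} (\<lambda>t. cmod (p t))"
    using solution_on_continuous(1)[OF p] by (intro continuous_intros)
  obtain tm where tm: "tm \<in> {s..s+l}" "\<And>t. t \<in> {s..s+l} \<Longrightarrow> cmod (p t) \<le> cmod (p tm)"
    using continuous_attains_sup[OF _ _ c] l by fastforce
  define M where "M = cmod (p tm)"
  have M: "cmod (p t) \<le> M" if "t \<in> {s..s+l}" for t using tm(2)[OF that] by (simp add: M_def)
  have M0: "M \<ge> 0" by (simp add: M_def)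
  \<comment> \<open>Potential and energy weigh at most 1/4 each over the whole interval;
    \<open>l = 1 / (4 * R)\<close> is made for the second 1/4.\<close>
  have D: "cmod (p' y - p' x) \<le> M / 2" if x: "s \<le> x" "x \<le> y" "y \<le> s + l" for x y
  proof -
    have i: "(\<lambda>t. \<bar>V t\<bar>) integrable_on {x..y}"
      using V(1) x by (auto intro: integrable_on_subinterval)
    have "cmod (p' y - p' x) \<le> M * (integral {x..y} (\<lambda>t. \<bar>V t\<bar>) + R * (y - x))"
      using x M by (intro derivative_variation_bound[OF i p x R(2)]) auto
    also have "integral {x..y} (\<lambda>t. \<bar>V t\<bar>) \<le> integral {s..s+l} (\<lambda>t. \<bar>V t\<bar>)"
      using x by (intro integral_subset_le i V) auto
    also have "R * (y - x) \<le> R * l" using x R by (intro mult_left_mono) auto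
    also have "M * (integral {s..s+l} (\<lambda>t. \<bar>V t\<bar>) + R * l) \<le> M * (1/2)"
      using V(2) l M0 by (intro mult_left_mono) auto
    finally show ?thesis using M0 by (simp add: mult_left_mono)
  qed
  have D': "cmod (p' x - p' t1) \<le> M / 2" if "x \<in> {s..s+l}" for x
    using D[of x t1] D[of t1 x] that t l by (cases "x \<le> t1") (auto simp: norm_minus_commute)
  \<comment> \<open>Deviation from the affine function with slope p'(t1): the slope varies by at
    most M/2 over a length of at most 1/4.\<close>
  have A: "cmod (p y - p x - of_real (y - x) * p' t1) \<le> M / 8" if x: "s \<le> x" "x \<le> y" "y \<le> s + l" for x y
  proof -
    have "(p' has_integral (p y - p x)) {x..y}"
      using p x indef_integral_has_integral unfolding solution_on_def by blast
    then have "((\<lambda>t. p' t - p' t1) has_integral (p y - p x - (y - x) *\<^sub>R p' t1)) {x..y}"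
      using has_integral_const_real[of "p' t1" x y] x by (intro has_integral_diff) auto
    then have "cmod (p y - p x - (y - x) *\<^sub>R p' t1) \<le> M / 2 * integral {x..y} (\<lambda>_. 1)"
      using x D' by (intro integral_bound_sup) auto
    also have "\<dots> = M / 2 * (y - x)" using x by simp
    also have "\<dots> \<le> M / 2 * (1 / 4)" using x l M0 by (intro mult_left_mono) auto
    finally show ?thesis by (simp add: scaleR_conv_of_real)
  qed
  have t12: "t1 \<le> t2" using t l by linarith
  have "cmod (of_real (t2 - t1) * p' t1) \<le> M / 8 + 2 * B"
  proof -
    have "of_real (t2 - t1) * p' t1 = p t2 - p t1 - (p t2 - p t1 - of_real (t2 - t1) * p' t1)" by simp
    also have "cmod \<dots> \<le> cmod (p t2) + cmod (p t1) + cmod (p t2 - p t1 - of_real (t2 - t1) * p' t1)"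
      by (meson add_mono norm_triangle_ineq4 norm_triangle_le_diff order_refl order_trans)
    also have "\<dots> \<le> M / 8 + 2 * B" using A[OF t(1) t12 t(3)] B by linarith
    finally show ?thesis .
  qed
  moreover have "l / 3 * cmod (p' t1) \<le> (t2 - t1) * cmod (p' t1)"
    using t by (intro mult_right_mono) auto
  ultimately have P': "l * cmod (p' t1) \<le> 6 * B + 3 * M / 8"
    using t12 by (simp add: norm_mult norm_of_real del: of_real_diff)
  have P: "cmod (p x) \<le> 7 * B + M / 2" if x: "x \<in> {s..s+l}" for x
  proof -
    define d where "d = p x - p t1 - of_real (x - t1) * p' t1"
    have d: "cmod d \<le> M / 8"
    proof (cases "t1 \<le> x")
      case False
      then have "cmod (p t1 - p x - of_real (t1 - x) * p' t1) \<le> M / 8" using A[of x t1] x t t12 by auto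
      moreover have "d = - (p t1 - p x - of_real (t1 - x) * p' t1)" by (simp add: d_def algebra_simps)
      ultimately show ?thesis by (metis norm_minus_cancel)
    qed (use A[of t1 x] x t in \<open>auto simp: d_def\<close>)
    have "p x = p t1 + (of_real (x - t1) * p' t1 + d)" by (simp add: d_def)
    also have "cmod \<dots> \<le> cmod (p t1) + (cmod (of_real (x - t1) * p' t1) + cmod d)"
      by (meson add_left_mono norm_triangle_ineq order_trans)
    also have "cmod (of_real (x - t1) * p' t1) = \<bar>x - t1\<bar> * cmod (p' t1)"
      by (metis norm_mult norm_of_real)
    also have "\<dots> \<le> l * cmod (p' t1)"
      using x t t12 by (intro mult_right_mono) auto
    finally show ?thesis using P' B(1) d by simp
  qed
  \<comment> \<open>At a point where |p| attains its maximum \<open>M\<close> the bound reads M <= 7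
    B + M/2, so the deviation from the affine function is absorbed.\<close>
  have M14: "M \<le> 14 * B" using P[OF tm(1)] by (simp add: M_def)
  show "cmod (p r) \<le> 14 * B" using M[OF r] M14 by simp
  have "cmod (p' r) \<le> cmod (p' t1) + M / 2"
    using D'[OF r] norm_triangle_sub[of "p' r" "p' t1"] by linarith
  then have "l * cmod (p' r) \<le> l * (cmod (p' t1) + M / 2)"
    using l by (intro mult_left_mono) auto
  then have "l * cmod (p' r) \<le> l * cmod (p' t1) + l * (M / 2)"
    by (simp only: distrib_left)
  also have "l * (M / 2) \<le> 1/4 * (M / 2)" using l M0 by (intro mult_right_mono) auto
  finally have "l * cmod (p' r) \<le> 13 * B" using P' M14 by simp
  then show "cmod (p' r) \<le> 13 * B / l" using l by (simp add: field_simps)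
qed

lemma exists_le_average:
  fixes g :: "real \<Rightarrow> real"
  assumes g: "continuous_on {a..b} g" and ab: "a < b"
  obtains t where "t \<in> {a..b}" "(b - a) * g t \<le> integral {a..b} g"
proof -
  obtain t where t: "t \<in> {a..b}" "\<And>x. x \<in> {a..b} \<Longrightarrow> g t \<le> g x"
    using continuous_attains_inf[OF _ _ g] ab by fastforce
  have "integral {a..b} (\<lambda>_. g t) \<le> integral {a..b} g"
    using t g by (intro integral_le integrable_continuous_interval) auto
  then show ?thesis using that t(1) ab by (simp add: mult.commute)
qed

text \<open>In the first and in the last third of the interval there is a point where |p|^2 is at
  most its mean over that third; two such points are far enough apart for
  \<open>two_point_bound\<close>.\<close>

lemma mean_square_bound:
  assumes V: "(\<lambda>t. \<bar>V t\<bar>) integrable_on {s..s+l}" "integral {s..s+l} (\<lambda>t. \<bar>V t\<bar>) \<le> 1 / 4"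
    and R: "R \<ge> 1" "cmod z \<le> R" "l = 1 / (4 * R)"
    and p: "solution_on V z s (s+l) p p'"
    and r: "r \<in> {s..s+l}"
  shows "cmod (p r) \<le> 14 * sqrt (3 / l * integral {s..s+l} (\<lambda>t. (cmod (p t))\<^sup>2))"
    and "cmod (p' r) \<le> 13 * sqrt (3 / l * integral {s..s+l} (\<lambda>t. (cmod (p t))\<^sup>2)) / l"
proof -
  let ?g = "\<lambda>t. (cmod (p t))\<^sup>2"
  let ?B = "sqrt (3 / l * integral {s..s+l} ?g)"
  have l: "l > 0" using R by auto
  have c: "continuous_on {x..y} ?g" if "s \<le> x" "y \<le> s + l" for x y
    using continuous_on_subset[OF solution_on_continuous(1)[OF p], of "{x..y}"] that
    by (intro continuous_intros) auto
  have *: "\<exists>t\<in>{x..x+l/3}. cmod (p t) \<le> ?B" if x: "s \<le> x" "x + l/3 \<le> s + l" for x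
  proof -
    obtain t where t: "t \<in> {x..x+l/3}" "(x + l/3 - x) * ?g t \<le> integral {x..x+l/3} ?g"
      using exists_le_average[of x "x+l/3" ?g] c x l by auto
    have "integral {x..x+l/3} ?g \<le> integral {s..s+l} ?g"
      using x l by (intro integral_subset_le integrable_continuous_interval c) auto
    then have "?g t \<le> 3 / l * integral {s..s+l} ?g" using t(2) l by (simp add: field_simps)
    then have "cmod (p t) \<le> ?B" using real_le_rsqrt by blast
    then show ?thesis using t(1) by blast
  qed
  obtain t1 where t1: "t1 \<in> {s..s+l/3}" "cmod (p t1) \<le> ?B" using *[of s] l by auto
  obtain t2 where t2: "t2 \<in> {s+2*l/3..s+2*l/3+l/3}" "cmod (p t2) \<le> ?B" using *[of "s+2*l/3"] l by (auto simp: field_simps)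
  show "cmod (p r) \<le> 14 * ?B" "cmod (p' r) \<le> 13 * ?B / l"
    using two_point_bound[OF V R p, of t1 t2 ?B r] t1 t2 r by auto
qed

section \<open>Fundamental solutions\<close>


lemma indef_integral_integral:
  fixes f :: "real \<Rightarrow> 'a::euclidean_space"
  assumes f: "f absolutely_integrable_on {a..b}"
  shows "indef_integral a b (\<lambda>x. integral {a..x} f) f"
proof (rule indef_integralI[where c = 0, OF f])
  fix x assume "a \<le> x" "x \<le> b"
  then have "f integrable_on {a..x}"
    using absolutely_integrable_on_subinterval[OF f, of a x] by (auto simp: absolutely_integrable_on_def)
  then show "(f has_integral (integral {a..x} f - 0)) {a..x}" by (simp add: has_integral_integral)
qed

lemma indef_integral_limit:
  fixes f :: "nat \<Rightarrow> real \<Rightarrow> 'a::euclidean_space"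
  assumes F: "\<And>k. indef_integral a b (F k) (f k)"
    and h: "h integrable_on {a..b}" "\<And>k t. t \<in> {a..b} \<Longrightarrow> norm (f k t) \<le> h t"
    and lim: "\<And>t. t \<in> {a..b} \<Longrightarrow> (\<lambda>k. f k t) \<longlonglongrightarrow> g t" "\<And>t. t \<in> {a..b} \<Longrightarrow> (\<lambda>k. F k t) \<longlonglongrightarrow> G t"
  shows "indef_integral a b G g"
proof (rule indef_integralI[where c = "G a"])
  have "norm (g t) \<le> h t" if "t \<in> {a..b}" for t
    using LIMSEQ_le_const2[OF tendsto_norm[OF lim(1)[OF that]]] h(2)[OF that] by blast
  then show "g absolutely_integrable_on {a..b}"
    using F by (intro dominated_convergence_absolutely_integrable[OF _ h(1) _ lim(1)])
      (auto simp: indef_integral_def)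
  fix x assume x: "a \<le> x" "x \<le> b"
  show "(g has_integral (G x - G a)) {a..x}"
  proof (rule has_integral_dominated_convergence)
    show "(f k has_integral (F k x - F k a)) {a..x}" for k
      using indef_integral_has_integral[OF F] x by auto
    show "h integrable_on {a..x}" using h(1) x by (auto intro: integrable_on_subinterval)
    show "(\<lambda>k. F k x - F k a) \<longlonglongrightarrow> G x - G a" using x by (intro tendsto_diff lim) auto
  qed (use h lim x in auto)
qed

text \<open>Supplies the factorial in the Picard estimate: integrating \<phi> \<Phi>^n, with \<Phi>
  a primitive of \<phi> that vanishes at the left end, produces \<Phi>^(n+1) / (n+1).\<close>

lemma indef_integral_power:
  fixes F f :: "real \<Rightarrow> real"
  assumes F: "indef_integral a b F f"
  shows "indef_integral a b (\<lambda>t. F t ^ Suc n) (\<lambda>t. real (Suc n) * (f t * F t ^ n))"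
proof (induction n)
  case 0
  then show ?case using F by simp
next
  case (Suc n)
  show ?case
    by (rule indef_integral_eq[OF indef_integral_mult[OF F Suc]]) (auto simp: algebra_simps)
qed

definition picard_deriv :: "(real \<Rightarrow> real) \<Rightarrow> complex \<Rightarrow> (real \<Rightarrow> complex) \<Rightarrow> real \<Rightarrow> complex" where
  "picard_deriv V z f s = integral {0..s} (\<lambda>t. (complex_of_real (V t) - z) * f t)"

text \<open>These are the summands of the Picard series, not its iterates: term 0 is the affine
  function with the given data, and each further term is the correction that \<open>V - z\<close>
  produces from the term before.\<close>

primrec picard :: "(real \<Rightarrow> real) \<Rightarrow> complex \<Rightarrow> complex \<Rightarrow> complex \<Rightarrow> nat \<Rightarrow> real \<Rightarrow> complex" where
  "picard V z c0 c1 0 = (\<lambda>x. c0 + of_real x * c1)"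
| "picard V z c0 c1 (Suc n) = (\<lambda>x. integral {0..x} (picard_deriv V z (picard V z c0 c1 n)))"

primrec picard' :: "(real \<Rightarrow> real) \<Rightarrow> complex \<Rightarrow> complex \<Rightarrow> complex \<Rightarrow> nat \<Rightarrow> real \<Rightarrow> complex" where
  "picard' V z c0 c1 0 = (\<lambda>x. c1)"
| "picard' V z c0 c1 (Suc n) = picard_deriv V z (picard V z c0 c1 n)"

text \<open>The solution with value \<open>c0\<close> and derivative \<open>c1\<close> at 0.
  \<open>ivp V 0 1\<close> satisfies the Dirichlet condition and \<open>ivp V 1 0\<close> the
  Neumann condition; these two are the fundamental solutions used throughout.\<close>

definition ivp :: "(real \<Rightarrow> real) \<Rightarrow> complex \<Rightarrow> complex \<Rightarrow> complex \<Rightarrow> real \<Rightarrow> complex" where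
  "ivp V c0 c1 z x = (\<Sum>n. picard V z c0 c1 n x)"

definition ivp' :: "(real \<Rightarrow> real) \<Rightarrow> complex \<Rightarrow> complex \<Rightarrow> complex \<Rightarrow> real \<Rightarrow> complex" where
  "ivp' V c0 c1 z x = (\<Sum>n. picard' V z c0 c1 n x)"

lemma picard_deriv_indef:
  assumes V: "locally_integrable V" and f: "continuous_on {0..b} f"
  shows "indef_integral 0 b (picard_deriv V z f) (\<lambda>t. (complex_of_real (V t) - z) * f t)"
  unfolding picard_deriv_def
  by (intro indef_integral_integral abs_int_mult_continuous abs_int_of_real_diff locally_integrable_abs_int V f) simp

lemma picard_indef:
  assumes V: "locally_integrable V"
  shows "indef_integral 0 b (picard V z c0 c1 n) (picard' V z c0 c1 n)"
proof (induction n)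
  case 0
  have "indef_integral 0 b (\<lambda>x. c0 + of_real x * c1) (\<lambda>_. c1)"
    by (rule indef_integral_vector_derivative) (auto intro!: derivative_eq_intros)
  then show ?case by simp
next
  case (Suc n)
  have "continuous_on {0..b} (picard_deriv V z (picard V z c0 c1 n))"
    using indef_integral_continuous[OF picard_deriv_indef[OF V indef_integral_continuous[OF Suc]]] .
  then have "picard_deriv V z (picard V z c0 c1 n) absolutely_integrable_on {0..b}"
    by (metis absolutely_integrable_continuous box_real(2))
  then show ?case by (simp add: indef_integral_integral)
qed

lemma picard'_indef:
  assumes V: "locally_integrable V"
  shows "indef_integral 0 b (picard' V z c0 c1 (Suc n)) (\<lambda>t. (complex_of_real (V t) - z) * picard V z c0 c1 n t)"
  using picard_deriv_indef[OF V indef_integral_continuous[OF picard_indef[OF V]]] by simp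

text \<open>With the weight \<open>\<phi>\<close> = b (|V| + R) and its primitive
  \<open>\<Phi>\<close>, induction gives the bound K \<Phi>(x)^n / n!. The factor b in the weight
  pays for the second integration, over a length of at most b; since b >= 1, the same bound covers
  the derivative.\<close>

lemma picard_bound:
  fixes c0 c1 :: complex
  assumes V: "locally_integrable V" and b: "1 \<le> b" and z: "cmod z \<le> R"
  defines "A \<equiv> b * (integral {0..b} (\<lambda>t. \<bar>V t\<bar>) + R * b)" and "K \<equiv> cmod c0 + b * cmod c1"
  assumes x: "x \<in> {0..b}"
  shows "cmod (picard V z c0 c1 n x) \<le> K * (A ^ n / fact n)"
    and "cmod (picard' V z c0 c1 n x) \<le> K * (A ^ n / fact n)"
proof -
  define \<phi> where "\<phi> t = b * (\<bar>V t\<bar> + R)" for t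
  define \<Phi> where "\<Phi> x = integral {0..x} \<phi>" for x
  have R: "R \<ge> 0" using z norm_ge_zero order_trans by blast
  have K: "K \<ge> 0" "cmod c1 \<le> K"
    using b mult_right_mono[of 1 b "cmod c1"] by (auto simp: K_def intro: add_increasing)
  have Vi: "(\<lambda>t. \<bar>V t\<bar>) integrable_on {0..b}" using locally_integrable_abs_integrable[OF V] by simp
  have \<phi>0: "\<phi> t \<ge> 0" for t using R b by (simp add: \<phi>_def)
  have \<phi>i: "(\<phi> has_integral A) {0..b}"
    unfolding \<phi>_def A_def using b
    by (intro has_integral_mult_right has_integral_add integrable_integral Vi)
      (use has_integral_const_real[of R 0 b] in \<open>simp add: mult.commute\<close>)
  have \<phi>a: "\<phi> absolutely_integrable_on {0..b}"
    using \<phi>i \<phi>0 by (auto intro: nonnegative_absolutely_integrable_1 simp: integrable_on_def)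
  have \<Phi>: "indef_integral 0 b \<Phi> \<phi>" unfolding \<Phi>_def by (rule indef_integral_integral[OF \<phi>a])
  have \<phi>I: "\<phi> integrable_on {0..x}" if "x \<le> b" for x
    using integrable_on_subinterval[OF has_integral_integrable[OF \<phi>i], of 0 x] that by simp
  have \<Phi>0: "0 \<le> \<Phi> x" for x unfolding \<Phi>_def using \<phi>0 by (cases "\<phi> integrable_on {0..x}") (auto intro: integral_nonneg simp: not_integrable_integral)
  have \<Phi>mono: "\<Phi> x \<le> \<Phi> y" if "x \<le> y" "y \<le> b" for x y
    unfolding \<Phi>_def using that \<phi>0 by (intro integral_subset_le \<phi>I) auto
  have \<Phi>A: "\<Phi> x \<le> A" if "x \<le> b" for x
    using \<Phi>mono[of x b] that integral_unique[OF \<phi>i] by (simp add: \<Phi>_def)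
  have *: "\<forall>x\<in>{0..b}. cmod (picard V z c0 c1 n x) \<le> K * (\<Phi> x ^ n / fact n) \<and>
       cmod (picard' V z c0 c1 n x) \<le> K * (\<Phi> x ^ n / fact n)" for n
  proof (induction n)
    case 0
    have "cmod (c0 + of_real x * c1) \<le> K" if "x \<in> {0..b}" for x
    proof -
      have "cmod (c0 + of_real x * c1) \<le> cmod c0 + x * cmod c1"
        using that norm_triangle_ineq[of c0 "of_real x * c1"] by (simp add: norm_mult)
      also have "x * cmod c1 \<le> b * cmod c1" using that by (intro mult_right_mono) auto
      finally show ?thesis by (simp add: K_def)
    qed
    then show ?case using K by simp
  next
    case (Suc n)
    have 1: "b * cmod (picard' V z c0 c1 (Suc n) s) \<le> K * (\<Phi> s ^ Suc n / fact (Suc n))" if s: "s \<in> {0..b}" for s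
    proof -
      have P: "((\<lambda>t. (complex_of_real (V t) - z) * picard V z c0 c1 n t) has_integral picard' V z c0 c1 (Suc n) s) {0..s}"
        using indef_integral_has_integral[OF picard'_indef[OF V, of b z c0 c1 n], of 0 s] s
        by (simp add: picard_deriv_def)
      have Q: "((\<lambda>t. real (Suc n) * (\<phi> t * \<Phi> t ^ n)) has_integral (\<Phi> s ^ Suc n)) {0..s}"
        using indef_integral_has_integral[OF indef_integral_power[OF \<Phi>], of 0 s] s by (simp add: \<Phi>_def)
      have "cmod (of_real b * picard' V z c0 c1 (Suc n) s) \<le> (K / fact (Suc n)) * integral {0..s} (\<lambda>t. real (Suc n) * (\<phi> t * \<Phi> t ^ n))"
      proof (rule integral_bound_sup[OF has_integral_mult_right[OF P]])
        show "(\<lambda>t. real (Suc n) * (\<phi> t * \<Phi> t ^ n)) integrable_on {0..s}" using Q by (auto simp: integrable_on_def)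
        fix t assume t: "t \<in> {0..s}"
        have "cmod (complex_of_real (V t) - z) \<le> \<bar>V t\<bar> + R"
          using norm_triangle_ineq4[of "complex_of_real (V t)" z] z by simp
        then have "b * cmod (complex_of_real (V t) - z) \<le> \<phi> t" unfolding \<phi>_def using b by (intro mult_left_mono) auto
        then have "(b * cmod (complex_of_real (V t) - z)) * cmod (picard V z c0 c1 n t) \<le> \<phi> t * (K * (\<Phi> t ^ n / fact n))"
          using Suc t s b \<phi>0[of t] by (intro mult_mono) auto
        also have "\<dots> = K / fact (Suc n) * (real (Suc n) * (\<phi> t * \<Phi> t ^ n))"
          by (simp add: field_simps del: of_nat_Suc)
        finally show "cmod (of_real b * ((complex_of_real (V t) - z) * picard V z c0 c1 n t)) \<le> K / fact (Suc n) * (real (Suc n) * (\<phi> t * \<Phi> t ^ n))"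
          using b by (simp add: norm_mult mult.assoc)
      qed
      then show ?thesis using b integral_unique[OF Q] by (simp add: norm_mult field_simps)
    qed
    have K\<Phi>: "0 \<le> K * (\<Phi> s ^ Suc n / fact (Suc n))" for s using K \<Phi>0 by simp
    have 2: "cmod (picard V z c0 c1 (Suc n) x) \<le> K * (\<Phi> x ^ Suc n / fact (Suc n))" if x: "x \<in> {0..b}" for x
    proof -
      have P: "(picard' V z c0 c1 (Suc n) has_integral picard V z c0 c1 (Suc n) x) {0..x}"
        using indef_integral_has_integral[OF picard_indef[OF V, of b z c0 c1 "Suc n"], of 0 x] x by simp
      have "cmod (picard V z c0 c1 (Suc n) x) \<le> (K * (\<Phi> x ^ Suc n / fact (Suc n)) / b) * integral {0..x} (\<lambda>_. 1)"
      proof (rule integral_bound_sup[OF P])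
        fix t assume t: "t \<in> {0..x}"
        have "b * cmod (picard' V z c0 c1 (Suc n) t) \<le> K * (\<Phi> t ^ Suc n / fact (Suc n))" using 1 t x by auto
        also have "\<dots> \<le> K * (\<Phi> x ^ Suc n / fact (Suc n))"
          using t x K \<Phi>0 by (intro mult_left_mono divide_right_mono power_mono \<Phi>mono) auto
        finally have "cmod (picard' V z c0 c1 (Suc n) t) * b \<le> K * (\<Phi> x ^ Suc n / fact (Suc n))"
          by (simp only: mult.commute)
        moreover have "0 < b" using b by simp
        ultimately show "cmod (picard' V z c0 c1 (Suc n) t) \<le> K * (\<Phi> x ^ Suc n / fact (Suc n)) / b * 1"
          by (simp only: mult_1_right pos_le_divide_eq)
      qed auto
      also have "\<dots> = K * (\<Phi> x ^ Suc n / fact (Suc n)) * (x / b)" using x by simp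
      also have "\<dots> \<le> K * (\<Phi> x ^ Suc n / fact (Suc n)) * 1"
        using x b K\<Phi>[of x] by (intro mult_left_mono) auto
      finally show ?thesis by simp
    qed
    have 3: "cmod (picard' V z c0 c1 (Suc n) x) \<le> K * (\<Phi> x ^ Suc n / fact (Suc n))" if x: "x \<in> {0..b}" for x
      using 1[OF x] b mult_right_mono[of 1 b "cmod (picard' V z c0 c1 (Suc n) x)"] by simp
    show ?case using 2 3 by blast
  qed
  have "K * (\<Phi> x ^ n / fact n) \<le> K * (A ^ n / fact n)"
    using x K \<Phi>0 \<Phi>A by (intro mult_left_mono divide_right_mono power_mono) auto
  then show "cmod (picard V z c0 c1 n x) \<le> K * (A ^ n / fact n)" "cmod (picard' V z c0 c1 n x) \<le> K * (A ^ n / fact n)"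
    using *[of n] x by force+
qed

text \<open>The series are dominated termwise by that of K exp A, so the integral equations of the
  partial sums pass to the limit by dominated convergence.\<close>

lemma ivp_facts:
  fixes c0 c1 :: complex
  assumes V: "locally_integrable V" and b: "1 \<le> b" and z: "cmod z \<le> R"
  defines "A \<equiv> b * (integral {0..b} (\<lambda>t. \<bar>V t\<bar>) + R * b)" and "K \<equiv> cmod c0 + b * cmod c1"
  shows "solution_on V z 0 b (ivp V c0 c1 z) (ivp' V c0 c1 z)"
    and "\<And>x. x \<in> {0..b} \<Longrightarrow> cmod (ivp V c0 c1 z x) \<le> K * exp A"
    and "\<And>x. x \<in> {0..b} \<Longrightarrow> cmod (ivp' V c0 c1 z x) \<le> K * exp A"
proof -
  have E: "(\<lambda>n. K * (A ^ n / fact n)) sums (K * exp A)"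
    using exp_converges[of A] by (intro sums_mult) (simp add: divide_inverse mult.commute)
  have R: "R \<ge> 0" using z norm_ge_zero order_trans by blast
  have A0: "A \<ge> 0"
    using b R locally_integrable_abs_integrable[OF V] unfolding A_def
    by (intro mult_nonneg_nonneg add_nonneg_nonneg integral_nonneg) auto
  have K0: "K \<ge> 0" using b by (simp add: K_def)
  have B: "cmod (picard V z c0 c1 n x) \<le> K * (A ^ n / fact n)"
     "cmod (picard' V z c0 c1 n x) \<le> K * (A ^ n / fact n)" if "x \<in> {0..b}" for n x
    using picard_bound[OF V b z that] unfolding A_def K_def by blast+
  have S: "summable (\<lambda>n. picard V z c0 c1 n x)" "summable (\<lambda>n. picard' V z c0 c1 n x)" if "x \<in> {0..b}" for x
    using summable_comparison_test'[OF sums_summable[OF E]] B that by metis+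
  have L: "(\<lambda>N. \<Sum>n<N. picard V z c0 c1 n x) \<longlonglongrightarrow> ivp V c0 c1 z x"
     "(\<lambda>N. \<Sum>n<N. picard' V z c0 c1 n x) \<longlonglongrightarrow> ivp' V c0 c1 z x" if "x \<in> {0..b}" for x
    unfolding ivp_def ivp'_def using S[OF that] summable_LIMSEQ by blast+
  have PB: "(\<Sum>n<N. K * (A ^ n / fact n)) \<le> K * exp A" for N
    using sum_le_suminf[OF sums_summable[OF E], of "{..<N}"] A0 K0 sums_unique[OF E] by simp
  have FB: "cmod (\<Sum>n<N. picard V z c0 c1 n x) \<le> K * exp A" "cmod (\<Sum>n<N. picard' V z c0 c1 n x) \<le> K * exp A"
    if x: "x \<in> {0..b}" for N x
    by (rule order_trans[OF sum_norm_le PB], use B[OF x] in blast)+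
  show "cmod (ivp V c0 c1 z x) \<le> K * exp A" if x: "x \<in> {0..b}" for x
    using LIMSEQ_le_const2[OF tendsto_norm[OF L(1)[OF x]]] FB[OF x] by blast
  show "cmod (ivp' V c0 c1 z x) \<le> K * exp A" if x: "x \<in> {0..b}" for x
    using LIMSEQ_le_const2[OF tendsto_norm[OF L(2)[OF x]]] FB[OF x] by blast
  show "solution_on V z 0 b (ivp V c0 c1 z) (ivp' V c0 c1 z)"
    unfolding solution_on_def
  proof
    have S: "indef_integral 0 b (\<lambda>t. \<Sum>n<N. picard V z c0 c1 n t) (\<lambda>t. \<Sum>n<N. picard' V z c0 c1 n t)" for N
    proof (induction N)
      case 0
      then show ?case by (auto simp: indef_integral_def absolutely_integrable_on_def)
    next
      case (Suc N)
      show ?case using indef_integral_add[OF Suc picard_indef[OF V]] by simp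
    qed
    show "indef_integral 0 b (ivp V c0 c1 z) (ivp' V c0 c1 z)"
    proof (rule indef_integral_limit[where F = "\<lambda>N t. \<Sum>n<N. picard V z c0 c1 n t" and
          f = "\<lambda>N t. \<Sum>n<N. picard' V z c0 c1 n t", OF S])
      show "(\<lambda>_. K * exp A) integrable_on {0..b}" by auto
    qed (use L FB in blast)+
    \<comment> \<open>The derivatives take one summand more: their term 0 is the constant
      \<open>c1\<close>, and their term n + 1 is the primitive of V - z times term n of the
      solution.\<close>
    have I: "indef_integral 0 b (\<lambda>t. \<Sum>n<Suc N. picard' V z c0 c1 n t)
         (\<lambda>t. (complex_of_real (V t) - z) * (\<Sum>n<N. picard V z c0 c1 n t))" for N
    proof (induction N)
      case 0
      then show ?case by (auto simp: indef_integral_def absolutely_integrable_on_def)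
    next
      case (Suc N)
      show ?case using indef_integral_add[OF Suc picard'_indef[OF V]] by (simp add: algebra_simps)
    qed
    show "indef_integral 0 b (ivp' V c0 c1 z) (\<lambda>t. (complex_of_real (V t) - z) * ivp V c0 c1 z t)"
    proof (rule indef_integral_limit[where F = "\<lambda>N t. \<Sum>n<Suc N. picard' V z c0 c1 n t" and
          f = "\<lambda>N t. (complex_of_real (V t) - z) * (\<Sum>n<N. picard V z c0 c1 n t)", OF I])
      show "(\<lambda>t. cmod (complex_of_real (V t) - z) * (K * exp A)) integrable_on {0..b}"
        using abs_int_of_real_diff[OF locally_integrable_abs_int[OF V, of 0 b], of z]
        by (intro integrable_on_mult_left) (auto simp: absolutely_integrable_on_def)
      fix t assume t: "t \<in> {0..b}"
      show "cmod ((complex_of_real (V t) - z) * (\<Sum>n<N. picard V z c0 c1 n t)) \<le> cmod (complex_of_real (V t) - z) * (K * exp A)" for N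
        unfolding norm_mult using FB[OF t] by (intro mult_left_mono) auto
      show "(\<lambda>N. (complex_of_real (V t) - z) * (\<Sum>n<N. picard V z c0 c1 n t)) \<longlonglongrightarrow> (complex_of_real (V t) - z) * ivp V c0 c1 z t"
        by (intro tendsto_intros L t)
      show "(\<lambda>N. \<Sum>n<Suc N. picard' V z c0 c1 n t) \<longlonglongrightarrow> ivp' V c0 c1 z t"
        using L(2)[OF t] by (rule LIMSEQ_Suc)
    qed
  qed
qed

lemma ivp_solution:
  assumes V: "locally_integrable V" and a: "0 \<le> a"
  shows "solution_on V z a b (ivp V c0 c1 z) (ivp' V c0 c1 z)"
  using solution_on_subinterval[OF ivp_facts(1)[OF V, of "max 1 b" z "cmod z"] a] by simp

lemma ivp_0: "ivp V c0 c1 z 0 = c0" "ivp' V c0 c1 z 0 = c1"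
proof -
  have "(\<lambda>n. picard V z c0 c1 n 0) = (\<lambda>n. if n = 0 then c0 else 0)"
  proof
    fix n show "picard V z c0 c1 n 0 = (if n = 0 then c0 else 0)" by (cases n) auto
  qed
  then show "ivp V c0 c1 z 0 = c0" using sums_unique[OF sums_single[of 0 "\<lambda>_. c0"]] by (simp add: ivp_def)
  have "(\<lambda>n. picard' V z c0 c1 n 0) = (\<lambda>n. if n = 0 then c1 else 0)"
  proof
    fix n show "picard' V z c0 c1 n 0 = (if n = 0 then c1 else 0)" by (cases n) (auto simp: picard_deriv_def)
  qed
  then show "ivp' V c0 c1 z 0 = c1" using sums_unique[OF sums_single[of 0 "\<lambda>_. c1"]] by (simp add: ivp'_def)
qed

section \<open>Dependence of solutions on the initial data and on the energy\<close>

lemma ivp_bounded: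
  assumes V: "locally_integrable V"
  obtains C where "C > 0" "\<And>z x. cmod z \<le> R \<Longrightarrow> x \<in> {0..b} \<Longrightarrow> cmod (ivp V c0 c1 z x) \<le> C"
proof -
  let ?b = "max 1 b"
  let ?C = "(cmod c0 + ?b * cmod c1) * exp (?b * (integral {0..?b} (\<lambda>t. \<bar>V t\<bar>) + R * ?b))"
  have "cmod (ivp V c0 c1 z x) \<le> max 1 ?C" if "cmod z \<le> R" "x \<in> {0..b}" for z x
    using ivp_facts(2)[OF V _ that(1), of ?b x c0 c1] that(2) by (auto simp: le_max_iff_disj)
  then show ?thesis using that[of "max 1 ?C"] by auto
qed

text \<open>Cramer's rule: the Wronskians of \<open>p\<close> with the two fundamental solutions are
  constant, hence known from the data at 0, and the Wronskian of the fundamental solutions is 1. In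
  particular a solution is determined by its data at 0.\<close>

lemma solution_as_ivp:
  assumes V: "locally_integrable V" and p: "solution_on V z 0 b p p'" and x: "x \<in> {0..b}"
  shows "p x = p 0 * ivp V 1 0 z x + p' 0 * ivp V 0 1 z x"
    and "p' x = p 0 * ivp' V 1 0 z x + p' 0 * ivp' V 0 1 z x"
proof -
  define u u' v v' where "u = ivp V 1 0 z x" "u' = ivp' V 1 0 z x" "v = ivp V 0 1 z x" "v' = ivp' V 0 1 z x"
  note d = this
  have s: "solution_on V z 0 b (ivp V c0 c1 z) (ivp' V c0 c1 z)" for c0 c1
    using ivp_solution[OF V] by simp
  have W: "u * v' - u' * v = 1" "p x * v' - p' x * v = p 0" "p x * u' - p' x * u = - p' 0"
    using wronskian_constant[OF s[of 1 0] s[of 0 1], of x] wronskian_constant[OF p s[of 0 1], of x]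
      wronskian_constant[OF p s[of 1 0], of x] x by (auto simp: d ivp_0)
  have "p 0 * u + p' 0 * v = (p x * v' - p' x * v) * u - (p x * u' - p' x * u) * v" using W by simp
  also have "\<dots> = p x * (u * v' - u' * v)" by (simp add: algebra_simps)
  finally show "p x = p 0 * ivp V 1 0 z x + p' 0 * ivp V 0 1 z x" using W by (simp add: d)
  have "p 0 * u' + p' 0 * v' = (p x * v' - p' x * v) * u' - (p x * u' - p' x * u) * v'" using W by simp
  also have "\<dots> = p' x * (u * v' - u' * v)" by (simp add: algebra_simps)
  finally show "p' x = p 0 * ivp' V 1 0 z x + p' 0 * ivp' V 0 1 z x" using W by (simp add: d)
qed

text \<open>Variation of constants: the Wronskians of the solution at energy \<open>z\<close> with
  the fundamental solutions at energy \<open>w\<close> have derivatives carrying the factor z - w.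
  This exhibits the difference quotient in the energy.\<close>

lemma ivp_difference:
  assumes V: "locally_integrable V" and x: "0 \<le> x"
  shows "ivp V c0 c1 z x - ivp V c0 c1 w x = (z - w) *
    (integral {0..x} (\<lambda>t. ivp V c0 c1 z t * ivp V 0 1 w t) * ivp V 1 0 w x
   - integral {0..x} (\<lambda>t. ivp V c0 c1 z t * ivp V 1 0 w t) * ivp V 0 1 w x)"
proof -
  define p p' where "p = ivp V c0 c1 z x" "p' = ivp' V c0 c1 z x"
  define u u' v v' where "u = ivp V 1 0 w x" "u' = ivp' V 1 0 w x" "v = ivp V 0 1 w x" "v' = ivp' V 0 1 w x"
  note d = \<open>p = _\<close> \<open>p' = _\<close> \<open>u = _\<close> \<open>u' = _\<close> \<open>v = _\<close> \<open>v' = _\<close>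
  have s: "solution_on V z 0 x (ivp V c0 c1 z) (ivp' V c0 c1 z)" for c0 c1 z
    using ivp_solution[OF V] by simp
  have I: "integral {0..x} (\<lambda>t. (z - w) * (ivp V c0 c1 z t * ivp V d0 d1 w t)) =
      p * ivp' V d0 d1 w x - p' * ivp V d0 d1 w x - (c0 * d1 - c1 * d0)" for d0 d1
    using integral_unique[OF indef_integral_has_integral[OF wronskian_indef_integral[OF s s], of 0 x]] x
    by (simp add: d ivp_0)
  have W: "u * v' - u' * v = 1"
    using wronskian_constant[OF s[of w 1 0] s[of w 0 1], of x] x by (auto simp: d ivp_0)
  have w: "ivp V c0 c1 w x = c0 * u + c1 * v"
    using solution_as_ivp(1)[OF V s[of w c0 c1], of x] x by (simp add: d ivp_0)
  have "(z - w) * (integral {0..x} (\<lambda>t. ivp V c0 c1 z t * ivp V 0 1 w t) * u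
   - integral {0..x} (\<lambda>t. ivp V c0 c1 z t * ivp V 1 0 w t) * v)
   = integral {0..x} (\<lambda>t. (z - w) * (ivp V c0 c1 z t * ivp V 0 1 w t)) * u
     - integral {0..x} (\<lambda>t. (z - w) * (ivp V c0 c1 z t * ivp V 1 0 w t)) * v"
    by (simp only: integral_mult_right) (simp add: algebra_simps)
  also have "\<dots> = (p * v' - p' * v - c0) * u - (p * u' - p' * u + c1) * v"
    unfolding I by (simp add: d)
  also have "\<dots> = p * (u * v' - u' * v) - (c0 * u + c1 * v)" by (simp add: algebra_simps)
  finally show ?thesis using W w by (simp add: d)
qed

text \<open>\<open>ivp_difference\<close> identifies the difference quotient with \<open>?g\<close>,
  so differentiability at \<open>w\<close> amounts to continuity of \<open>?g\<close> there. Local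
  boundedness gives a Lipschitz bound in the energy, uniform on [0, x], and this gives the
  continuity.\<close>

lemma ivp_holomorphic:
  assumes V: "locally_integrable V" and x: "0 \<le> x"
  shows "(\<lambda>z. ivp V c0 c1 z x) holomorphic_on S"
proof -
  have "\<exists>D. ((\<lambda>z. ivp V c0 c1 z x) has_field_derivative D) (at w)" for w
  proof -
    let ?p = "\<lambda>z t. ivp V c0 c1 z t" and ?q = "\<lambda>d0 d1 t. ivp V d0 d1 w t"
    let ?R = "cmod w + 1"
    have c: "continuous_on {0..s} (ivp V c0 c1 z)" for c0 c1 z s
      using solution_on_continuous(1)[OF ivp_solution[OF V]] by blast
    obtain C where C: "C > 0" "\<And>z t. cmod z \<le> ?R \<Longrightarrow> t \<in> {0..x} \<Longrightarrow> cmod (?p z t) \<le> C"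
      using ivp_bounded[OF V] by blast
    obtain C1 where C1: "C1 > 0" "\<And>z t. cmod z \<le> ?R \<Longrightarrow> t \<in> {0..x} \<Longrightarrow> cmod (ivp V 1 0 z t) \<le> C1"
      using ivp_bounded[OF V] by blast
    obtain C2 where C2: "C2 > 0" "\<And>z t. cmod z \<le> ?R \<Longrightarrow> t \<in> {0..x} \<Longrightarrow> cmod (ivp V 0 1 z t) \<le> C2"
      using ivp_bounded[OF V] by blast
    define Q where "Q = max C1 C2"
    have Q: "Q > 0" "\<And>t. t \<in> {0..x} \<Longrightarrow> cmod (?q 1 0 t) \<le> Q" "\<And>t. t \<in> {0..x} \<Longrightarrow> cmod (?q 0 1 t) \<le> Q"
      using C1 C2 by (auto simp: Q_def le_max_iff_disj)
    have IB: "cmod (integral {0..t} (\<lambda>s. f s * q s)) \<le> x * (D * Q)"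
      if "t \<in> {0..x}" "\<And>s. s \<in> {0..x} \<Longrightarrow> cmod (f s) \<le> D" "\<And>s. s \<in> {0..x} \<Longrightarrow> cmod (q s) \<le> Q"
        "continuous_on {0..x} f" "continuous_on {0..x} q" "0 \<le> D" for t D f q
    proof -
      have "cmod (integral {0..t} (\<lambda>s. f s * q s)) \<le> (D * Q) * (t - 0)"
        using that by (intro integral_bound continuous_intros) (auto simp: norm_mult intro!: mult_mono
            intro: continuous_on_subset)
      also have "\<dots> \<le> (D * Q) * x" using that Q by (intro mult_left_mono) auto
      finally show ?thesis by (simp add: mult.commute)
    qed
    have Lip: "cmod (?p z t - ?p w t) \<le> cmod (z - w) * (2 * x * C * Q * Q)" if z: "cmod z \<le> ?R" and t: "t \<in> {0..x}" for z t
    proof -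
      have "cmod (integral {0..t} (\<lambda>s. ?p z s * ?q 0 1 s) * ?q 1 0 t - integral {0..t} (\<lambda>s. ?p z s * ?q 1 0 s) * ?q 0 1 t)
        \<le> cmod (integral {0..t} (\<lambda>s. ?p z s * ?q 0 1 s)) * cmod (?q 1 0 t) + cmod (integral {0..t} (\<lambda>s. ?p z s * ?q 1 0 s)) * cmod (?q 0 1 t)"
        by (rule order_trans[OF norm_triangle_ineq4]) (simp add: norm_mult)
      also have "\<dots> \<le> (x * (C * Q)) * Q + (x * (C * Q)) * Q"
        using C Q z t x c by (intro add_mono mult_mono IB) auto
      finally have "cmod (integral {0..t} (\<lambda>s. ?p z s * ?q 0 1 s) * ?q 1 0 t - integral {0..t} (\<lambda>s. ?p z s * ?q 1 0 s) * ?q 0 1 t)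
         \<le> 2 * x * C * Q * Q" by (simp add: algebra_simps)
      then have "cmod (z - w) * cmod (integral {0..t} (\<lambda>s. ?p z s * ?q 0 1 s) * ?q 1 0 t - integral {0..t} (\<lambda>s. ?p z s * ?q 1 0 s) * ?q 0 1 t)
         \<le> cmod (z - w) * (2 * x * C * Q * Q)" by (rule mult_left_mono) simp
      then show ?thesis
        using arg_cong[OF ivp_difference[OF V, of t c0 c1 z w], of cmod] t by (simp only: norm_mult) simp
    qed
    have lim: "(\<lambda>z. integral {0..x} (\<lambda>t. ?p z t * q t)) \<midarrow>w\<rightarrow> integral {0..x} (\<lambda>t. ?p w t * q t)"
      if q: "continuous_on {0..x} q" "\<And>s. s \<in> {0..x} \<Longrightarrow> cmod (q s) \<le> Q" for q
    proof (rule LIM_zero_cancel, rule Lim_null_comparison)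
      show "((\<lambda>z. x * ((cmod (z - w) * (2 * x * C * Q * Q)) * Q)) \<longlongrightarrow> 0) (at w)"
        by (auto intro!: tendsto_eq_intros)
      have "cmod (integral {0..x} (\<lambda>t. ?p z t * q t) - integral {0..x} (\<lambda>t. ?p w t * q t))
          \<le> x * ((cmod (z - w) * (2 * x * C * Q * Q)) * Q)" if z: "cmod z \<le> ?R" for z
      proof -
        have "integral {0..x} (\<lambda>t. ?p z t * q t) - integral {0..x} (\<lambda>t. ?p w t * q t)
           = integral {0..x} (\<lambda>t. (?p z t - ?p w t) * q t)"
          by (subst integral_diff[symmetric]) (auto intro!: integrable_continuous_interval continuous_intros c q simp: algebra_simps)
        also have "cmod \<dots> \<le> x * ((cmod (z - w) * (2 * x * C * Q * Q)) * Q)"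
          using C Q x Lip[OF z] c q by (intro IB) (auto intro!: continuous_intros)
        finally show ?thesis .
      qed
      moreover have "\<forall>\<^sub>F z in at w. cmod z \<le> ?R"
        unfolding eventually_at
      proof (intro exI conjI ballI impI)
        fix z assume "z \<noteq> w \<and> dist z w < 1"
        then show "cmod z \<le> ?R" using norm_triangle_sub[of z w] by (simp add: dist_norm)
      qed simp
      ultimately show "\<forall>\<^sub>F z in at w. cmod (integral {0..x} (\<lambda>t. ?p z t * q t) - integral {0..x} (\<lambda>t. ?p w t * q t))
          \<le> x * ((cmod (z - w) * (2 * x * C * Q * Q)) * Q)"
        by (auto elim: eventually_mono)
    qed
    let ?g = "\<lambda>z. integral {0..x} (\<lambda>t. ?p z t * ?q 0 1 t) * ?q 1 0 x - integral {0..x} (\<lambda>t. ?p z t * ?q 1 0 t) * ?q 0 1 x"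
    have 1: "isCont ?g w" unfolding isCont_def by (intro tendsto_intros lim c Q)
    have 2: "\<forall>z. ?p z x - ?p w x = ?g z * (z - w)"
      by (rule allI, subst mult.commute, rule ivp_difference[OF V x])
    have "((\<lambda>z. ivp V c0 c1 z x) has_field_derivative ?g w) (at w)"
      unfolding CARAT_DERIV by (rule exI[of _ ?g], rule conjI[OF 2 conjI[OF 1 refl]])
    then show ?thesis by (rule exI)
  qed
  then have "(\<lambda>z. ivp V c0 c1 z x) field_differentiable (at w)" for w
    unfolding field_differentiable_def by simp
  then show ?thesis
    using holomorphic_onI field_differentiable_at_within by metis
qed

section \<open>The Weyl solution\<close>


text \<open>Smallness is asked for arbitrarily far out, since solutions have to be examined near
  infinity, and it is measured by the integral of |V|, the quantity that enters the integrated
  equation.\<close>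

definition L1_sparse :: "(real \<Rightarrow> real) \<Rightarrow> bool" where
  "L1_sparse V \<longleftrightarrow> locally_integrable V \<and>
     (\<forall>\<eta>>0. \<forall>N>0. \<forall>r\<ge>0. \<exists>a\<ge>r. integral {a..a+N} (\<lambda>t. \<bar>V t\<bar>) \<le> \<eta>)"

lemma L1_sparseD:
  assumes "L1_sparse V" "\<eta> > 0" "N > 0" "r \<ge> 0"
  obtains a where "a \<ge> r" "integral {a..a+N} (\<lambda>t. \<bar>V t\<bar>) \<le> \<eta>"
  using assms unfolding L1_sparse_def by blast

lemma L1_sparse_locally_integrable: "L1_sparse V \<Longrightarrow> locally_integrable V"
  by (simp add: L1_sparse_def)

text \<open>The inequality |V| <= s + V^2 / s turns smallness of the integral of V^2 into smallness
  of that of |V|. As \<open>L2_sparse\<close> does not say where its interval lies, a longer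
  interval is requested and its beginning is discarded.\<close>

lemma L2_sparse_imp_L1_sparse:
  assumes "L2_sparse V" shows "L1_sparse V"
proof -
  have V: "locally_integrable V" using assms by (simp add: L2_sparse_def locally_integrable_def)
  have "\<exists>a\<ge>r. integral {a..a+N} (\<lambda>t. \<bar>V t\<bar>) \<le> \<eta>" if h: "\<eta> > 0" "N > 0" "r \<ge> 0" for \<eta> N r
  proof -
    \<comment> \<open>Beyond the length \<open>N\<close> there is room for a shift by r + 1 that
      stays strictly below the right end. With this length and the next choice of \<open>s\<close>,
      the two terms of the estimate contribute \<eta>/2 each.\<close>
    define M where "M = N + r + 2"
    define s where "s = \<eta> / (2 * M)"
    have M: "M > 0" and s: "s > 0" using h by (auto simp: M_def s_def)
    have "\<exists>a b. 0 \<le> a \<and> b - a = M \<and> (\<integral>\<^sup>+ x\<in>{a<..<b}. ennreal ((V x)\<^sup>2) \<partial>lebesgue) < ennreal (\<eta> * s / 2)"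
      using assms M s h unfolding L2_sparse_def by (metis half_gt_zero mult_pos_pos)
    then obtain a b where a: "0 \<le> a" "b - a = M" and I: "(\<integral>\<^sup>+ x\<in>{a<..<b}. ennreal ((V x)\<^sup>2) \<partial>lebesgue) < ennreal (\<eta> * s / 2)"
      by blast
    let ?S = "{a+r+1..a+r+1+N}"
    have "?S \<subseteq> {a<..<b}" using a h by (auto simp: M_def)
    have V0: "V absolutely_integrable_on {0..b}" using V locally_integrable_abs_int by blast
    \<comment> \<open>\<open>V\<close> is known to be measurable on bounded intervals only; the
      truncation is measurable on the whole line and agrees with \<open>V\<close> where the
      integrals see it.\<close>
    let ?W = "\<lambda>x. indicator {0..b} x * V x"
    have Wm[measurable]: "?W \<in> borel_measurable lebesgue"
      using V0 unfolding set_integrable_def by (simp add: borel_measurable_integrable)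
    have [measurable]: "{a<..<b} \<in> sets lebesgue" by simp
    have W2: "ennreal ((V x)\<^sup>2 / s) * indicator {a<..<b} x = ennreal ((?W x)\<^sup>2 / s) * indicator {a<..<b} x" for x
      using a by (auto simp: indicator_def)
    have "((\<lambda>t. \<bar>V t\<bar>) has_integral integral ?S (\<lambda>t. \<bar>V t\<bar>)) ?S"
      using locally_integrable_abs_integrable[OF V] a h by (intro integrable_integral) auto
    then have "ennreal (integral ?S (\<lambda>t. \<bar>V t\<bar>)) = (\<integral>\<^sup>+x. ennreal \<bar>V x\<bar> * indicator ?S x \<partial>lebesgue)"
      by (simp only: nn_integral_completion nn_integral_has_integral_lebesgue'[OF abs_ge_zero])
    also have "\<dots> \<le> (\<integral>\<^sup>+x. ennreal s * indicator {a<..<b} x + ennreal ((V x)\<^sup>2 / s) * indicator {a<..<b} x \<partial>lebesgue)"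
    proof (rule nn_integral_mono)
      fix x
      have "\<bar>V x\<bar> * s \<le> s\<^sup>2 + \<bar>V x\<bar>\<^sup>2"
        using sum_squares_bound[of "\<bar>V x\<bar>" s] mult_nonneg_nonneg[OF abs_ge_zero less_imp_le[OF s], of "V x"]
        unfolding power2_eq_square by linarith
      then have "\<bar>V x\<bar> \<le> s + (V x)\<^sup>2 / s" using s by (simp add: field_simps power2_eq_square)
      then have "ennreal \<bar>V x\<bar> \<le> ennreal s + ennreal ((V x)\<^sup>2 / s)"
        using s ennreal_leI[of "\<bar>V x\<bar>" "s + (V x)\<^sup>2 / s"] by simp
      then show "ennreal \<bar>V x\<bar> * indicator ?S x \<le> ennreal s * indicator {a<..<b} x + ennreal ((V x)\<^sup>2 / s) * indicator {a<..<b} x"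
        using \<open>?S \<subseteq> {a<..<b}\<close> by (auto simp: indicator_def)
    qed
    also have "\<dots> = (\<integral>\<^sup>+x. ennreal s * indicator {a<..<b} x \<partial>lebesgue) + (\<integral>\<^sup>+x. ennreal ((V x)\<^sup>2 / s) * indicator {a<..<b} x \<partial>lebesgue)"
      unfolding W2 by (rule nn_integral_add; measurable)
    also have "(\<integral>\<^sup>+x. ennreal s * indicator {a<..<b} x \<partial>lebesgue) = ennreal (s * M)"
      using a M s by (subst nn_integral_cmult_indicator) (auto simp: ennreal_mult)
    also have "(\<integral>\<^sup>+x. ennreal ((V x)\<^sup>2 / s) * indicator {a<..<b} x \<partial>lebesgue) = (\<integral>\<^sup>+x. ennreal (1/s) * (ennreal ((?W x)\<^sup>2) * indicator {a<..<b} x) \<partial>lebesgue)"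
      unfolding W2 using s by (intro nn_integral_cong) (auto simp: indicator_def ennreal_mult[symmetric])
    also have "\<dots> = ennreal (1/s) * (\<integral>\<^sup>+x. ennreal ((?W x)\<^sup>2) * indicator {a<..<b} x \<partial>lebesgue)"
      by (rule nn_integral_cmult) measurable
    also have "(\<integral>\<^sup>+x. ennreal ((?W x)\<^sup>2) * indicator {a<..<b} x \<partial>lebesgue) = (\<integral>\<^sup>+x. ennreal ((V x)\<^sup>2) * indicator {a<..<b} x \<partial>lebesgue)"
      using a by (intro nn_integral_cong) (auto simp: indicator_def)
    also have "ennreal (s * M) + ennreal (1/s) * \<dots> \<le> ennreal (s * M) + ennreal (1/s) * ennreal (\<eta> * s / 2)"
      using I by (intro add_left_mono mult_left_mono) auto
    also have "\<dots> = ennreal (s * M + 1/s * (\<eta> * s / 2))"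
      using s M h by (simp add: ennreal_mult[symmetric] ennreal_plus[symmetric] del: ennreal_plus)
    also have "s * M + 1/s * (\<eta> * s / 2) = \<eta>" using s M by (simp add: s_def field_simps)
    finally have "integral ?S (\<lambda>t. \<bar>V t\<bar>) \<le> \<eta>" using h by (simp add: ennreal_le_iff)
    then show ?thesis using a by (intro exI[of _ "a+r+1"]) auto
  qed
  then show ?thesis using V by (auto simp: L1_sparse_def)
qed

text \<open>Square integrability makes the mass of |F|^2 small on distant windows of length
  \<open>l\<close>; on such a window with little potential, \<open>mean_square_bound\<close> turns
  this into smallness of both F and F' at a point.\<close>

lemma weyl_decay:
  assumes V: "L1_sparse V" and F: "schrodinger_solution V z F F'"
    and L2: "(\<lambda>x. (cmod (F x))\<^sup>2) absolutely_integrable_on {0<..}" and e: "e > 0" and r: "r \<ge> 0"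
  obtains b where "b \<ge> r" "cmod (F b) \<le> e" "cmod (F' b) \<le> e"
proof -
  define R where "R = max 1 (cmod z)"
  define l where "l = 1 / (4 * R)"
  have R: "R \<ge> 1" "cmod z \<le> R" by (auto simp: R_def)
  have l: "l > 0" "l \<le> 1" using R by (auto simp: l_def field_simps)
  have lV: "locally_integrable V" using V by (rule L1_sparse_locally_integrable)
  have s: "solution_on V z a b F F'" if "0 \<le> a" for a b using schrodinger_solution_on[OF lV F that] .
  have i: "(\<lambda>t. (cmod (F t))\<^sup>2) integrable_on {a..b}" if "0 \<le> a" for a b
    using solution_on_norm_sq_integrable[OF s[OF that]] by blast
  define I where "I b = integral {1..b} (\<lambda>t. (cmod (F t))\<^sup>2)" for b
  have "I b \<le> integral {0<..} (\<lambda>t. (cmod (F t))\<^sup>2)" for b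
    unfolding I_def using L2 by (intro integral_subset_le i) (auto simp: absolutely_integrable_on_def)
  then have bdd: "bdd_above (range I)" by (auto simp: bdd_above_def)
  \<comment> \<open>Chosen so that the square root in \<open>mean_square_bound\<close> is at most e
    l / 14, which compensates the factor 14 and the division by l.\<close>
  define \<epsilon> where "\<epsilon> = l / 3 * (e * l / 14)\<^sup>2"
  have \<epsilon>: "\<epsilon> > 0" using l e by (simp add: \<epsilon>_def)
  obtain r0 where r0: "I r0 > Sup (range I) - \<epsilon>"
    using less_cSupD[of "range I" "Sup (range I) - \<epsilon>"] \<epsilon> by auto
  have m0: "0 \<le> max 1 (max r r0)" by (simp add: max_def)
  obtain a where a: "a \<ge> max 1 (max r r0)" "integral {a..a+l} (\<lambda>t. \<bar>V t\<bar>) \<le> 1/4"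
    by (rule L1_sparseD[OF V _ l(1) m0, of "1/4"]) (simp, blast)
  have "I r0 \<le> I a" unfolding I_def using a by (intro integral_subset_le i) auto
  moreover have "I (a + l) \<le> Sup (range I)" using bdd by (intro cSup_upper) auto
  moreover have "I a + integral {a..a+l} (\<lambda>t. (cmod (F t))\<^sup>2) = I (a + l)"
    unfolding I_def using a l by (intro Henstock_Kurzweil_Integration.integral_combine i) auto
  ultimately have J: "integral {a..a+l} (\<lambda>t. (cmod (F t))\<^sup>2) \<le> \<epsilon>" using r0 by linarith
  have "sqrt (3 / l * integral {a..a+l} (\<lambda>t. (cmod (F t))\<^sup>2)) \<le> sqrt (3 / l * \<epsilon>)"
    using J l by (intro real_sqrt_le_mono mult_left_mono) auto
  also have "3 / l * \<epsilon> = (e * l / 14)\<^sup>2" using l by (simp add: \<epsilon>_def)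
  also have "sqrt \<dots> = e * l / 14" using e l by simp
  finally have S: "sqrt (3 / l * integral {a..a+l} (\<lambda>t. (cmod (F t))\<^sup>2)) \<le> e * l / 14" .
  have aV: "(\<lambda>t. \<bar>V t\<bar>) integrable_on {a..a+l}"
    using locally_integrable_abs_integrable[OF lV] a by simp
  have 0: "solution_on V z a (a+l) F F'" using s a by simp
  note M = mean_square_bound[OF aV a(2) R l_def 0, of a]
  have "cmod (F a) \<le> 14 * (e * l / 14)" using M(1) S l by simp
  also have "\<dots> \<le> e" using l e by simp
  finally have 1: "cmod (F a) \<le> e" .
  have "cmod (F' a) \<le> 13 * (e * l / 14) / l"
    using M(2) l divide_right_mono[of "13 * sqrt (3 / l * integral {a..a+l} (\<lambda>t. (cmod (F t))\<^sup>2))" "13 * (e * l / 14)" l] S by simp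
  also have "\<dots> \<le> e" using l e by simp
  finally have "cmod (F' a) \<le> e" .
  then show ?thesis using that[of a] 1 a by simp
qed

text \<open>The flux Im (cnj F F') does not increase, and by \<open>weyl_decay\<close> it becomes
  arbitrarily small in modulus at arbitrarily distant points. Hence it is never negative, and its
  value at x bounds Im z times the mass beyond x. This is the limit-point property in quantitative
  form.\<close>

lemma weyl_flux_lower:
  assumes V: "L1_sparse V" and z: "Im z > 0" and F: "schrodinger_solution V z F F'"
    and L2: "(\<lambda>x. (cmod (F x))\<^sup>2) absolutely_integrable_on {0<..}" and x: "0 \<le> x" "x \<le> y"
  shows "Im z * integral {x..y} (\<lambda>t. (cmod (F t))\<^sup>2) \<le> Im (cnj (F x) * F' x)"
proof -
  define g where "g t = Im (cnj (F t) * F' t)" for t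
  have lV: "locally_integrable V" using V by (rule L1_sparse_locally_integrable)
  have s: "solution_on V z a b F F'" if "0 \<le> a" for a b using schrodinger_solution_on[OF lV F that] .
  have G: "Im z * integral {u..w} (\<lambda>t. (cmod (F t))\<^sup>2) = g u - g w" if "0 \<le> u" "u \<le> w" for u w
    using green_identity[OF s[of u w], of u w] that by (simp add: g_def)
  have "g y \<ge> 0"
  proof (rule ccontr)
    assume "\<not> g y \<ge> 0"
    then have n: "sqrt (- g y / 2) > 0" by simp
    obtain b where b: "b \<ge> y" "cmod (F b) \<le> sqrt (- g y / 2)" "cmod (F' b) \<le> sqrt (- g y / 2)"
      using weyl_decay[OF V F L2 n, of y] x by auto
    have "\<bar>g b\<bar> \<le> cmod (F b) * cmod (F' b)" unfolding g_def
      by (metis abs_Im_le_cmod complex_mod_cnj norm_mult)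
    also have "\<dots> \<le> sqrt (- g y / 2) * sqrt (- g y / 2)" using b n by (intro mult_mono) auto
    also have "\<dots> = - g y / 2" using n by (simp add: real_sqrt_gt_0_iff)
    finally have "\<bar>g b\<bar> \<le> - g y / 2" .
    moreover have "0 \<le> Im z * integral {y..b} (\<lambda>t. (cmod (F t))\<^sup>2)"
      using z solution_on_norm_sq_integrable[OF s[of y b]] x b
      by (intro mult_nonneg_nonneg integral_nonneg) auto
    ultimately show False using G[of y b] x b n by (simp add: real_sqrt_gt_0_iff)
  qed
  then show ?thesis using G[OF x] by (simp add: g_def)
qed

text \<open>With F(0) = 0 the flux at 0 vanishes, hence so does the mass of |F|^2: a self-adjoint
  operator has no non-real eigenvalue. The derivative at 0 vanishes because F' is constant on [0, 1]
  once F is zero.\<close>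

lemma square_integrable_zero_imp_trivial:
  assumes V: "L1_sparse V" and z: "Im z > 0" and F: "schrodinger_solution V z F F'"
    and L2: "(\<lambda>x. (cmod (F x))\<^sup>2) absolutely_integrable_on {0<..}" and F0: "F 0 = 0"
  shows "\<forall>x\<ge>0. F x = 0" "F' 0 = 0"
proof -
  have lV: "locally_integrable V" using V by (rule L1_sparse_locally_integrable)
  have s: "solution_on V z 0 b F F'" for b using schrodinger_solution_on[OF lV F] by simp
  show *: "\<forall>x\<ge>0. F x = 0"
  proof (intro allI impI)
    fix x :: real assume x: "0 \<le> x"
    let ?I = "integral {0..x+1} (\<lambda>t. (cmod (F t))\<^sup>2)"
    have "Im z * ?I \<le> 0" using weyl_flux_lower[OF V z F L2, of 0 "x+1"] x F0 by simp
    moreover have "0 \<le> ?I"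
      using solution_on_norm_sq_integrable[OF s[of "x+1"]] by (intro integral_nonneg) auto
    ultimately have "?I = 0" using z by (simp add: mult_le_0_iff)
    moreover have "continuous_on {0..x+1} (\<lambda>t. (cmod (F t))\<^sup>2)"
      using solution_on_continuous(1)[OF s] by (intro continuous_intros)
    ultimately show "F x = 0" using integral_eq_0_iff[of 0 "x+1" "\<lambda>t. (cmod (F t))\<^sup>2"] x by auto
  qed
  have i: "indef_integral 0 1 F F'" "indef_integral 0 1 F' (\<lambda>t. (complex_of_real (V t) - z) * F t)"
    using s[of 1] by (auto simp: solution_on_def)
  have c: "F' t = F' 0" if "t \<in> {0..1}" for t :: real
  proof -
    have "((\<lambda>t. (complex_of_real (V t) - z) * F t) has_integral (F' t - F' 0)) {0..t}"
      using indef_integral_has_integral[OF i(2)] that by auto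
    moreover have "((\<lambda>t. (complex_of_real (V t) - z) * F t) has_integral 0) {0..t}"
      using * by (intro has_integral_is_0) auto
    ultimately have "F' t - F' 0 = 0" by (rule has_integral_unique)
    then show ?thesis by simp
  qed
  have "(F' has_integral (F 1 - F 0)) {0..1}" using indef_integral_has_integral[OF i(1)] by simp
  then have "((\<lambda>t::real. F' 0) has_integral (F 1 - F 0)) {0..1}"
    by (rule has_integral_eq[rotated]) (rule c)
  moreover have "((\<lambda>t. F' 0) has_integral F' 0) {0..1::real}" using has_integral_const_real[of "F' 0" 0 1] by simp
  ultimately have "F 1 - F 0 = F' 0" using has_integral_unique by blast
  then show "F' 0 = 0" using * by simp
qed

lemma weyl_solution_nonzero:
  assumes "L1_sparse V" "Im z > 0" "weyl_solution V z F F'" shows "F 0 \<noteq> 0"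
  using square_integrable_zero_imp_trivial(1)[of V z F F'] assms by (auto simp: weyl_solution_def)

lemma square_integrable_linear:
  fixes F G :: "real \<Rightarrow> complex"
  assumes F: "continuous_on {0<..} F" "(\<lambda>x. (cmod (F x))\<^sup>2) absolutely_integrable_on {0<..}"
    and G: "continuous_on {0<..} G" "(\<lambda>x. (cmod (G x))\<^sup>2) absolutely_integrable_on {0<..}"
  shows "(\<lambda>x. (cmod (c * F x + d * G x))\<^sup>2) absolutely_integrable_on {0<..}"
proof (rule measurable_bounded_by_integrable_imp_absolutely_integrable)
  show "(\<lambda>x. (cmod (c * F x + d * G x))\<^sup>2) \<in> borel_measurable (lebesgue_on {0<..})"
    by (intro continuous_imp_measurable_on_sets_lebesgue continuous_intros F G) auto
  show "(\<lambda>x. 2 * (cmod c)\<^sup>2 * (cmod (F x))\<^sup>2 + 2 * (cmod d)\<^sup>2 * (cmod (G x))\<^sup>2) integrable_on {0<..}"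
    using F G by (intro integrable_add integrable_on_mult_right) (auto simp: absolutely_integrable_on_def)
  fix x
  have "(cmod (c * F x + d * G x))\<^sup>2 \<le> (cmod (c * F x) + cmod (d * G x))\<^sup>2"
    by (intro power_mono norm_triangle_ineq) auto
  also have "\<dots> \<le> 2 * (cmod (c * F x))\<^sup>2 + 2 * (cmod (d * G x))\<^sup>2"
    using sum_squares_bound[of "cmod (c * F x)" "cmod (d * G x)"] by (simp add: power2_sum)
  finally show "norm ((cmod (c * F x + d * G x))\<^sup>2) \<le> 2 * (cmod c)\<^sup>2 * (cmod (F x))\<^sup>2 + 2 * (cmod d)\<^sup>2 * (cmod (G x))\<^sup>2"
    by (simp add: norm_mult power_mult_distrib)
qed auto

lemma schrodinger_solution_continuous:
  assumes "schrodinger_solution V z F F'" shows "continuous_on {0..} F"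
  using assms unfolding schrodinger_solution_def
  by (intro continuous_on_vector_derivative) auto

text \<open>Scaled to the value 1 at 0, two Weyl solutions differ by a square integrable solution
  that vanishes at 0, so its derivative vanishes there as well. This gives the uniqueness that
  \<open>weyl_m\<close> presupposes.\<close>

lemma weyl_solution_unique:
  assumes V: "L1_sparse V" and z: "Im z > 0" and F: "weyl_solution V z F F'" and G: "weyl_solution V z G G'"
  shows "F' 0 / F 0 = G' 0 / G 0"
proof -
  have lV: "locally_integrable V" using V by (rule L1_sparse_locally_integrable)
  let ?c = "1 / F 0" and ?d = "- 1 / G 0"
  let ?H = "\<lambda>t. ?c * F t + ?d * G t" and ?H' = "\<lambda>t. ?c * F' t + ?d * G' t"
  have nz: "F 0 \<noteq> 0" "G 0 \<noteq> 0" using weyl_solution_nonzero[OF V z] F G by auto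
  have FG: "schrodinger_solution V z F F'" "schrodinger_solution V z G G'"
    using F G by (auto simp: weyl_solution_def)
  have c: "continuous_on {0<..} F" "continuous_on {0<..} G"
    using FG[THEN schrodinger_solution_continuous] by (auto intro: continuous_on_subset)
  have "schrodinger_solution V z ?H ?H'"
    by (rule solution_on_schrodinger, rule solution_on_linear[OF schrodinger_solution_on[OF lV FG(1)]
        schrodinger_solution_on[OF lV FG(2)]]) auto
  moreover have "(\<lambda>x. (cmod (?H x))\<^sup>2) absolutely_integrable_on {0<..}"
    using F G c by (intro square_integrable_linear) (auto simp: weyl_solution_def)
  moreover have "?H 0 = 0" using nz by simp
  ultimately have "?H' 0 = 0" by (rule square_integrable_zero_imp_trivial(2)[OF V z])
  then show ?thesis by simp
qed

section \<open>Weyl's nested discs and the m-function\<close>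

lemma ivp_schrodinger:
  "locally_integrable V \<Longrightarrow> schrodinger_solution V z (ivp V c0 c1 z) (ivp' V c0 c1 z)"
  by (intro solution_on_schrodinger ivp_solution) auto

lemma ivp_linear:
  assumes V: "locally_integrable V" and x: "0 \<le> x"
  shows "ivp V c0 c1 z x = c0 * ivp V 1 0 z x + c1 * ivp V 0 1 z x"
    and "ivp' V c0 c1 z x = c0 * ivp' V 1 0 z x + c1 * ivp' V 0 1 z x"
  using solution_as_ivp[OF V ivp_solution[OF V order_refl], of x x c0 c1 z] x by (auto simp: ivp_0)

text \<open>Weyl's nested discs: \<open>D n\<close> consists of the slopes w for which u + w v has
  nonnegative flux at n + 1, equivalently for which Im z times its mass on [0, n + 1] is at most Im
  w. A slope common to all discs has mass at most Im w / Im z on every bounded interval starting at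
  0.\<close>

lemma weyl_solution_exists:
  assumes V: "locally_integrable V" and z: "Im z > 0"
  shows "\<exists>w. weyl_solution V z (ivp V 1 w z) (ivp' V 1 w z)"
proof -
  define u u' v v' where "u = ivp V 1 0 z" "u' = ivp' V 1 0 z" "v = ivp V 0 1 z" "v' = ivp' V 0 1 z"
  note d = \<open>u = _\<close> \<open>u' = _\<close> \<open>v = _\<close> \<open>v' = _\<close>
  define I where "I w b = integral {0..b} (\<lambda>t. (cmod (ivp V 1 w z t))\<^sup>2)" for w b
  have s: "solution_on V z 0 b (ivp V c0 c1 z) (ivp' V c0 c1 z)" for b c0 c1
    using ivp_solution[OF V] by simp
  have i: "(\<lambda>t. (cmod (ivp V c0 c1 z t))\<^sup>2) integrable_on {0..b}" for b c0 c1
    using solution_on_norm_sq_integrable[OF s] by blast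
  have c: "continuous_on {0..b} (\<lambda>t. (cmod (ivp V c0 c1 z t))\<^sup>2)" for b c0 c1
    using solution_on_continuous(1)[OF s] by (intro continuous_intros)
  have F: "ivp V 1 w z x = u x + w * v x" "ivp' V 1 w z x = u' x + w * v' x" if "0 \<le> x" for w x
    using ivp_linear[OF V that, of 1 w z] by (auto simp: d)
  have G: "Im z * I w b = Im w - Im (cnj (u b + w * v b) * (u' b + w * v' b))" if "0 \<le> b" for w b
    using green_identity[OF s, of 0 b b 1 w] that F[OF that] by (simp add: I_def ivp_0)
  define Cv where "Cv = integral {0..1} (\<lambda>t. (cmod (v t))\<^sup>2)"
  define Cu where "Cu = integral {0..1} (\<lambda>t. (cmod (u t))\<^sup>2)"
  \<comment> \<open>If v vanished on [0, b], its derivative would be constant there, equal to v'(0)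
    = 1, and yet have integral 0.\<close>
  have Vp: "0 < integral {0..b} (\<lambda>t. (cmod (v t))\<^sup>2)" if b: "b > 0" for b
  proof (rule ccontr)
    assume "\<not> ?thesis"
    moreover have "0 \<le> integral {0..b} (\<lambda>t. (cmod (v t))\<^sup>2)" unfolding d by (intro integral_nonneg i) auto
    ultimately have "integral {0..b} (\<lambda>t. (cmod (v t))\<^sup>2) = 0" by simp
    then have v0: "v t = 0" if "t \<in> {0..b}" for t
      using integral_eq_0_iff[OF c b, of 0 1] that by (auto simp: d)
    have W: "u t * v' t - u' t * v t = 1" if "t \<in> {0..b}" for t
      using wronskian_constant[OF s[of b 1 0] s[of b 0 1], of t] that by (auto simp: d ivp_0)
    have ct: "continuous_on {0..b} u" "continuous_on {0..b} v'" using solution_on_continuous[OF s] by (auto simp: d)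
    have "(v' has_integral (v b - v 0)) {0..b}"
      using s[of b 0 1] b indef_integral_has_integral[of 0 b v v' 0 b] unfolding solution_on_def d by auto
    then have "(v' has_integral 0) {0..b}" using v0[of b] v0[of 0] b by simp
    moreover have "((\<lambda>t. v' t) has_integral (v' 0 * of_real b)) {0..b}"
    proof -
      have e: "v' 0 = v' t" if t: "t \<in> {0..b}" for t
      proof -
        have "((\<lambda>t. (complex_of_real (V t) - z) * v t) has_integral (v' t - v' 0)) {0..t}"
          using s[of b 0 1] t indef_integral_has_integral[of 0 b v' _ 0 t] unfolding solution_on_def d by auto
        moreover have "((\<lambda>t. (complex_of_real (V t) - z) * v t) has_integral 0) {0..t}"
          using v0 t by (intro has_integral_is_0) auto
        ultimately have "v' t - v' 0 = 0" by (rule has_integral_unique)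
        then show ?thesis by simp
      qed
      have "((\<lambda>t. v' 0) has_integral (v' 0 * of_real b)) {0..b}"
        using has_integral_const_real[of "v' 0" 0 b] b by (simp add: scaleR_conv_of_real mult.commute)
      then show ?thesis by (rule has_integral_eq[rotated]) (rule e)
    qed
    ultimately have "v' 0 * of_real b = 0" by (blast intro: has_integral_unique)
    then show False using b by (simp add: d ivp_0)
  qed
  define D where "D n = {w. 0 \<le> Im (cnj (u (real (Suc n)) + w * v (real (Suc n))) * (u' (real (Suc n)) + w * v' (real (Suc n))))}" for n
  have D: "w \<in> D n \<longleftrightarrow> Im z * I w (real (Suc n)) \<le> Im w" for w n
    unfolding D_def using G[of "real (Suc n)" w] by auto
  have Dmono: "D n \<subseteq> D m" if "m \<le> n" for m n
  proof
    fix w assume "w \<in> D n"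
    moreover have "I w (real (Suc m)) \<le> I w (real (Suc n))"
      unfolding I_def using that by (intro integral_subset_le i) auto
    ultimately show "w \<in> D m" unfolding D using z mult_left_mono[of "I w (real (Suc m))" "I w (real (Suc n))" "Im z"] by linarith
  qed
  have "closed (D n)" for n unfolding D_def by (intro closed_Collect_le continuous_intros)
  have Dne: "D n \<noteq> {}" for n
  proof -
    let ?b = "real (Suc n)"
    have "v ?b \<noteq> 0"
    proof
      assume "v ?b = 0"
      then have "Im z * integral {0..?b} (\<lambda>t. (cmod (v t))\<^sup>2) = 0"
        using green_identity[OF s, of 0 ?b ?b 0 1] by (simp add: d ivp_0)
      then show False using z Vp[of ?b] by simp
    qed
    \<comment> \<open>The slope for which the solution vanishes at \<open>?b\<close> has zero flux
      there, hence lies in the disc.\<close>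
    then have "u ?b + (- u ?b / v ?b) * v ?b = 0" by simp
    then have "- u ?b / v ?b \<in> D n"
      by (simp only: D_def mem_Collect_eq complex_cnj_zero mult_zero_left zero_complex.simps order_refl)
    then show ?thesis by blast
  qed
  \<comment> \<open>The mass of u + w v on [0, 1] grows at least quadratically in |w|, while
    membership in \<open>D 0\<close> bounds it by Im w / Im z, which is linear in |w|.\<close>
  have "bounded (D 0)"
    unfolding bounded_iff
  proof (intro exI ballI)
    fix w assume w: "w \<in> D 0"
    have Cv: "Cv > 0" using Vp[of 1] by (simp add: Cv_def)
    have Cu: "Cu \<ge> 0" unfolding Cu_def d by (intro integral_nonneg i) auto
    have "((cmod w)\<^sup>2 / 2) * Cv - Cu = integral {0..1} (\<lambda>t. (cmod w)\<^sup>2 / 2 * (cmod (v t))\<^sup>2 - (cmod (u t))\<^sup>2)"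
      unfolding Cv_def Cu_def d using i by (subst integral_diff) (auto intro: integrable_on_mult_right)
    also have "\<dots> \<le> I w 1"
      unfolding I_def
    proof (intro integral_le i integrable_diff integrable_on_mult_right)
      fix t :: real assume t: "t \<in> {0..1}"
      have "(cmod (w * v t))\<^sup>2 \<le> (cmod (u t + w * v t) + cmod (u t))\<^sup>2"
        using norm_triangle_ineq4[of "u t + w * v t" "u t"] by (intro power_mono) auto
      also have "\<dots> \<le> 2 * (cmod (u t + w * v t))\<^sup>2 + 2 * (cmod (u t))\<^sup>2"
        using sum_squares_bound[of "cmod (u t + w * v t)" "cmod (u t)"] by (simp add: power2_sum)
      finally show "(cmod w)\<^sup>2 / 2 * (cmod (v t))\<^sup>2 - (cmod (u t))\<^sup>2 \<le> (cmod (ivp V 1 w z t))\<^sup>2"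
        using F[of t w] t by (simp add: norm_mult power_mult_distrib)
    qed (auto simp: d i)
    finally have "Im z * (((cmod w)\<^sup>2 / 2) * Cv - Cu) \<le> cmod w"
      using w[unfolded D] abs_Im_le_cmod[of w]
        mult_left_mono[OF _ less_imp_le[OF z], of "((cmod w)\<^sup>2 / 2) * Cv - Cu" "I w 1"] by simp
    then have q: "(Im z * Cv / 2) * (cmod w)\<^sup>2 \<le> cmod w + Im z * Cu" by (simp add: algebra_simps)
    show "cmod w \<le> max 1 ((1 + Im z * Cu) / (Im z * Cv / 2))"
    proof (cases "cmod w \<le> 1")
      case False
      have "Im z * Cu * 1 \<le> Im z * Cu * cmod w" using False z Cu by (intro mult_left_mono) auto
      then have "((Im z * Cv / 2) * cmod w) * cmod w \<le> (1 + Im z * Cu) * cmod w"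
        using q by (simp add: algebra_simps power2_eq_square)
      then have "(Im z * Cv / 2) * cmod w \<le> 1 + Im z * Cu" by (rule mult_right_le_imp_le) (use False in linarith)
      then show ?thesis using z Cv by (simp add: field_simps le_max_iff_disj)
    qed simp
  qed
  then have "compact (D n)" for n
    using \<open>\<And>n. closed (D n)\<close> Dmono[of 0 n] bounded_subset compact_eq_bounded_closed by blast
  then have "\<Inter> (range D) \<noteq> {}" using Dne Dmono by (rule compact_nest)
  then obtain w where w: "\<And>n. w \<in> D n" by auto
  have Ib: "I w (real k) \<le> Im w / Im z" for k
  proof -
    have "I w (real k) \<le> I w (real (Suc k))" unfolding I_def by (intro integral_subset_le i) auto
    also have "\<dots> \<le> Im w / Im z" using w[of k] z unfolding D by (simp add: field_simps)
    finally show ?thesis .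
  qed
  \<comment> \<open>The truncations to [0, k] increase to the square of the modulus and have bounded
    integrals, so monotone convergence applies.\<close>
  let ?f = "\<lambda>k x. if x \<in> {0..real k} then (cmod (ivp V 1 w z x))\<^sup>2 else 0"
  have If: "integral {0..} (?f k) = I w (real k)" for k
    unfolding I_def Henstock_Kurzweil_Integration.integral_restrict_Int by (simp add: Int_absorb2 Icc_subset_Ici_iff)
  have "(\<lambda>x. (cmod (ivp V 1 w z x))\<^sup>2) integrable_on {0..} \<and>
     ((\<lambda>k. integral {0..} (?f k)) \<longlongrightarrow> integral {0..} (\<lambda>x. (cmod (ivp V 1 w z x))\<^sup>2)) sequentially"
  proof (rule monotone_convergence_increasing)
    show "?f k integrable_on {0..}" for k
      unfolding integrable_restrict_Int using i by (simp add: Int_absorb2 Icc_subset_Ici_iff)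
    show "?f k x \<le> ?f (Suc k) x" for k x by auto
    fix x :: real assume x: "x \<in> {0..}"
    show "(\<lambda>k. ?f k x) \<longlonglongrightarrow> (cmod (ivp V 1 w z x))\<^sup>2"
    proof (rule tendsto_eventually)
      show "\<forall>\<^sub>F k in sequentially. ?f k x = (cmod (ivp V 1 w z x))\<^sup>2"
        by (rule eventually_mono[OF eventually_ge_at_top[of "nat \<lceil>x\<rceil>"]]) (use x in \<open>auto simp: nat_ceiling_le_eq\<close>)
    qed
  next
    have "0 \<le> I w (real k)" for k unfolding I_def by (intro integral_nonneg i) auto
    then show "bounded (range (\<lambda>k. integral {0..} (?f k)))"
      unfolding If bounded_iff using Ib by (intro exI[of _ "Im w / Im z"]) auto
  qed
  then have "(\<lambda>x. (cmod (ivp V 1 w z x))\<^sup>2) absolutely_integrable_on {0..}"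
    by (intro nonnegative_absolutely_integrable_1) auto
  then have "(\<lambda>x. (cmod (ivp V 1 w z x))\<^sup>2) absolutely_integrable_on {0<..}"
    by (rule set_integrable_subset) auto
  then have "weyl_solution V z (ivp V 1 w z) (ivp' V 1 w z)"
    unfolding weyl_solution_def using ivp_schrodinger[OF V] by (auto simp: ivp_0 intro!: exI[of _ 0])
  then show ?thesis by blast
qed

text \<open>Existence and uniqueness together make the definite description in \<open>weyl_m\<close>
  meaningful: its value is the slope at 0 of the Weyl solution normalised to 1 there.\<close>

lemma weyl_m_solution:
  assumes V: "L1_sparse V" and z: "Im z > 0"
  shows "weyl_solution V z (ivp V 1 (weyl_m V z) z) (ivp' V 1 (weyl_m V z) z)"
proof -
  obtain w where w: "weyl_solution V z (ivp V 1 w z) (ivp' V 1 w z)"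
    using weyl_solution_exists[OF L1_sparse_locally_integrable[OF V] z] by blast
  have "weyl_m V z = w"
    unfolding weyl_m_def
  proof (rule the_equality)
    show "\<exists>F F'. weyl_solution V z F F' \<and> w = F' 0 / F 0"
      using w by (intro exI[of _ "ivp V 1 w z"] exI[of _ "ivp' V 1 w z"]) (simp add: ivp_0)
    show "w' = w" if "\<exists>F F'. weyl_solution V z F F' \<and> w' = F' 0 / F 0" for w'
      using that weyl_solution_unique[OF V z _ w] by (auto simp: ivp_0)
  qed
  then show ?thesis using w by simp
qed

lemma weyl_flux:
  assumes V: "L1_sparse V" and z: "Im z > 0" and x: "0 \<le> x" "x \<le> y"
  defines "F \<equiv> ivp V 1 (weyl_m V z) z" and "F' \<equiv> ivp' V 1 (weyl_m V z) z"
  shows "Im z * integral {x..y} (\<lambda>t. (cmod (F t))\<^sup>2) \<le> Im (cnj (F x) * F' x)"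
  using weyl_flux_lower[OF V z _ _ x, of F F'] weyl_m_solution[OF V z]
  by (simp add: weyl_solution_def F_def F'_def)

text \<open>Im m is the flux at 0 of the normalised Weyl solution. Were it not positive, the mass on
  [0, 1] would vanish although the solution equals 1 at 0.\<close>

lemma weyl_m_Im_pos:
  assumes V: "L1_sparse V" and z: "Im z > 0" shows "Im (weyl_m V z) > 0"
proof (rule ccontr)
  let ?m = "weyl_m V z"
  have s: "solution_on V z 0 1 (ivp V 1 ?m z) (ivp' V 1 ?m z)"
    using ivp_solution[OF L1_sparse_locally_integrable[OF V]] by simp
  have c: "continuous_on {0..1} (\<lambda>t. (cmod (ivp V 1 ?m z t))\<^sup>2)"
    using solution_on_continuous(1)[OF s] by (intro continuous_intros)
  assume "\<not> Im ?m > 0"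
  then have "Im z * integral {0..1} (\<lambda>t. (cmod (ivp V 1 ?m z t))\<^sup>2) \<le> 0"
    using weyl_flux[OF V z, of 0 1] by (simp add: ivp_0)
  moreover have "0 \<le> integral {0..1} (\<lambda>t. (cmod (ivp V 1 ?m z t))\<^sup>2)"
    by (intro integral_nonneg integrable_continuous_interval c) auto
  ultimately have "integral {0..1} (\<lambda>t. (cmod (ivp V 1 ?m z t))\<^sup>2) = 0" using z by (simp add: mult_le_0_iff)
  then have "ivp V 1 ?m z 0 = 0" using integral_eq_0_iff[OF c] by auto
  then show False by (simp add: ivp_0)
qed

section \<open>Green functions and decay\<close>


text \<open>\<open>p x * F x\<close> is the diagonal of the Green function for the real boundary
  condition satisfied by \<open>p\<close>. Multiplying its conjugate by the Wronskian 1 shows that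
  its imaginary part is |p|^2 flux(F) - |F|^2 flux(p), where flux(p) <= 0. For the size, |F(x)|^2 is
  at most a constant over l Im z times flux(F); hence |p F|^2 is at most that multiple of |p F|, and
  one factor cancels.\<close>

lemma green_product_bound:
  assumes V: "L1_sparse V" and z: "Im z > 0" and F: "schrodinger_solution V z F F'"
    and L2: "(\<lambda>x. (cmod (F x))\<^sup>2) absolutely_integrable_on {0<..}"
    and x: "0 \<le> x" and p: "solution_on V z 0 x p p'" and p0: "Im (cnj (p 0) * p' 0) = 0"
    and W: "F 0 * p' 0 - F' 0 * p 0 = 1"
  shows "(cmod (p x))\<^sup>2 * Im (cnj (F x) * F' x) \<le> Im (p x * F x)"
    and "R \<ge> 1 \<Longrightarrow> cmod z \<le> R \<Longrightarrow> l = 1 / (4 * R) \<Longrightarrow> integral {x..x+l} (\<lambda>t. \<bar>V t\<bar>) \<le> 1 / 4 \<Longrightarrow>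
      cmod (p x * F x) \<le> 600 / (l * Im z)"
proof -
  have lV: "locally_integrable V" using V by (rule L1_sparse_locally_integrable)
  have s: "solution_on V z a b F F'" if "0 \<le> a" for a b using schrodinger_solution_on[OF lV F that] .
  have "Im z * integral {0..x} (\<lambda>t. (cmod (p t))\<^sup>2) = - Im (cnj (p x) * p' x)"
    using green_identity[OF p, of 0 x] x p0 by simp
  moreover have "0 \<le> integral {0..x} (\<lambda>t. (cmod (p t))\<^sup>2)"
    using solution_on_norm_sq_integrable[OF p] by (intro integral_nonneg) auto
  ultimately have pneg: "Im (cnj (p x) * p' x) \<le> 0" using z by (smt (verit) mult_nonneg_nonneg)
  have W': "F x * p' x - F' x * p x = 1" using wronskian_constant[OF s p, of x] x W by simp
  have "cnj (p x * F x) = cnj (p x * F x) * (F x * p' x - F' x * p x)" unfolding W' by simp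
  also have "\<dots> = (F x * cnj (F x)) * (cnj (p x) * p' x) - (p x * cnj (p x)) * (cnj (F x) * F' x)"
    by (simp add: algebra_simps)
  also have "\<dots> = of_real ((cmod (F x))\<^sup>2) * (cnj (p x) * p' x) - of_real ((cmod (p x))\<^sup>2) * (cnj (F x) * F' x)"
    by (simp only: complex_norm_square)
  finally have "Im (cnj (p x * F x)) = (cmod (F x))\<^sup>2 * Im (cnj (p x) * p' x) - (cmod (p x))\<^sup>2 * Im (cnj (F x) * F' x)"
    by (metis Im_complex_of_real Re_complex_of_real add.right_neutral minus_complex.simps(2) mult_zero_left times_complex.simps(2))
  moreover have "(cmod (F x))\<^sup>2 * Im (cnj (p x) * p' x) \<le> 0" using pneg by (simp add: mult_nonneg_nonpos)
  ultimately show 1: "(cmod (p x))\<^sup>2 * Im (cnj (F x) * F' x) \<le> Im (p x * F x)" by simp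
  assume R: "R \<ge> 1" "cmod z \<le> R" "l = 1 / (4 * R)" and Vx: "integral {x..x+l} (\<lambda>t. \<bar>V t\<bar>) \<le> 1 / 4"
  have l: "l > 0" using R by simp
  let ?I = "integral {x..x+l} (\<lambda>t. (cmod (F t))\<^sup>2)"
  have I0: "0 \<le> ?I" using solution_on_norm_sq_integrable[OF s[OF x, of "x+l"]] by (intro integral_nonneg) auto
  have "cmod (F x) \<le> 14 * sqrt (3 / l * ?I)"
    using mean_square_bound(1)[OF _ Vx R s[OF x]] locally_integrable_abs_integrable[OF lV x] l by simp
  then have "(cmod (F x))\<^sup>2 \<le> (14 * sqrt (3 / l * ?I))\<^sup>2" by (intro power_mono) auto
  \<comment> \<open>588 is 3 times the square of 14, from \<open>mean_square_bound\<close>; it is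
    rounded up to 600 below.\<close>
  also have "\<dots> = 588 / l * ?I" using l I0 by (simp add: power_mult_distrib)
  also have "\<dots> \<le> 588 / l * (Im (cnj (F x) * F' x) / Im z)"
    using weyl_flux_lower[OF V z F L2 x, of "x+l"] l z by (intro mult_left_mono) (auto simp: field_simps)
  finally have Fx: "(cmod (F x))\<^sup>2 \<le> 588 / (l * Im z) * Im (cnj (F x) * F' x)" by simp
  have "(cmod (p x * F x))\<^sup>2 = (cmod (p x))\<^sup>2 * (cmod (F x))\<^sup>2" by (simp add: norm_mult power_mult_distrib)
  also have "\<dots> \<le> (cmod (p x))\<^sup>2 * (588 / (l * Im z) * Im (cnj (F x) * F' x))"
    using Fx by (intro mult_left_mono) auto
  also have "\<dots> = 588 / (l * Im z) * ((cmod (p x))\<^sup>2 * Im (cnj (F x) * F' x))" by simp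
  also have "\<dots> \<le> 588 / (l * Im z) * cmod (p x * F x)"
    using 1 abs_Im_le_cmod[of "p x * F x"] l z by (intro mult_left_mono) auto
  also have "\<dots> \<le> 600 / (l * Im z) * cmod (p x * F x)"
    using l z by (intro mult_right_mono divide_right_mono) auto
  finally have sq: "cmod (p x * F x) * cmod (p x * F x) \<le> 600 / (l * Im z) * cmod (p x * F x)"
    by (simp add: power2_eq_square)
  show "cmod (p x * F x) \<le> 600 / (l * Im z)"
  proof (cases "cmod (p x * F x) = 0")
    case True
    then show ?thesis using l z by (simp only:) simp
  next
    case False
    then have "0 < cmod (p x * F x)" by simp
    with sq show ?thesis by (rule mult_right_le_imp_le)
  qed
qed

text \<open>The Dirichlet Green function on the diagonal, at (x, x). The second factor is the Weyl
  solution, whose Wronskian with \<open>ivp V 0 1\<close> is 1.\<close>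

definition greenD :: "(real \<Rightarrow> real) \<Rightarrow> real \<Rightarrow> complex \<Rightarrow> complex" where
  "greenD V x z = ivp V 0 1 z x * (ivp V 1 0 z x + weyl_m V z * ivp V 0 1 z x)"

text \<open>The Neumann counterpart: the factor -1/m restores the Wronskian 1 between the Weyl
  solution and \<open>ivp V 1 0\<close>.\<close>

definition greenN :: "(real \<Rightarrow> real) \<Rightarrow> real \<Rightarrow> complex \<Rightarrow> complex" where
  "greenN V x z = ivp V 1 0 z x * ((- 1 / weyl_m V z) * (ivp V 1 0 z x + weyl_m V z * ivp V 0 1 z x))"

text \<open>\<open>g\<close> is the flux of the Weyl solution at x, rewritten by the Green identity
  on [0, x] so that its behaviour for small Im z becomes visible. In the Neumann case the factor
  -1/m divides it by |m|^2.\<close>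

lemma green_bounds:
  fixes z :: complex
  assumes V: "L1_sparse V" and z: "Im z > 0" and x: "0 \<le> x"
  defines "g \<equiv> Im (weyl_m V z) - Im z * integral {0..x} (\<lambda>t. (cmod (ivp V 1 (weyl_m V z) z t))\<^sup>2)"
  shows "g \<ge> 0" "(cmod (ivp V 0 1 z x))\<^sup>2 * g \<le> Im (greenD V x z)"
    "(cmod (ivp V 1 0 z x))\<^sup>2 * (g / (cmod (weyl_m V z))\<^sup>2) \<le> Im (greenN V x z)"
    "R \<ge> 1 \<Longrightarrow> cmod z \<le> R \<Longrightarrow> l = 1 / (4 * R) \<Longrightarrow> integral {x..x+l} (\<lambda>t. \<bar>V t\<bar>) \<le> 1 / 4 \<Longrightarrow>
      cmod (greenD V x z) \<le> 600 / (l * Im z) \<and> cmod (greenN V x z) \<le> 600 / (l * Im z)"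
proof -
  let ?m = "weyl_m V z"
  define F F' where "F = ivp V 1 ?m z" and "F' = ivp' V 1 ?m z"
  have lV: "locally_integrable V" using V by (rule L1_sparse_locally_integrable)
  have m: "?m \<noteq> 0" using weyl_m_Im_pos[OF V z] by auto
  have wF: "schrodinger_solution V z F F'" "(\<lambda>x. (cmod (F x))\<^sup>2) absolutely_integrable_on {0<..}"
    using weyl_m_solution[OF V z] by (auto simp: weyl_solution_def F_def F'_def)
  have g: "Im (cnj (F x) * F' x) = g"
    using green_identity[OF ivp_solution[OF lV order_refl], of 0 x x z 1 ?m] x
    by (simp add: g_def F_def F'_def ivp_0)
  have "Im z * integral {x..x} (\<lambda>t. (cmod (F t))\<^sup>2) \<le> Im (cnj (F x) * F' x)"
    using weyl_flux_lower[OF V z wF x, of x] by simp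
  then show "g \<ge> 0" using g by simp
  have Fx: "F x = ivp V 1 0 z x + ?m * ivp V 0 1 z x" using ivp_linear(1)[OF lV x, of 1 ?m z] by (simp add: F_def)
  have v: "solution_on V z 0 x (ivp V 0 1 z) (ivp' V 0 1 z)" and u: "solution_on V z 0 x (ivp V 1 0 z) (ivp' V 1 0 z)"
    using ivp_solution[OF lV] by auto
  note D = green_product_bound[OF V z wF x v]
  have W: "F 0 * ivp' V 0 1 z 0 - F' 0 * ivp V 0 1 z 0 = 1" "Im (cnj (ivp V 0 1 z 0) * ivp' V 0 1 z 0) = 0"
    by (auto simp: F_def F'_def ivp_0)
  show "(cmod (ivp V 0 1 z x))\<^sup>2 * g \<le> Im (greenD V x z)"
    using D(1)[OF W(2,1)] g Fx by (simp add: greenD_def)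
  let ?c = "- 1 / ?m"
  have wG: "schrodinger_solution V z (\<lambda>t. ?c * F t) (\<lambda>t. ?c * F' t)"
  proof (rule solution_on_schrodinger)
    fix b :: real assume "0 \<le> b"
    have "solution_on V z 0 b F F'" using schrodinger_solution_on[OF lV wF(1)] by simp
    from solution_on_linear[OF this this, of ?c 0] show "solution_on V z 0 b (\<lambda>t. ?c * F t) (\<lambda>t. ?c * F' t)" by simp
  qed
  have LG: "(\<lambda>x. (cmod (?c * F x))\<^sup>2) absolutely_integrable_on {0<..}"
    unfolding norm_mult power_mult_distrib using wF(2) by (intro set_integrable_mult_right) auto
  note N = green_product_bound[OF V z wG LG x u]
  have WN: "?c * F 0 * ivp' V 1 0 z 0 - ?c * F' 0 * ivp V 1 0 z 0 = 1" "Im (cnj (ivp V 1 0 z 0) * ivp' V 1 0 z 0) = 0"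
    using m by (auto simp: F_def F'_def ivp_0)
  have "cnj (?c * F x) * (?c * F' x) = (?c * cnj ?c) * (cnj (F x) * F' x)" by simp
  also have "?c * cnj ?c = of_real ((cmod ?c)\<^sup>2)" by (rule complex_norm_square[symmetric])
  finally have "Im (cnj (?c * F x) * (?c * F' x)) = (cmod ?c)\<^sup>2 * Im (cnj (F x) * F' x)" by (simp only: Im_complex_of_real Re_complex_of_real times_complex.simps)
  also have "(cmod ?c)\<^sup>2 = 1 / (cmod ?m)\<^sup>2" by (simp add: norm_divide power_divide)
  finally have gN: "Im (cnj (?c * F x) * (?c * F' x)) = g / (cmod ?m)\<^sup>2" using g by simp
  have GN: "greenN V x z = ivp V 1 0 z x * (?c * F x)" unfolding greenN_def Fx ..
  show "(cmod (ivp V 1 0 z x))\<^sup>2 * (g / (cmod ?m)\<^sup>2) \<le> Im (greenN V x z)"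
    using N(1)[OF WN(2,1)] unfolding gN GN .
  assume R: "R \<ge> 1" "cmod z \<le> R" "l = 1 / (4 * R)" "integral {x..x+l} (\<lambda>t. \<bar>V t\<bar>) \<le> 1 / 4"
  have "cmod (greenD V x z) \<le> 600 / (l * Im z)"
    using D(2)[OF W(2,1) R] Fx by (simp add: greenD_def)
  moreover have "cmod (greenN V x z) \<le> 600 / (l * Im z)"
    using N(2)[OF WN(2,1) R] unfolding GN .
  ultimately show "cmod (greenD V x z) \<le> 600 / (l * Im z) \<and> cmod (greenN V x z) \<le> 600 / (l * Im z)" ..
qed

lemma green_nonneg:
  assumes V: "L1_sparse V" and z: "Im z > 0" and x: "0 \<le> x"
  shows "0 \<le> Im (greenD V x z)" "0 \<le> Im (greenN V x z)"
  using green_bounds(2,3)[OF assms] green_bounds(1)[OF assms]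
  by (meson order_trans mult_nonneg_nonneg divide_nonneg_nonneg zero_le_power2)+

text \<open>Of the flux Im m at 0, only Im z times the mass on [0, x] is lost on the way to x. For
  bounded energies with |m| <= L this mass is at most \<open>K\<close>, so for Im z < c / (2 K) a
  flux of at least c/2 is left. The threshold depends on x.\<close>

lemma green_lower_bound:
  assumes V: "L1_sparse V" and x: "0 \<le> x" and c: "c > 0" and L: "L > 0"
  obtains e where "e > 0" "\<And>z. 0 < Im z \<Longrightarrow> Im z < e \<Longrightarrow> cmod z \<le> R \<Longrightarrow> c \<le> Im (weyl_m V z) \<Longrightarrow> cmod (weyl_m V z) \<le> L \<Longrightarrow>
     c / 2 * (cmod (ivp V 0 1 z x))\<^sup>2 \<le> Im (greenD V x z) \<and> c / (2 * L\<^sup>2) * (cmod (ivp V 1 0 z x))\<^sup>2 \<le> Im (greenN V x z)"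
proof -
  have lV: "locally_integrable V" using V by (rule L1_sparse_locally_integrable)
  obtain C1 where C1: "C1 > 0" "\<And>z t. cmod z \<le> R \<Longrightarrow> t \<in> {0..x} \<Longrightarrow> cmod (ivp V 1 0 z t) \<le> C1"
    using ivp_bounded[OF lV] by blast
  obtain C2 where C2: "C2 > 0" "\<And>z t. cmod z \<le> R \<Longrightarrow> t \<in> {0..x} \<Longrightarrow> cmod (ivp V 0 1 z t) \<le> C2"
    using ivp_bounded[OF lV] by blast
  define K where "K = (C1 + L * C2)\<^sup>2 * (x + 1)"
  have K: "K > 0" using C1 C2 L x add_pos_pos[of C1 "L * C2"] by (simp add: K_def)
  show ?thesis
  proof (rule that[of "c / (2 * K)"])
    show "c / (2 * K) > 0" using c K by simp
    fix z assume z: "0 < Im z" "Im z < c / (2 * K)" "cmod z \<le> R" and m: "c \<le> Im (weyl_m V z)" "cmod (weyl_m V z) \<le> L"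
    let ?I = "integral {0..x} (\<lambda>t. (cmod (ivp V 1 (weyl_m V z) z t))\<^sup>2)"
    define g where "g = Im (weyl_m V z) - Im z * ?I"
    have "?I \<le> integral {0..x} (\<lambda>t. (C1 + L * C2)\<^sup>2)"
    proof (rule integral_le)
      show "(\<lambda>t. (cmod (ivp V 1 (weyl_m V z) z t))\<^sup>2) integrable_on {0..x}"
        using solution_on_norm_sq_integrable[OF ivp_solution[OF lV order_refl] order_refl order_refl] .
      fix t assume t: "t \<in> {0..x}"
      have "cmod (ivp V 1 (weyl_m V z) z t) \<le> cmod (ivp V 1 0 z t) + cmod (weyl_m V z) * cmod (ivp V 0 1 z t)"
        using ivp_linear(1)[OF lV, of t 1 "weyl_m V z" z] t norm_triangle_ineq[of "ivp V 1 0 z t" "weyl_m V z * ivp V 0 1 z t"] by (simp add: norm_mult)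
      also have "\<dots> \<le> C1 + L * C2" using C1 C2 L m t z by (intro add_mono mult_mono) auto
      finally show "(cmod (ivp V 1 (weyl_m V z) z t))\<^sup>2 \<le> (C1 + L * C2)\<^sup>2" by (intro power_mono) auto
    qed auto
    also have "\<dots> = (C1 + L * C2)\<^sup>2 * x" using x by simp
    also have "\<dots> \<le> K" unfolding K_def by (intro mult_left_mono) auto
    finally have "?I \<le> K" .
    moreover have "0 \<le> ?I"
      by (intro integral_nonneg solution_on_norm_sq_integrable[OF ivp_solution[OF lV order_refl] order_refl order_refl]) auto
    ultimately have "Im z * ?I \<le> c / (2 * K) * K" using z K c by (intro mult_mono) auto
    then have g: "c / 2 \<le> g" using m K by (simp add: g_def)
    have "c / 2 * (cmod (ivp V 0 1 z x))\<^sup>2 \<le> g * (cmod (ivp V 0 1 z x))\<^sup>2" using g by (intro mult_right_mono) auto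
    also have "\<dots> \<le> Im (greenD V x z)" using green_bounds(2)[OF V z(1) x] by (simp add: g_def mult.commute)
    finally have 1: "c / 2 * (cmod (ivp V 0 1 z x))\<^sup>2 \<le> Im (greenD V x z)" .
    have m0: "cmod (weyl_m V z) > 0" using m c by (metis abs_Im_le_cmod abs_of_nonneg less_le_trans linorder_not_less norm_ge_zero order_less_le zero_complex.simps(2) norm_zero norm_eq_zero)
    have "c / (2 * L\<^sup>2) \<le> g / (cmod (weyl_m V z))\<^sup>2"
    proof -
      have "c / 2 / L\<^sup>2 \<le> g / (cmod (weyl_m V z))\<^sup>2"
        using g c m m0 L by (intro frac_le power_mono) auto
      then show ?thesis by simp
    qed
    then have "c / (2 * L\<^sup>2) * (cmod (ivp V 1 0 z x))\<^sup>2 \<le> g / (cmod (weyl_m V z))\<^sup>2 * (cmod (ivp V 1 0 z x))\<^sup>2"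
      by (intro mult_right_mono) auto
    also have "\<dots> \<le> Im (greenN V x z)" using green_bounds(3)[OF V z(1) x] by (simp add: g_def mult.commute)
    finally show "c / 2 * (cmod (ivp V 0 1 z x))\<^sup>2 \<le> Im (greenD V x z) \<and> c / (2 * L\<^sup>2) * (cmod (ivp V 1 0 z x))\<^sup>2 \<le> Im (greenN V x z)"
      using 1 by blast
  qed
qed

text \<open>Since k^2 = -z, (p' + k p)' = k (p' + k p) + V p, and the integrating factor leaves the
  potential term alone. It is applied with both roots, k and -k.\<close>

lemma exponential_component:
  assumes p: "solution_on V z x y p p'" and k: "k\<^sup>2 = - z" and xy: "x \<le> y"
  shows "((\<lambda>s. exp (k * of_real (t - s)) * (of_real (V s) * p s)) has_integral
     (exp (k * of_real (t - y)) * (p' y + k * p y) - exp (k * of_real (t - x)) * (p' x + k * p x))) {x..y}"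
proof -
  have P: "indef_integral x y p p'" "indef_integral x y p' (\<lambda>t. (complex_of_real (V t) - z) * p t)"
    using p by (auto simp: solution_on_def)
  have 1: "indef_integral x y (\<lambda>s. p' s + k * p s) (\<lambda>s. (complex_of_real (V s) - z) * p s + k * p' s)"
    by (intro indef_integral_add indef_integral_cmult P)
  have 2: "indef_integral x y (\<lambda>s. exp (k * of_real (t - s))) (\<lambda>s. - k * exp (k * of_real (t - s)))"
  proof (rule indef_integral_vector_derivative)
    fix s :: real
    have "((\<lambda>w. exp (k * (of_real t - w))) has_field_derivative (- k * exp (k * (of_real t - of_real s)))) (at (of_real s))"
      by (auto intro!: derivative_eq_intros)
    from has_vector_derivative_real_field[OF this]
    show "((\<lambda>s. exp (k * of_real (t - s))) has_vector_derivative - k * exp (k * of_real (t - s))) (at s within {x..y})"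
      by (auto intro: has_vector_derivative_at_within)
  qed (intro continuous_intros)
  have z: "z = - k\<^sup>2" using k by simp
  have "indef_integral x y (\<lambda>s. exp (k * of_real (t - s)) * (p' s + k * p s)) (\<lambda>s. exp (k * of_real (t - s)) * (of_real (V s) * p s))"
    by (rule indef_integral_eq[OF indef_integral_mult[OF 2 1]])
       (auto simp: algebra_simps z power2_eq_square)
  then show ?thesis using indef_integral_has_integral xy by blast
qed

text \<open>Without potential, p' + k p is a multiple of exp(k t) and p' - k p one of exp(-k t), so
  the first is estimated from the right end and the second from the left end. The potential term
  involves the maximum \<open>M\<close> of |p|, which is bounded beforehand by the end data
  \<open>S\<close>.\<close>

lemma interior_decay:
  assumes V: "(\<lambda>t. \<bar>V t\<bar>) integrable_on {x..y}" "integral {x..y} (\<lambda>t. \<bar>V t\<bar>) \<le> \<eta>" and \<eta>: "\<eta> \<le> \<kappa>"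
    and k: "k\<^sup>2 = - z" "Re k \<ge> \<kappa>" "\<kappa> > 0"
    and p: "solution_on V z x y p p'" and xy: "x \<le> y"
  defines "S \<equiv> cmod (p' y + k * p y) + cmod (p' x - k * p x)"
    and "\<tau> \<equiv> exp (- \<kappa> * (y - x) / 2) + \<eta> / \<kappa>" and "t \<equiv> (x + y) / 2"
  shows "cmod (p' t + k * p t) \<le> \<tau> * S" "cmod (p' t - k * p t) \<le> \<tau> * S"
proof -
  have c: "continuous_on {x..y} (\<lambda>t. cmod (p t))"
    using solution_on_continuous(1)[OF p] by (intro continuous_intros)
  obtain tm where tm: "tm \<in> {x..y}" "\<And>t. t \<in> {x..y} \<Longrightarrow> cmod (p t) \<le> cmod (p tm)"
    using continuous_attains_sup[OF _ _ c] xy by fastforce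
  define M where "M = cmod (p tm)"
  define J where "J a b = integral {a..b} (\<lambda>t. \<bar>V t\<bar>)" for a b
  have Ji: "(\<lambda>t. \<bar>V t\<bar>) integrable_on {a..b}" if "x \<le> a" "b \<le> y" for a b
    using V(1) that by (auto intro: integrable_on_subinterval)
  have J0: "0 \<le> J a b" if "x \<le> a" "b \<le> y" for a b unfolding J_def using Ji[OF that] by (intro integral_nonneg) auto
  have Jadd: "J x t + J t y \<le> \<eta>" if "t \<in> {x..y}" for t
    using Henstock_Kurzweil_Integration.integral_combine[of x t y "\<lambda>t. \<bar>V t\<bar>"] V that by (simp add: J_def)
  have B: "cmod (p' t + k * p t) \<le> exp (- \<kappa> * (y - t)) * cmod (p' y + k * p y) + M * J t y"
    if t: "t \<in> {x..y}" for t
  proof -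
    let ?I = "exp (k * of_real (t - y)) * (p' y + k * p y) - exp (k * of_real (t - t)) * (p' t + k * p t)"
    have "((\<lambda>s. exp (k * of_real (t - s)) * (of_real (V s) * p s)) has_integral ?I) {t..y}"
      using t by (intro exponential_component[OF _ k(1)] solution_on_subinterval[OF p]) auto
    then have "cmod ?I \<le> M * J t y"
      unfolding J_def
    proof (rule integral_bound_sup)
      show "(\<lambda>t. \<bar>V t\<bar>) integrable_on {t..y}" using Ji t by auto
      fix s assume s: "s \<in> {t..y}"
      have "cmod (exp (k * of_real (t - s))) \<le> 1"
        using s k by (simp add: mult_nonneg_nonpos)
      then show "cmod (exp (k * of_real (t - s)) * (of_real (V s) * p s)) \<le> M * \<bar>V s\<bar>"
        using tm(2)[of s] s t mult_mono[of "cmod (exp (k * of_real (t - s)))" 1 "\<bar>V s\<bar> * cmod (p s)" "\<bar>V s\<bar> * M"]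
        by (simp add: norm_mult M_def mult_left_mono mult.commute)
    qed
    moreover have "p' t + k * p t = exp (k * of_real (t - y)) * (p' y + k * p y) - ?I" by simp
    then have "cmod (p' t + k * p t) \<le> cmod (exp (k * of_real (t - y)) * (p' y + k * p y)) + cmod ?I"
      by (rule order_trans[OF eq_refl[OF arg_cong[of _ _ cmod]] norm_triangle_ineq4])
    ultimately have "cmod (p' t + k * p t) \<le> cmod (exp (k * of_real (t - y)) * (p' y + k * p y)) + M * J t y"
      by linarith
    also have "cmod (exp (k * of_real (t - y)) * (p' y + k * p y)) = exp (Re k * (t - y)) * cmod (p' y + k * p y)"
      by (simp add: norm_mult)
    also have "\<dots> \<le> exp (- \<kappa> * (y - t)) * cmod (p' y + k * p y)"
      using t k mult_right_mono[of \<kappa> "Re k" "y - t"] by (intro mult_right_mono) (auto simp: algebra_simps)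
    finally show ?thesis by simp
  qed
  have C: "cmod (p' t - k * p t) \<le> exp (- \<kappa> * (t - x)) * cmod (p' x - k * p x) + M * J x t"
    if t: "t \<in> {x..y}" for t
  proof -
    let ?I = "exp (- k * of_real (t - t)) * (p' t + (- k) * p t) - exp (- k * of_real (t - x)) * (p' x + (- k) * p x)"
    have k': "(- k)\<^sup>2 = - z" using k by simp
    have "((\<lambda>s. exp (- k * of_real (t - s)) * (of_real (V s) * p s)) has_integral ?I) {x..t}"
      using t by (intro exponential_component[OF _ k'] solution_on_subinterval[OF p]) auto
    then have "cmod ?I \<le> M * J x t"
      unfolding J_def
    proof (rule integral_bound_sup)
      show "(\<lambda>t. \<bar>V t\<bar>) integrable_on {x..t}" using Ji t by auto
      fix s assume s: "s \<in> {x..t}"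
      have "cmod (exp (- k * of_real (t - s))) \<le> 1"
        using s k by (simp add: mult_nonneg_nonneg)
      then show "cmod (exp (- k * of_real (t - s)) * (of_real (V s) * p s)) \<le> M * \<bar>V s\<bar>"
        using tm(2)[of s] s t mult_mono[of "cmod (exp (- k * of_real (t - s)))" 1 "\<bar>V s\<bar> * cmod (p s)" "\<bar>V s\<bar> * M"]
        by (simp add: norm_mult M_def mult_left_mono mult.commute)
    qed
    moreover have "p' t - k * p t = exp (- k * of_real (t - x)) * (p' x - k * p x) + ?I" by simp
    then have "cmod (p' t - k * p t) \<le> cmod (exp (- k * of_real (t - x)) * (p' x - k * p x)) + cmod ?I"
      by (rule order_trans[OF eq_refl[OF arg_cong[of _ _ cmod]] norm_triangle_ineq])
    ultimately have "cmod (p' t - k * p t) \<le> cmod (exp (- k * of_real (t - x)) * (p' x - k * p x)) + M * J x t"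
      by linarith
    also have "cmod (exp (- k * of_real (t - x)) * (p' x - k * p x)) = exp (- (Re k * (t - x))) * cmod (p' x - k * p x)"
      by (simp add: norm_mult)
    also have "\<dots> \<le> exp (- \<kappa> * (t - x)) * cmod (p' x - k * p x)"
      using t k mult_right_mono[of \<kappa> "Re k" "t - x"] by (intro mult_right_mono) (auto simp: algebra_simps)
    finally show ?thesis by simp
  qed
  have M0: "0 \<le> M" by (simp add: M_def)
  have kk: "\<kappa> \<le> cmod k" using k complex_Re_le_cmod[of k] by linarith
  \<comment> \<open>At the maximum point 2 k p is the difference of the two components. The
    potential contributes at most M \<eta> <= M \<kappa>, which the left-hand side absorbs.\<close>
  have "2 * \<kappa> * M \<le> 2 * cmod k * M" using kk M0 by (intro mult_right_mono) auto
  also have "\<dots> = cmod ((p' tm + k * p tm) - (p' tm - k * p tm))" by (simp add: M_def norm_mult)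
  also have "\<dots> \<le> cmod (p' tm + k * p tm) + cmod (p' tm - k * p tm)" by (rule norm_triangle_ineq4)
  also have "\<dots> \<le> (exp (- \<kappa> * (y - tm)) * cmod (p' y + k * p y) + M * J tm y) + (exp (- \<kappa> * (tm - x)) * cmod (p' x - k * p x) + M * J x tm)"
    using B[OF tm(1)] C[OF tm(1)] by linarith
  also have "\<dots> = exp (- \<kappa> * (y - tm)) * cmod (p' y + k * p y) + exp (- \<kappa> * (tm - x)) * cmod (p' x - k * p x) + M * (J x tm + J tm y)"
    by (simp add: algebra_simps)
  also have "\<dots> \<le> 1 * cmod (p' y + k * p y) + 1 * cmod (p' x - k * p x) + M * \<kappa>"
    using tm(1) k M0 Jadd[OF tm(1)] \<eta> by (intro add_mono mult_right_mono mult_left_mono) auto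
  finally have "\<kappa> * M \<le> S" by (simp add: S_def algebra_simps)
  then have M: "M \<le> S / \<kappa>" using k by (simp add: field_simps)
  have t: "t \<in> {x..y}" using xy by (auto simp: t_def)
  have e: "exp (- \<kappa> * (y - t)) = exp (- \<kappa> * (y - x) / 2)" "exp (- \<kappa> * (t - x)) = exp (- \<kappa> * (y - x) / 2)"
    by (simp_all add: t_def field_simps)
  have S0: "S \<ge> 0" by (simp add: S_def)
  have MJ: "M * j \<le> \<eta> / \<kappa> * S" if "0 \<le> j" "j \<le> \<eta>" for j
  proof -
    have "M * j \<le> S / \<kappa> * \<eta>" using M that S0 k by (intro mult_mono) auto
    then show ?thesis by (simp add: field_simps)
  qed
  have "cmod (p' t + k * p t) \<le> exp (- \<kappa> * (y - x) / 2) * cmod (p' y + k * p y) + M * J t y" using B[OF t] by (simp only: e)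
  also have "\<dots> \<le> exp (- \<kappa> * (y - x) / 2) * S + \<eta> / \<kappa> * S"
    using Jadd[OF t] J0[of t y] J0[of x t] t by (intro add_mono mult_left_mono MJ) (auto simp: S_def)
  finally show "cmod (p' t + k * p t) \<le> \<tau> * S" by (simp add: \<tau>_def distrib_right)
  have "cmod (p' t - k * p t) \<le> exp (- \<kappa> * (y - x) / 2) * cmod (p' x - k * p x) + M * J x t" using C[OF t] by (simp only: e)
  also have "\<dots> \<le> exp (- \<kappa> * (y - x) / 2) * S + \<eta> / \<kappa> * S"
    using Jadd[OF t] J0[of t y] J0[of x t] t by (intro add_mono mult_left_mono MJ) (auto simp: S_def)
  finally show "cmod (p' t - k * p t) \<le> \<tau> * S" by (simp add: \<tau>_def distrib_right)
qed

text \<open>The Green functions control |p| at single points; \<open>two_point_bound\<close> on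
  [x, x + l] and [y - l, y] recovers the end data, derivatives included, from four such points.
  There 13 / l = 52 R, and 52 + 14 = 66; squaring the sum of two such terms gives 8712, twice the
  square of 66.\<close>

lemma end_data_bound:
  assumes V: "(\<lambda>t. \<bar>V t\<bar>) integrable_on {x..y}" "integral {x..y} (\<lambda>t. \<bar>V t\<bar>) \<le> 1 / 4"
    and R: "R \<ge> 1" "cmod z \<le> R" "l = 1 / (4 * R)" and k: "k\<^sup>2 = - z"
    and p: "solution_on V z x y p p'" and xy: "x + l \<le> y"
  shows "(cmod (p' y + k * p y) + cmod (p' x - k * p x))\<^sup>2 \<le> 8712 * R\<^sup>2 * (\<Sum>t\<leftarrow>[x, x + l, y - l, y]. (cmod (p t))\<^sup>2)"
proof -
  have l: "l > 0" using R by auto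
  have "(cmod k)\<^sup>2 \<le> R\<^sup>2"
  proof -
    have "(cmod k)\<^sup>2 = cmod z" using k by (metis norm_minus_cancel norm_power)
    also have "\<dots> \<le> R * R" using R(1,2) mult_right_mono[of 1 R R] by linarith
    finally show ?thesis by (simp add: power2_eq_square)
  qed
  then have kR: "cmod k \<le> R" using R by (simp add: power2_le_iff_abs_le)
  have *: "cmod (p' r) + cmod k * cmod (p r) \<le> 66 * R * max (cmod (p a)) (cmod (p (a + l)))"
    if a: "x \<le> a" "a + l \<le> y" and r: "r \<in> {a..a+l}" for a r
  proof -
    let ?B = "max (cmod (p a)) (cmod (p (a + l)))"
    have Vi: "(\<lambda>t. \<bar>V t\<bar>) integrable_on {a..a+l}" using V(1) a by (auto intro: integrable_on_subinterval)
    have "integral {a..a+l} (\<lambda>t. \<bar>V t\<bar>) \<le> integral {x..y} (\<lambda>t. \<bar>V t\<bar>)"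
      using a V by (intro integral_subset_le Vi) auto
    then have V4: "integral {a..a+l} (\<lambda>t. \<bar>V t\<bar>) \<le> 1 / 4" using V by linarith
    have "cmod (p r) \<le> 14 * ?B" "cmod (p' r) \<le> 13 * ?B / l"
      using two_point_bound[OF Vi V4 R solution_on_subinterval[OF p a], of a "a + l" ?B r] l r by auto
    moreover have "cmod k * cmod (p r) \<le> R * (14 * ?B)" using calculation kR R by (intro mult_mono) auto
    moreover have "13 * ?B / l = 52 * R * ?B" using R(1) by (simp add: R(3))
    ultimately show ?thesis by (simp add: algebra_simps)
  qed
  define A where "A = max (cmod (p x)) (cmod (p (x + l)))"
  define B where "B = max (cmod (p (y - l))) (cmod (p y))"
  have "cmod (p' y + k * p y) \<le> 66 * R * B"
    using *[of "y - l" y] xy l norm_triangle_ineq[of "p' y" "k * p y"] by (simp add: norm_mult B_def)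
  moreover have "cmod (p' x - k * p x) \<le> 66 * R * A"
    using *[of x x] xy l norm_triangle_ineq4[of "p' x" "k * p x"] by (simp add: norm_mult A_def)
  ultimately have "cmod (p' y + k * p y) + cmod (p' x - k * p x) \<le> 66 * R * (A + B)" by (simp add: algebra_simps)
  then have "(cmod (p' y + k * p y) + cmod (p' x - k * p x))\<^sup>2 \<le> (66 * R * (A + B))\<^sup>2" by (intro power_mono) auto
  also have "\<dots> = 4356 * R\<^sup>2 * (A + B)\<^sup>2" by (simp add: power_mult_distrib)
  also have "\<dots> \<le> 4356 * R\<^sup>2 * (2 * (A\<^sup>2 + B\<^sup>2))"
    using sum_squares_bound[of A B] by (intro mult_left_mono) (auto simp: power2_sum)
  also have "\<dots> \<le> 4356 * R\<^sup>2 * (2 * (((cmod (p x))\<^sup>2 + (cmod (p (x + l)))\<^sup>2) + ((cmod (p (y - l)))\<^sup>2 + (cmod (p y))\<^sup>2)))"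
    by (intro mult_left_mono add_mono) (auto simp: A_def B_def max_def)
  also have "\<dots> = 8712 * R\<^sup>2 * (\<Sum>t\<leftarrow>[x, x + l, y - l, y]. (cmod (p t))\<^sup>2)" by simp
  finally show ?thesis .
qed

text \<open>The Wronskian of the two fundamental solutions is 1, while in the middle of a long good interval
  both exponential components of any solution are a small multiple of its size near the ends.\<close>

lemma good_interval_lower_bound:
  assumes V: "locally_integrable V" and x: "0 \<le> x" "x + l \<le> y" and \<eta>: "integral {x..y} (\<lambda>t. \<bar>V t\<bar>) \<le> \<eta>" "\<eta> \<le> \<kappa>" "\<eta> \<le> 1 / 4"
    and R: "R \<ge> 1" "cmod z \<le> R" "l = 1 / (4 * R)"
    and \<kappa>: "\<kappa> > 0" "Re z \<le> - \<kappa>\<^sup>2"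
  defines "\<tau> \<equiv> exp (- \<kappa> * (y - x) / 2) + \<eta> / \<kappa>"
  shows "2 * \<kappa> \<le> \<tau>\<^sup>2 * (8712 * R\<^sup>2 * (\<Sum>t\<leftarrow>[x, x + l, y - l, y]. (cmod (ivp V 1 0 z t))\<^sup>2 + (cmod (ivp V 0 1 z t))\<^sup>2))"
proof -
  \<comment> \<open>The root with nonnegative real part; from (Re k)^2 >= - Re z >= \<kappa>^2 that
    real part is at least \<kappa>.\<close>
  define k where "k = csqrt (- z)"
  have k: "k\<^sup>2 = - z" by (simp add: k_def)
  have "(Re k)\<^sup>2 - (Im k)\<^sup>2 = - Re z" using arg_cong[OF k, of Re] by (simp add: power2_eq_square)
  then have "\<kappa>\<^sup>2 \<le> (Re k)\<^sup>2" using \<kappa>(2) zero_le_power2[of "Im k"] by linarith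
  moreover have "Re k \<ge> 0" using csqrt_principal[of "- z"] by (auto simp: k_def)
  ultimately have Rk: "Re k \<ge> \<kappa>" by (rule power2_le_imp_le)
  have xy: "x \<le> y" using x R by (smt (verit) divide_nonneg_nonneg)
  have Vi: "(\<lambda>t. \<bar>V t\<bar>) integrable_on {x..y}" using locally_integrable_abs_integrable[OF V x(1)] .
  have V4: "integral {x..y} (\<lambda>t. \<bar>V t\<bar>) \<le> 1/4" using \<eta> by linarith
  have s: "solution_on V z x y (ivp V c0 c1 z) (ivp' V c0 c1 z)" for c0 c1 using ivp_solution[OF V x(1)] .
  define t where "t = (x + y) / 2"
  define u u' v v' where "u = ivp V 1 0 z" "u' = ivp' V 1 0 z" "v = ivp V 0 1 z" "v' = ivp' V 0 1 z"
  note d = \<open>u = _\<close> \<open>u' = _\<close> \<open>v = _\<close> \<open>v' = _\<close>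
  define Su where "Su = cmod (u' y + k * u y) + cmod (u' x - k * u x)"
  define Sv where "Sv = cmod (v' y + k * v y) + cmod (v' x - k * v x)"
  have U: "cmod (u' t + k * u t) \<le> \<tau> * Su" "cmod (u' t - k * u t) \<le> \<tau> * Su"
    using interior_decay[OF Vi \<eta>(1,2) k Rk \<kappa>(1) s xy] by (simp_all add: Su_def \<tau>_def t_def d)
  have Vv: "cmod (v' t + k * v t) \<le> \<tau> * Sv" "cmod (v' t - k * v t) \<le> \<tau> * Sv"
    using interior_decay[OF Vi \<eta>(1,2) k Rk \<kappa>(1) s xy] by (simp_all add: Sv_def \<tau>_def t_def d)
  have "t \<ge> 0" using x xy by (simp add: t_def)
  then have W: "u t * v' t - u' t * v t = 1"
    using wronskian_constant[OF ivp_solution[OF V order_refl] ivp_solution[OF V order_refl], of t t 1 0 z 0 1]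
    by (simp add: d ivp_0)
  \<comment> \<open>The Wronskian in exponential components: each product pairs a component of u
    with one of v, both small at the midpoint.\<close>
  have "2 * k = 2 * k * (u t * v' t - u' t * v t)" by (simp add: W)
  also have "\<dots> = (u' t + k * u t) * (v' t - k * v t) - (u' t - k * u t) * (v' t + k * v t)"
    by (simp add: algebra_simps)
  finally have "cmod (2 * k) \<le> cmod (u' t + k * u t) * cmod (v' t - k * v t) + cmod (u' t - k * u t) * cmod (v' t + k * v t)"
    by (metis norm_mult norm_triangle_ineq4)
  also have "\<dots> \<le> (\<tau> * Su) * (\<tau> * Sv) + (\<tau> * Su) * (\<tau> * Sv)"
    using U Vv by (intro add_mono mult_mono) (auto intro: order_trans[OF norm_ge_zero])
  also have "\<dots> = \<tau>\<^sup>2 * (2 * Su * Sv)" by (simp add: power2_eq_square)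
  also have "\<dots> \<le> \<tau>\<^sup>2 * (Su\<^sup>2 + Sv\<^sup>2)" by (intro mult_left_mono sum_squares_bound) auto
  also have "\<dots> \<le> \<tau>\<^sup>2 * (8712 * R\<^sup>2 * (\<Sum>t\<leftarrow>[x, x + l, y - l, y]. (cmod (u t))\<^sup>2) + 8712 * R\<^sup>2 * (\<Sum>t\<leftarrow>[x, x + l, y - l, y]. (cmod (v t))\<^sup>2))"
    unfolding Su_def Sv_def d by (intro mult_left_mono add_mono end_data_bound[OF Vi V4 R k s x(2)]) auto
  also have "\<dots> = \<tau>\<^sup>2 * (8712 * R\<^sup>2 * (\<Sum>t\<leftarrow>[x, x + l, y - l, y]. (cmod (u t))\<^sup>2 + (cmod (v t))\<^sup>2))"
    by (simp add: algebra_simps)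
  finally have "2 * cmod k \<le> \<dots>" by (simp add: norm_mult)
  then show ?thesis using Rk complex_Re_le_cmod[of k] unfolding d by linarith
qed

section \<open>Boundary behaviour of Herglotz functions\<close>


text \<open>Cauchy's theorem on a right triangle whose hypotenuse and vertical leg meet the real axis at the
  zeros of the weight; there the weight compensates the growth of the function.\<close>

lemma upper_half_plane_level_set_bound:
  fixes G :: "complex \<Rightarrow> complex"
  assumes hol: "G holomorphic_on {z. Im z > 0}" and nonneg: "\<And>z. Im z > 0 \<Longrightarrow> 0 \<le> Im (G z)"
    and bd: "\<And>z. Im z > 0 \<Longrightarrow> cmod z \<le> R \<Longrightarrow> cmod (G z) \<le> C / Im z"
    and R: "\<bar>\<alpha>\<bar> + \<bar>\<beta>\<bar> + (\<beta> - \<alpha> + 2) + 3 \<le> R" and ab: "\<alpha> < \<beta>" and e: "0 < e" "e \<le> 1"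
    and S: "S \<in> sets borel" "S \<subseteq> {\<alpha>..\<beta>}" "\<And>E. E \<in> S \<Longrightarrow> 1 \<le> Im (G (Complex E e))"
  shows "measure lborel S \<le> 6 * (\<beta> - \<alpha> + 2)\<^sup>2 * C"
proof -
  define L where "L = \<beta> - \<alpha> + 2"
  \<comment> \<open>The base exceeds [\<alpha>, \<beta>] by 1 on either side, so that the weight is
    at least 1 over \<open>S\<close>. The height of the triangle equals its base
    \<open>L\<close>.\<close>
  define A B P :: complex where "A = of_real (\<alpha> - 1)" and "B = of_real (\<beta> + 1)" and "P = A + \<i> * of_real L"
  \<comment> \<open>The shift by e makes \<open>f\<close> holomorphic in a neighbourhood of the
    closed triangle, base included.\<close>
  define f where "f z = (z - A) * (B - z) * G (z + \<i> * of_real e)" for z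
  have L: "L > 0" using ab by (simp add: L_def)
  have BA: "B - A = of_real L" by (simp add: A_def B_def L_def)
  have PB: "P - B = of_real L * (\<i> - 1)" using BA by (simp add: P_def algebra_simps)
  have n2: "cmod (\<i> - 1) \<le> 2" using norm_triangle_ineq4[of \<i> 1] by simp
  have C0: "0 \<le> C"
  proof -
    have "0 \<le> C / Im (\<i>::complex)" using bd[of \<i>] R ab by (intro order_trans[OF norm_ge_zero bd]) auto
    then show ?thesis by simp
  qed
  have seg: "closed_segment a b \<subseteq> convex hull {A, B, P}" if "a \<in> {A, B, P}" "b \<in> {A, B, P}" for a b
    using that by (metis closed_segment_subset_convex_hull hull_inc)
  have "convex hull {A, B, P} \<subseteq> {z. Im z \<ge> 0}"
    using L by (intro hull_minimal convex_halfspace_Im_ge) (auto simp: A_def B_def P_def)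
  then have hull: "convex hull {A, B, P} \<subseteq> {z. Im z > - e}" using e by force
  have "(\<lambda>z. G (z + \<i> * of_real e)) holomorphic_on {z. Im z > - e}"
    by (rule holomorphic_on_compose_gen[OF _ hol, unfolded o_def]) (auto intro!: holomorphic_intros)
  then have fh: "f holomorphic_on {z. Im z > - e}" unfolding f_def by (intro holomorphic_intros)
  have tri: "(f has_contour_integral 0) (linepath A B +++ linepath B P +++ linepath P A)"
    using holomorphic_on_subset[OF fh hull] by (rule Cauchy_theorem_triangle)
  have fc: "f contour_integrable_on linepath a b" if "a \<in> {A, B, P}" "b \<in> {A, B, P}" for a b
    using seg[OF that] hull
    by (intro contour_integrable_continuous_linepath holomorphic_on_imp_continuous_on holomorphic_on_subset[OF fh]) auto
  have sum0: "contour_integral (linepath A B) f + contour_integral (linepath B P) f + contour_integral (linepath P A) f = 0"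
    using contour_integral_unique[OF tri] fc by (simp add: add.assoc)
  have Gb: "cmod (G (z + \<i> * of_real e)) \<le> C / (Im z + e)"
    if "0 \<le> Im z" "Im z \<le> L" "\<alpha> - 1 \<le> Re z" "Re z \<le> \<beta> + 1" for z
  proof -
    have "cmod (z + \<i> * of_real e) \<le> \<bar>Re z\<bar> + \<bar>Im z + e\<bar>" using cmod_le[of "z + \<i> * of_real e"] by simp
    also have "\<dots> \<le> R" using that R e ab by (simp add: L_def)
    finally show ?thesis using bd[of "z + \<i> * of_real e"] that e by simp
  qed
  \<comment> \<open>At height s L one factor of the weight is at most 2 s L, which compensates the
    growth C / (s L + e) uniformly in e.\<close>
  have frac: "s * L * (C / (s * L + e)) \<le> C" if "0 \<le> s" for s
  proof -
    have "s * L / (s * L + e) \<le> 1" using that L e add_nonneg_pos[of "s * L" e] by simp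
    then have "s * L / (s * L + e) * C \<le> 1 * C" using C0 by (rule mult_right_mono)
    then show ?thesis by simp
  qed
  have "cmod (contour_integral (linepath B P) f) \<le> 2 * L * C * cmod (P - B)"
  proof (rule contour_integral_bound_linepath)
    show "f contour_integrable_on linepath B P" by (rule fc) auto
    show "0 \<le> 2 * L * C" using L C0 by simp
    fix z assume "z \<in> closed_segment B P"
    then obtain s where s: "0 \<le> s" "s \<le> 1" "z = (1 - s) *\<^sub>R B + s *\<^sub>R P" by (auto simp: closed_segment_def)
    have z: "z - A = of_real L * (of_real (1 - s) + of_real s * \<i>)" "B - z = of_real (s * L) * (1 - \<i>)"
      using BA by (simp_all add: s(3) P_def scaleR_conv_of_real algebra_simps)
    have zi: "Im z = s * L" "Re z = \<beta> + 1 - s * L" by (auto simp: s(3) A_def B_def P_def L_def algebra_simps)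
    have sL: "s * L \<le> L" using mult_right_mono[OF s(2), of L] L by simp
    have "cmod (z - A) \<le> L * 1"
      unfolding z norm_mult using L s norm_triangle_ineq[of "of_real (1 - s)" "of_real s * \<i> :: complex"]
      by (intro mult_mono) (auto simp: norm_mult simp del: of_real_diff)
    moreover have "cmod (B - z) \<le> s * L * 2"
      unfolding z norm_mult using L s n2 by (intro mult_mono) (auto simp: norm_minus_commute norm_mult)
    moreover have "\<alpha> - 1 \<le> Re z" "0 \<le> s * L" using zi(2) sL mult_nonneg_nonneg[OF s(1) less_imp_le[OF L]] L_def by linarith+
    then have "cmod (G (z + \<i> * of_real e)) \<le> C / (s * L + e)" using Gb[of z] zi sL by simp
    ultimately have "cmod (f z) \<le> (L * 1) * (s * L * 2) * (C / (s * L + e))"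
      unfolding f_def norm_mult using L s by (intro mult_mono) auto
    also have "\<dots> = 2 * L * (s * L * (C / (s * L + e)))" by simp
    also have "\<dots> \<le> 2 * L * C" using frac[OF s(1)] L by (intro mult_left_mono) auto
    finally show "cmod (f z) \<le> 2 * L * C" .
  qed
  also have "2 * L * C * cmod (P - B) \<le> 2 * L * C * (2 * L)"
    unfolding PB norm_mult using L n2 C0 by (intro mult_left_mono) auto
  finally have I1: "cmod (contour_integral (linepath B P) f) \<le> 4 * L\<^sup>2 * C"
    by (simp add: power2_eq_square mult_ac)
  have "cmod (contour_integral (linepath P A) f) \<le> 2 * L * C * cmod (A - P)"
  proof (rule contour_integral_bound_linepath)
    show "f contour_integrable_on linepath P A" by (rule fc) auto
    show "0 \<le> 2 * L * C" using L C0 by simp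
    fix z assume "z \<in> closed_segment P A"
    then have "z \<in> closed_segment A P" by (simp add: closed_segment_commute)
    then obtain s where s: "0 \<le> s" "s \<le> 1" "z = (1 - s) *\<^sub>R A + s *\<^sub>R P" by (auto simp: closed_segment_def)
    have z: "z - A = of_real (s * L) * \<i>" "B - z = of_real L * (1 - of_real s * \<i>)"
      using BA by (simp_all add: s(3) P_def scaleR_conv_of_real algebra_simps)
    have zi: "Im z = s * L" "Re z = \<alpha> - 1" by (auto simp: s(3) A_def P_def algebra_simps)
    have sL: "s * L \<le> L" using mult_right_mono[OF s(2), of L] L by simp
    have "cmod (z - A) \<le> s * L" unfolding z norm_mult using L s by (simp add: norm_mult)
    moreover have "cmod (B - z) \<le> L * 2"
      unfolding z norm_mult using L s norm_triangle_ineq4[of 1 "of_real s * \<i> :: complex"]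
      by (intro mult_mono) (auto simp: norm_mult)
    moreover have "cmod (G (z + \<i> * of_real e)) \<le> C / (s * L + e)" using Gb[of z] zi s L sL ab by auto
    ultimately have "cmod (f z) \<le> (s * L) * (L * 2) * (C / (s * L + e))"
      unfolding f_def norm_mult using L s by (intro mult_mono) auto
    also have "\<dots> = 2 * L * (s * L * (C / (s * L + e)))" by simp
    also have "\<dots> \<le> 2 * L * C" using frac[OF s(1)] L by (intro mult_left_mono) auto
    finally show "cmod (f z) \<le> 2 * L * C" .
  qed
  also have "cmod (A - P) = L" using L by (simp add: P_def norm_mult)
  finally have I2: "cmod (contour_integral (linepath P A) f) \<le> 2 * L\<^sup>2 * C" by (simp add: power2_eq_square mult_ac)
  have AB: "A \<in> Reals" "B \<in> Reals" "Re A < Re B" using ab by (auto simp: A_def B_def)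
  have AB': "Re A = \<alpha> - 1" "Re B = \<beta> + 1" by (auto simp: A_def B_def)
  \<comment> \<open>On the base the weight is real and nonnegative, so the imaginary part of the
    integral is a weighted integral of Im G. The hypotenuse contributes 4 and the leg 2 to the
    factor 6.\<close>
  let ?h = "\<lambda>x. Im (f (of_real x))"
  have "contour_integral (linepath A B) f = - (contour_integral (linepath B P) f + contour_integral (linepath P A) f)"
    using sum0 by (simp only: eq_neg_iff_add_eq_0 add.assoc)
  then have "cmod (contour_integral (linepath A B) f) = cmod (contour_integral (linepath B P) f + contour_integral (linepath P A) f)"
    by (simp only: norm_minus_cancel)
  then have "cmod (contour_integral (linepath A B) f) \<le> 6 * L\<^sup>2 * C"
    using I1 I2 norm_triangle_ineq[of "contour_integral (linepath B P) f" "contour_integral (linepath P A) f"]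
    by linarith
  then have N: "cmod (integral {\<alpha>-1..\<beta>+1} (\<lambda>x. f (of_real x))) \<le> 6 * L\<^sup>2 * C"
    using contour_integral_linepath_Reals_eq[OF AB, of f] AB' by simp
  have fi: "(\<lambda>x. f (of_real x)) integrable_on {\<alpha>-1..\<beta>+1}"
    using fc[of A B] contour_integrable_linepath_Reals_iff[OF AB, of f] AB' by simp
  have hI: "(?h has_integral Im (integral {\<alpha>-1..\<beta>+1} (\<lambda>x. f (of_real x)))) {\<alpha>-1..\<beta>+1}"
    using fi by (intro has_integral_Im integrable_integral)
  have h: "?h x = (x - \<alpha> + 1) * (\<beta> + 1 - x) * Im (G (Complex x e))" for x
  proof -
    have "of_real x + \<i> * of_real e = Complex x e" by (simp add: complex_eq_iff)
    moreover have "(of_real x - A) * (B - of_real x) = complex_of_real ((x - \<alpha> + 1) * (\<beta> + 1 - x))"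
      by (simp add: A_def B_def)
    ultimately have "f (of_real x) = of_real ((x - \<alpha> + 1) * (\<beta> + 1 - x)) * G (Complex x e)" by (simp add: f_def)
    then show ?thesis by (simp only: Im_complex_of_real Re_complex_of_real times_complex.simps)
  qed
  have hS: "1 \<le> ?h x" if "x \<in> S" for x
  proof -
    have "1 * 1 * 1 \<le> (x - \<alpha> + 1) * (\<beta> + 1 - x) * Im (G (Complex x e))"
      using that S by (intro mult_mono) auto
    then show ?thesis by (simp add: h)
  qed
  have h0: "0 \<le> ?h x" if "x \<in> {\<alpha>-1..\<beta>+1}" for x
    using that e nonneg[of "Complex x e"] by (simp add: h)
  have Sl: "S \<in> lmeasurable"
    using S(1) bounded_subset[OF bounded_closed_interval S(2)] by (intro bounded_set_imp_lmeasurable) auto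
  have "((\<lambda>x. if x \<in> S then 1 else 0) has_integral measure lebesgue S) {\<alpha>-1..\<beta>+1}"
  proof -
    have "((\<lambda>x. 1) has_integral measure lebesgue S) S"
      using Sl by (simp add: lmeasure_integral integrable_integral lmeasurable_iff_integrable_on)
    moreover have "S \<inter> {\<alpha>-1..\<beta>+1} = S" using S(2) by fastforce
    ultimately show ?thesis by (simp only: has_integral_restrict_Int)
  qed
  then have "measure lebesgue S \<le> Im (integral {\<alpha>-1..\<beta>+1} (\<lambda>x. f (of_real x)))"
    using hI by (rule has_integral_le) (use hS h0 in auto)
  also have "\<dots> \<le> 6 * L\<^sup>2 * C" using N abs_Im_le_cmod[of "integral {\<alpha>-1..\<beta>+1} (\<lambda>x. f (of_real x))"] by linarith
  finally show ?thesis using S(1) by (simp add: L_def measure_completion)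
qed

lemma holomorphic_measurable_line:
  fixes G :: "complex \<Rightarrow> complex"
  assumes "G holomorphic_on {z. Im z > 0}" "e > 0"
  shows "(\<lambda>E. G (Complex E e)) \<in> borel_measurable borel"
proof (rule borel_measurable_continuous_onI)
  have "continuous_on UNIV (\<lambda>E. Complex E e)"
    by (simp add: Complex_eq continuous_intros)
  then show "continuous_on UNIV (\<lambda>E. G (Complex E e))"
    by (rule continuous_on_compose2[OF holomorphic_on_imp_continuous_on[OF assms(1)]]) (use assms in auto)
qed

text \<open>The Moebius transform 2 i m / (m + i r) has nonnegative imaginary part, which is at
  least 1 exactly where |m| >= r, and its modulus is at most 2 |m| / r. The level-set bound
  therefore applies to it with 2 C / r in place of C.\<close>

lemma boundary_weak_type:
  fixes m :: "complex \<Rightarrow> complex"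
  assumes hol: "m holomorphic_on {z. Im z > 0}" and pos: "\<And>z. Im z > 0 \<Longrightarrow> 0 < Im (m z)"
    and bd: "\<And>z. Im z > 0 \<Longrightarrow> cmod z \<le> R \<Longrightarrow> cmod (m z) \<le> C / Im z"
    and R: "\<bar>\<alpha>\<bar> + \<bar>\<beta>\<bar> + (\<beta> - \<alpha> + 2) + 3 \<le> R" and ab: "\<alpha> < \<beta>" and e: "0 < e" "e \<le> 1" and r: "r > 0"
  shows "measure lborel {E\<in>{\<alpha>..\<beta>}. r < cmod (m (Complex E e))} \<le> 6 * (\<beta> - \<alpha> + 2)\<^sup>2 * (2 * C / r)"
proof -
  define G where "G z = 2 * \<i> * m z / (m z + \<i> * of_real r)" for z
  have nz: "m z + \<i> * of_real r \<noteq> 0" and ge: "r \<le> cmod (m z + \<i> * of_real r)" if "Im z > 0" for z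
  proof -
    have "r < Im (m z + \<i> * of_real r)" using pos[OF that] r by simp
    also have "\<dots> \<le> cmod (m z + \<i> * of_real r)" using abs_Im_le_cmod[of "m z + \<i> * of_real r"] by linarith
    finally show "r \<le> cmod (m z + \<i> * of_real r)" "m z + \<i> * of_real r \<noteq> 0" using r by auto
  qed
  have IG: "Im (G z) = 2 * ((cmod (m z))\<^sup>2 + r * Im (m z)) / ((cmod (m z))\<^sup>2 + 2 * r * Im (m z) + r\<^sup>2)" if "Im z > 0" for z
    unfolding G_def cmod_power2 Im_divide by (simp add: power2_eq_square algebra_simps)
  show ?thesis
  proof (rule upper_half_plane_level_set_bound[where G = G and R = R and e = e])
    show "G holomorphic_on {z. Im z > 0}" unfolding G_def using nz by (intro holomorphic_intros hol) auto
    show "0 \<le> Im (G z)" if "Im z > 0" for z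
      unfolding IG[OF that] using pos[OF that] r by (intro divide_nonneg_nonneg add_nonneg_nonneg mult_nonneg_nonneg) auto
    show "cmod (G z) \<le> 2 * C / r / Im z" if "Im z > 0" "cmod z \<le> R" for z
    proof -
      have "cmod (G z) = 2 * cmod (m z) / cmod (m z + \<i> * of_real r)" by (simp add: G_def norm_divide norm_mult)
      also have "\<dots> \<le> 2 * (C / Im z) / r" using bd[OF that] ge[OF that(1)] r order_trans[OF norm_ge_zero bd[OF that]]
        by (intro frac_le) (auto simp del: divide_nonneg_nonneg)
      finally show ?thesis by (simp add: mult.commute)
    qed
    have [measurable]: "(\<lambda>E. m (Complex E e)) \<in> borel_measurable borel" using holomorphic_measurable_line[OF hol e(1)] .
    show "{E\<in>{\<alpha>..\<beta>}. r < cmod (m (Complex E e))} \<in> sets borel" by measurable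
    fix E assume "E \<in> {E\<in>{\<alpha>..\<beta>}. r < cmod (m (Complex E e))}"
    then have E: "r < cmod (m (Complex E e))" by simp
    let ?z = "Complex E e"
    have z: "Im ?z > 0" using e by simp
    have "r\<^sup>2 \<le> (cmod (m ?z))\<^sup>2" using E r by (intro power_mono) auto
    moreover have "0 < r * Im (m ?z)" using pos[OF z] r by simp
    moreover have "0 < r\<^sup>2" using r by simp
    ultimately have "0 < (cmod (m ?z))\<^sup>2 + 2 * r * Im (m ?z) + r\<^sup>2"
      "1 * ((cmod (m ?z))\<^sup>2 + 2 * r * Im (m ?z) + r\<^sup>2) \<le> 2 * ((cmod (m ?z))\<^sup>2 + r * Im (m ?z))"
      by (linarith, simp add: algebra_simps)
    then show "1 \<le> Im (G ?z)" unfolding IG[OF z] by (simp only: pos_le_divide_eq)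
  qed (use R ab e in auto)
qed

section \<open>Functions with a Herglotz representation\<close>

definition herglotz_kernel :: "complex \<Rightarrow> real \<Rightarrow> complex" where
  "herglotz_kernel z t = 1 / (of_real t - z) - of_real (t / (1 + t\<^sup>2))"

text \<open>The kernel equals (z + (1 + z^2) / (t - z)) / (1 + t^2), and |t - z| >= Im z.\<close>

lemma herglotz_kernel_bound:
  assumes z: "Im z > 0"
  shows "cmod (herglotz_kernel z t) \<le> (cmod z + (1 + (cmod z)\<^sup>2) / Im z) * (1 / (1 + t\<^sup>2))"
proof -
  have nz: "of_real t - z \<noteq> 0" using z by (auto simp: complex_eq_iff)
  have t: "1 + t\<^sup>2 > 0" by (simp add: add_pos_nonneg)
  have t': "1 + (complex_of_real t)\<^sup>2 \<noteq> 0" using t by (metis of_real_1 of_real_add of_real_eq_0_iff of_real_power less_irrefl)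
  have eq: "herglotz_kernel z t = (z + (1 + z\<^sup>2) / (of_real t - z)) * of_real (1 / (1 + t\<^sup>2))"
    using nz t' by (simp add: herglotz_kernel_def field_simps) (simp add: algebra_simps power2_eq_square)
  have "Im z \<le> cmod (of_real t - z)" using abs_Im_le_cmod[of "of_real t - z"] by simp
  then have "cmod ((1 + z\<^sup>2) / (of_real t - z)) \<le> (1 + (cmod z)\<^sup>2) / Im z"
    unfolding norm_divide using z norm_triangle_ineq[of 1 "z\<^sup>2"] by (intro frac_le) (auto simp: norm_power)
  then have "cmod (z + (1 + z\<^sup>2) / (of_real t - z)) \<le> cmod z + (1 + (cmod z)\<^sup>2) / Im z"
    using norm_triangle_ineq[of z] by (smt (verit))
  moreover have "0 \<le> cmod z + (1 + (cmod z)\<^sup>2) / Im z" using z by simp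
  ultimately show ?thesis unfolding eq norm_mult norm_of_real using t by (intro mult_mono) auto
qed

lemma herglotz_kernel_integrable:
  assumes sets: "sets \<mu> = sets borel" and int: "integrable \<mu> (\<lambda>t. 1 / (1 + t\<^sup>2))" and z: "Im z > 0"
  shows "integrable \<mu> (herglotz_kernel z)"
proof (rule Bochner_Integration.integrable_bound)
  show "integrable \<mu> (\<lambda>t. (cmod z + (1 + (cmod z)\<^sup>2) / Im z) * (1 / (1 + t\<^sup>2)))"
    using int by (rule integrable_mult_right)
  have "herglotz_kernel z \<in> borel_measurable borel" unfolding herglotz_kernel_def by measurable
  then show "herglotz_kernel z \<in> borel_measurable \<mu>" by (simp add: measurable_cong_sets[OF sets refl])
  have "0 \<le> cmod z + (1 + (cmod z)\<^sup>2) / Im z" using z by simp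
  then show "AE t in \<mu>. cmod (herglotz_kernel z t) \<le> norm ((cmod z + (1 + (cmod z)\<^sup>2) / Im z) * (1 / (1 + t\<^sup>2)))"
    using herglotz_kernel_bound[OF z] by (auto simp: abs_mult)
qed

text \<open>Provides, with one constant for a whole half disc, the growth rate 1 / Im z that the
  level-set bound takes as input.\<close>

lemma herglotz_bound:
  assumes H: "herglotz_measure m \<mu>" and R: "R \<ge> 1"
  obtains C where "C > 0" "\<And>z. Im z > 0 \<Longrightarrow> cmod z \<le> R \<Longrightarrow> cmod (m z) \<le> C / Im z"
proof -
  obtain \<alpha> \<beta> where b: "0 \<le> \<beta>" and m: "\<And>z. Im z > 0 \<Longrightarrow> m z = of_real \<alpha> + of_real \<beta> * z + (\<integral>t. herglotz_kernel z t \<partial>\<mu>)"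
    using H unfolding herglotz_measure_def herglotz_kernel_def by auto
  have sets: "sets \<mu> = sets borel" and int: "integrable \<mu> (\<lambda>t. 1 / (1 + t\<^sup>2))"
    using H by (auto simp: herglotz_measure_def)
  define I where "I = (\<integral>t. 1 / (1 + t\<^sup>2) \<partial>\<mu>)"
  have I: "0 \<le> I" unfolding I_def by (intro integral_nonneg_AE) auto
  define C where "C = (\<bar>\<alpha>\<bar> + \<beta> * R + R * I) * R + (1 + R\<^sup>2) * I + 1"
  show ?thesis
  proof (rule that[of C])
    show "C > 0" unfolding C_def using b R I by (intro add_nonneg_pos add_nonneg_nonneg mult_nonneg_nonneg) auto
    fix z assume z: "Im z > 0" "cmod z \<le> R"
    have iz: "Im z \<le> R" using abs_Im_le_cmod[of z] z by linarith
    have "cmod (\<integral>t. herglotz_kernel z t \<partial>\<mu>) \<le> (\<integral>t. cmod (herglotz_kernel z t) \<partial>\<mu>)" by (rule integral_norm_bound)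
    also have "\<dots> \<le> (\<integral>t. (cmod z + (1 + (cmod z)\<^sup>2) / Im z) * (1 / (1 + t\<^sup>2)) \<partial>\<mu>)"
      using herglotz_kernel_integrable[OF sets int z(1)] herglotz_kernel_bound[OF z(1)]
      by (intro integral_mono integrable_norm integrable_mult_right int) auto
    also have "\<dots> = (cmod z + (1 + (cmod z)\<^sup>2) / Im z) * I" by (simp only: I_def integral_mult_right_zero)
    also have "\<dots> \<le> (R + (1 + R\<^sup>2) / Im z) * I"
      using z I by (intro mult_right_mono add_mono divide_right_mono power_mono) auto
    finally have k: "cmod (\<integral>t. herglotz_kernel z t \<partial>\<mu>) \<le> (R + (1 + R\<^sup>2) / Im z) * I" .
    have "cmod (m z) \<le> cmod (of_real \<alpha>) + cmod (of_real \<beta> * z) + cmod (\<integral>t. herglotz_kernel z t \<partial>\<mu>)"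
      unfolding m[OF z(1)] by (meson add_mono norm_triangle_ineq norm_triangle_le order_refl order_trans)
    also have "\<dots> \<le> \<bar>\<alpha>\<bar> + \<beta> * R + (R + (1 + R\<^sup>2) / Im z) * I"
      using k b z by (intro add_mono) (auto simp: norm_mult mult_left_mono)
    finally have "cmod (m z) * Im z \<le> (\<bar>\<alpha>\<bar> + \<beta> * R + (R + (1 + R\<^sup>2) / Im z) * I) * Im z"
      using z by (intro mult_right_mono) auto
    also have "\<dots> = (\<bar>\<alpha>\<bar> + \<beta> * R + R * I) * Im z + (1 + R\<^sup>2) * I" using z by (simp add: field_simps)
    also have "\<dots> \<le> (\<bar>\<alpha>\<bar> + \<beta> * R + R * I) * R + (1 + R\<^sup>2) * I"
      using iz b R I by (intro add_mono mult_left_mono) auto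
    finally show "cmod (m z) \<le> C / Im z" using z by (simp add: C_def pos_le_divide_eq)
  qed
qed

text \<open>The difference quotient of the kernel minus (t - w)^(-2) equals (z - w) / ((t - z) (t -
  w)^2), which near \<open>w\<close> is at most |z - w| times a fixed integrable function of
  t.\<close>

lemma herglotz_holomorphic:
  assumes H: "herglotz_measure m \<mu>"
  shows "m holomorphic_on {z. Im z > 0}"
proof -
  obtain \<alpha> \<beta> where m: "\<And>z. Im z > 0 \<Longrightarrow> m z = of_real \<alpha> + of_real \<beta> * z + (\<integral>t. herglotz_kernel z t \<partial>\<mu>)"
    using H unfolding herglotz_measure_def herglotz_kernel_def by auto
  have sets: "sets \<mu> = sets borel" and int: "integrable \<mu> (\<lambda>t. 1 / (1 + t\<^sup>2))"
    using H by (auto simp: herglotz_measure_def)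
  have "\<exists>D. ((\<lambda>z. \<integral>t. herglotz_kernel z t \<partial>\<mu>) has_field_derivative D) (at w within {z. Im z > 0})" if w: "Im w > 0" for w
  proof -
    define q where "q t = 1 / (of_real t - w)" for t
    \<comment> \<open>From t^2 <= 2 |t - w|^2 + 2 |w|^2 and |t - w| >= Im w it follows that 1 + t^2
      <= K |t - w|^2.\<close>
    define K where "K = 2 + (2 * (cmod w)\<^sup>2 + 1) / (Im w)\<^sup>2"
    have wt: "Im w \<le> cmod (of_real t - w)" for t using abs_Im_le_cmod[of "of_real t - w"] by simp
    have nz: "of_real t - z \<noteq> 0" if "Im z > 0" for t z using that by (auto simp: complex_eq_iff)
    have q2: "(cmod (q t))\<^sup>2 \<le> K * (1 / (1 + t\<^sup>2))" for t
    proof -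
      have "t\<^sup>2 \<le> (cmod (of_real t - w) + cmod w)\<^sup>2"
        using norm_triangle_ineq[of "of_real t - w" w] by (intro power2_le_iff_abs_le[THEN iffD2]) (auto simp: power2_le_iff_abs_le)
      also have "\<dots> \<le> 2 * (cmod (of_real t - w))\<^sup>2 + 2 * (cmod w)\<^sup>2"
        using sum_squares_bound[of "cmod (of_real t - w)" "cmod w"] by (simp add: power2_sum)
      finally have 1: "1 + t\<^sup>2 \<le> 2 * (cmod (of_real t - w))\<^sup>2 + (2 * (cmod w)\<^sup>2 + 1) * 1" by simp
      have "1 \<le> (cmod (of_real t - w))\<^sup>2 / (Im w)\<^sup>2" using wt[of t] w by (simp add: power_mono)
      then have "(2 * (cmod w)\<^sup>2 + 1) * 1 \<le> (2 * (cmod w)\<^sup>2 + 1) * ((cmod (of_real t - w))\<^sup>2 / (Im w)\<^sup>2)"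
        by (intro mult_left_mono) auto
      with 1 have "1 + t\<^sup>2 \<le> K * (cmod (of_real t - w))\<^sup>2" by (simp add: K_def algebra_simps)
      moreover have "1 + t\<^sup>2 > 0" by (simp add: add_pos_nonneg)
      moreover have "(cmod (of_real t - w))\<^sup>2 > 0" using nz[OF w] by simp
      ultimately show ?thesis by (simp add: q_def norm_divide power_divide field_simps)
    qed
    have qm: "q \<in> borel_measurable borel" unfolding q_def by measurable
    have K0: "0 \<le> K" by (simp add: K_def)
    have qi: "integrable \<mu> (\<lambda>t. (q t)\<^sup>2)"
    proof (rule Bochner_Integration.integrable_bound)
      show "integrable \<mu> (\<lambda>t. K * (1 / (1 + t\<^sup>2)))" using int by (rule integrable_mult_right)
      show "(\<lambda>t. (q t)\<^sup>2) \<in> borel_measurable \<mu>" using qm by (simp add: measurable_cong_sets[OF sets refl])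
      show "AE t in \<mu>. cmod ((q t)\<^sup>2) \<le> norm (K * (1 / (1 + t\<^sup>2)))"
        using q2 K0 by (auto simp: norm_power abs_mult)
    qed
    define D where "D = (\<integral>t. (q t)\<^sup>2 \<partial>\<mu>)"
    define Q where "Q = (\<integral>t. K * (1 / (1 + t\<^sup>2)) \<partial>\<mu>)"
    have est: "cmod (((\<integral>t. herglotz_kernel z t \<partial>\<mu>) - (\<integral>t. herglotz_kernel w t \<partial>\<mu>)) / (z - w) - D) \<le> cmod (z - w) * (2 / Im w) * Q"
      if z: "Im z > 0" "z \<noteq> w" "cmod (z - w) < Im w / 2" for z
    proof -
      have kz: "integrable \<mu> (herglotz_kernel z)" "integrable \<mu> (herglotz_kernel w)"
        using herglotz_kernel_integrable[OF sets int] z w by auto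
      have i: "integrable \<mu> (\<lambda>t. (herglotz_kernel z t - herglotz_kernel w t) / (z - w) - (q t)\<^sup>2)"
        using kz qi by simp
      have "((\<integral>t. herglotz_kernel z t \<partial>\<mu>) - (\<integral>t. herglotz_kernel w t \<partial>\<mu>)) / (z - w) - D
         = (\<integral>t. (herglotz_kernel z t - herglotz_kernel w t) / (z - w) - (q t)\<^sup>2 \<partial>\<mu>)"
        unfolding D_def using kz qi by simp
      also have "cmod \<dots> \<le> (\<integral>t. cmod ((herglotz_kernel z t - herglotz_kernel w t) / (z - w) - (q t)\<^sup>2) \<partial>\<mu>)"
        by (rule integral_norm_bound)
      also have "\<dots> \<le> (\<integral>t. (cmod (z - w) * (2 / Im w)) * (K * (1 / (1 + t\<^sup>2))) \<partial>\<mu>)"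
      proof (intro integral_mono integrable_norm i integrable_mult_right int)
        fix t
        have "Im w / 2 \<le> Im z" using z(3) abs_Im_le_cmod[of "z - w"] by simp
        also have "Im z \<le> cmod (of_real t - z)" using abs_Im_le_cmod[of "of_real t - z"] by simp
        finally have zt: "Im w / 2 \<le> cmod (of_real t - z)" .
        have "(herglotz_kernel z t - herglotz_kernel w t) / (z - w) - (q t)\<^sup>2 = (z - w) * (1 / (of_real t - z)) * (q t)\<^sup>2"
          using nz[OF z(1), of t] nz[OF w, of t] z(2)
          by (simp add: herglotz_kernel_def q_def divide_simps) (simp add: algebra_simps power2_eq_square)
        also have "cmod \<dots> = cmod (z - w) * (1 / cmod (of_real t - z)) * (cmod (q t))\<^sup>2"
          by (simp add: norm_mult norm_divide norm_power)
        also have "\<dots> \<le> cmod (z - w) * (2 / Im w) * (K * (1 / (1 + t\<^sup>2)))"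
        proof (intro mult_mono q2 order_refl)
          show "1 / cmod (of_real t - z) \<le> 2 / Im w"
            using zt w frac_le[of 1 1 "Im w / 2" "cmod (of_real t - z)"] by simp
        qed (use w in auto)
        finally show "cmod ((herglotz_kernel z t - herglotz_kernel w t) / (z - w) - (q t)\<^sup>2) \<le> (cmod (z - w) * (2 / Im w)) * (K * (1 / (1 + t\<^sup>2)))" .
      qed
      also have "\<dots> = cmod (z - w) * (2 / Im w) * Q" by (simp only: Q_def integral_mult_right_zero)
      finally show ?thesis .
    qed
    have "((\<lambda>z. ((\<integral>t. herglotz_kernel z t \<partial>\<mu>) - (\<integral>t. herglotz_kernel w t \<partial>\<mu>)) / (z - w)) \<longlongrightarrow> D) (at w within {z. Im z > 0})"
    proof (rule LIM_zero_cancel, rule Lim_null_comparison)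
      show "((\<lambda>z. cmod (z - w) * (2 / Im w) * Q) \<longlongrightarrow> 0) (at w within {z. Im z > 0})"
        using w by (auto intro!: tendsto_eq_intros)
      show "\<forall>\<^sub>F z in at w within {z. Im z > 0}. cmod (((\<integral>t. herglotz_kernel z t \<partial>\<mu>) - (\<integral>t. herglotz_kernel w t \<partial>\<mu>)) / (z - w) - D) \<le> cmod (z - w) * (2 / Im w) * Q"
        unfolding eventually_at
        by (intro exI[of _ "Im w / 2"]) (use w est in \<open>auto simp: dist_norm\<close>)
    qed
    then show ?thesis unfolding has_field_derivative_iff by blast
  qed
  then have "(\<lambda>z. \<integral>t. herglotz_kernel z t \<partial>\<mu>) holomorphic_on {z. Im z > 0}"
    unfolding holomorphic_on_def field_differentiable_def by simp
  then have "(\<lambda>z. of_real \<alpha> + of_real \<beta> * z + (\<integral>t. herglotz_kernel z t \<partial>\<mu>)) holomorphic_on {z. Im z > 0}"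
    by (intro holomorphic_intros)
  then show ?thesis using m by (subst holomorphic_cong[OF refl]) auto
qed

lemma herglotz_finite_interval:
  assumes H: "herglotz_measure m \<mu>" shows "emeasure \<mu> {a..b} < \<infinity>" "integrable \<mu> (indicat_real {a..b})"
proof -
  have sets: "sets \<mu> = sets borel" and int: "integrable \<mu> (\<lambda>t. 1 / (1 + t\<^sup>2))"
    using H by (auto simp: herglotz_measure_def)
  define C where "C = 1 + (\<bar>a\<bar> + \<bar>b\<bar>)\<^sup>2"
  show i: "integrable \<mu> (indicat_real {a..b})"
  proof (rule Bochner_Integration.integrable_bound)
    show "integrable \<mu> (\<lambda>t. C * (1 / (1 + t\<^sup>2)))" using int by (rule integrable_mult_right)
    have "indicat_real {a..b} \<in> borel_measurable borel" by measurable
    then show "indicat_real {a..b} \<in> borel_measurable \<mu>" by (simp add: measurable_cong_sets[OF sets refl])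
    have "norm (indicat_real {a..b} t) \<le> norm (C * (1 / (1 + t\<^sup>2)))" for t
    proof (cases "t \<in> {a..b}")
      case True
      then have "t\<^sup>2 \<le> (\<bar>a\<bar> + \<bar>b\<bar>)\<^sup>2" by (intro power2_le_iff_abs_le[THEN iffD2]) auto
      then show ?thesis using True by (simp add: C_def add_pos_nonneg)
    qed (simp add: C_def)
    then show "AE t in \<mu>. norm (indicat_real {a..b} t) \<le> norm (C * (1 / (1 + t\<^sup>2)))" by simp
  qed
  then show "emeasure \<mu> {a..b} < \<infinity>"
    using sets by (simp add: integrable_indicator_iff)
qed

text \<open>The Poisson kernel e / ((t - E)^2 + e^2) is at least 1 / (2 e) for |t - E| <= e, and the
  linear term adds \<beta> e >= 0 to Im m.\<close>

lemma herglotz_Im_lower: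
  assumes H: "herglotz_measure m \<mu>" and e: "e > 0"
  shows "measure \<mu> {E - e..E + e} \<le> 2 * e * Im (m (Complex E e))"
proof -
  let ?z = "Complex E e" and ?J = "{E - e..E + e}"
  obtain \<alpha> \<beta> where b: "0 \<le> \<beta>" and m: "m ?z = of_real \<alpha> + of_real \<beta> * ?z + (\<integral>t. herglotz_kernel ?z t \<partial>\<mu>)"
    using H e unfolding herglotz_measure_def herglotz_kernel_def by auto
  have sets: "sets \<mu> = sets borel" and int: "integrable \<mu> (\<lambda>t. 1 / (1 + t\<^sup>2))"
    using H by (auto simp: herglotz_measure_def)
  have k: "integrable \<mu> (herglotz_kernel ?z)" using herglotz_kernel_integrable[OF sets int] e by simp
  have Im_k: "Im (herglotz_kernel ?z t) = e / ((t - E)\<^sup>2 + e\<^sup>2)" for t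
    by (simp add: herglotz_kernel_def Im_divide)
  have "measure \<mu> ?J / (2 * e) = (\<integral>t. indicat_real ?J t / (2 * e) \<partial>\<mu>)"
    using sets sets_eq_imp_space_eq[OF sets] by simp
  also have "\<dots> \<le> (\<integral>t. Im (herglotz_kernel ?z t) \<partial>\<mu>)"
  proof (intro integral_mono integrable_Im k)
    show "integrable \<mu> (\<lambda>t. indicat_real ?J t / (2 * e))"
      using herglotz_finite_interval(2)[OF H] by simp
    fix t
    show "indicat_real ?J t / (2 * e) \<le> Im (herglotz_kernel ?z t)"
    proof (cases "t \<in> ?J")
      case True
      then have "(t - E)\<^sup>2 \<le> e\<^sup>2" using e by (intro power2_le_iff_abs_le[THEN iffD2]) auto
      then have "e / (2 * e\<^sup>2) \<le> e / ((t - E)\<^sup>2 + e\<^sup>2)"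
        using e by (intro frac_le) (auto simp: add_nonneg_pos)
      then show ?thesis using True e by (simp add: Im_k power2_eq_square)
    qed (use e in \<open>simp add: Im_k\<close>)
  qed
  also have "\<dots> = Im (\<integral>t. herglotz_kernel ?z t \<partial>\<mu>)" using k by simp
  also have "\<dots> \<le> Im (m ?z)" unfolding m using b e by simp
  finally show ?thesis using e by (simp add: field_simps)
qed

section \<open>Absence of absolutely continuous spectrum\<close>


text \<open>If Im m < c/2 at height e above E in K, then \<open>herglotz_Im_lower\<close> and the
  lower bound for \<mu> leave at most half of [E - e, E + e] to K. The other half lies in U - K,
  where U is an open set slightly larger than K. Integrating over all such E and exchanging the
  integrals bounds their measure by 2 |U - K|.\<close>

lemma boundary_density:
  assumes H: "herglotz_measure m \<mu>" and K: "compact K" and c: "c > 0"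
    and low: "\<And>B. B \<in> sets borel \<Longrightarrow> B \<subseteq> K \<Longrightarrow> c * measure lborel B \<le> measure \<mu> B"
    and pos: "measure lborel K > 0"
  obtains d where "d > 0" "\<And>e. 0 < e \<Longrightarrow> e < d \<Longrightarrow>
    measure lborel {E\<in>K. Im (m (Complex E e)) < c / 2} \<le> measure lborel K / 4"
proof -
  \<comment> \<open>Twice this is the quarter of the measure of K in the conclusion.\<close>
  let ?q = "measure lborel K / 8"
  have Kb: "K \<in> sets borel" using K by (simp add: borel_compact)
  obtain U where U: "open U" "K \<subseteq> U" "emeasure lborel (U - K) < ennreal ?q"
    using outer_regular_lborel[OF Kb, of ?q] pos by auto
  obtain d where d: "d > 0" "(\<Union>x\<in>K. cball x d) \<subseteq> U"
    using compact_subset_open_imp_cball_epsilon_subset[OF K U(1,2)] by blast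
  have m_sets: "sets \<mu> = sets borel" using H by (simp add: herglotz_measure_def)
  define D where "D = U - K"
  have D[measurable]: "D \<in> sets borel" using U(1) Kb by (auto simp: D_def)
  show ?thesis
  proof (rule that[OF d(1)])
    fix e :: real assume e: "0 < e" "e < d"
    let ?J = "\<lambda>E. {E - e..E + e}"
    define T where "T = {E\<in>K. Im (m (Complex E e)) < c / 2}"
    have [measurable]: "(\<lambda>E. m (Complex E e)) \<in> borel_measurable borel"
      using holomorphic_measurable_line[OF herglotz_holomorphic[OF H] e(1)] .
    have T[measurable]: "T \<in> sets borel" unfolding T_def using Kb by measurable
    have 1: "ennreal e \<le> emeasure lborel (D \<inter> ?J E)" if "E \<in> T" for E
    proof -
      have E: "E \<in> K" "Im (m (Complex E e)) < c / 2" using that by (auto simp: T_def)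
      have "?J E \<subseteq> cball E d" using e by (auto simp: dist_real_def)
      then have JU: "?J E \<subseteq> U" using d(2) E(1) by blast
      have fin: "emeasure lborel (B \<inter> ?J E) < \<infinity>" if "B \<in> sets borel" for B
        using emeasure_mono[of "B \<inter> ?J E" "?J E" lborel] e by (simp add: le_less_trans[OF _ ennreal_less_top])
      have "c * measure lborel (K \<inter> ?J E) \<le> measure \<mu> (K \<inter> ?J E)"
        using Kb by (intro low) auto
      also have "\<dots> \<le> measure \<mu> (?J E)"
        using Kb m_sets herglotz_finite_interval(1)[OF H, of "E - e" "E + e"]
        by (intro measure_mono_fmeasurable fmeasurableI) auto
      also have "\<dots> \<le> 2 * e * Im (m (Complex E e))" by (rule herglotz_Im_lower[OF H e(1)])
      also have "\<dots> \<le> 2 * e * (c / 2)" using E e by (intro mult_left_mono) auto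
      finally have "c * measure lborel (K \<inter> ?J E) \<le> c * e" by (simp add: mult.commute)
      then have "measure lborel (K \<inter> ?J E) \<le> e" using c by simp
      moreover have "2 * e = measure lborel (K \<inter> ?J E) + measure lborel (D \<inter> ?J E)"
      proof -
        have "?J E = (K \<inter> ?J E) \<union> (D \<inter> ?J E)" using JU by (auto simp: D_def)
        then have "measure lborel (?J E) = measure lborel (K \<inter> ?J E) + measure lborel (D \<inter> ?J E)"
          using fin[OF Kb] fin[OF D] Kb D
          by (subst measure_Union[symmetric]) (auto simp: D_def)
        then show ?thesis using e by simp
      qed
      ultimately have "e \<le> measure lborel (D \<inter> ?J E)" by simp
      then show ?thesis
        using fin[OF D] by (simp add: emeasure_eq_ennreal_measure less_top[symmetric] ennreal_leI)
    qed
    have "ennreal e * emeasure lborel T = (\<integral>\<^sup>+E. ennreal e * indicator T E \<partial>lborel)"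
      by (simp add: nn_integral_cmult_indicator)
    also have "\<dots> \<le> (\<integral>\<^sup>+E. emeasure lborel (D \<inter> ?J E) \<partial>lborel)"
      using 1 by (intro nn_integral_mono) (auto simp: indicator_def)
    also have "\<dots> = (\<integral>\<^sup>+E. (\<integral>\<^sup>+t. indicator D t * (if \<bar>t - E\<bar> \<le> e then 1 else 0) \<partial>lborel) \<partial>lborel)"
    proof (intro nn_integral_cong)
      fix E
      have "emeasure lborel (D \<inter> ?J E) = (\<integral>\<^sup>+t. indicator (D \<inter> ?J E) t \<partial>lborel)" by simp
      also have "\<dots> = (\<integral>\<^sup>+t. indicator D t * (if \<bar>t - E\<bar> \<le> e then 1 else 0) \<partial>lborel)"
        by (intro nn_integral_cong) (auto simp: indicator_def)
      finally show "emeasure lborel (D \<inter> ?J E) = \<dots>" .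
    qed
    also have "\<dots> = (\<integral>\<^sup>+t. (\<integral>\<^sup>+E. indicator D t * (if \<bar>t - E\<bar> \<le> e then 1 else 0) \<partial>lborel) \<partial>lborel)"
      by (rule lborel_pair.Fubini') measurable
    also have "\<dots> = (\<integral>\<^sup>+t. ennreal (2 * e) * indicator D t \<partial>lborel)"
    proof (intro nn_integral_cong)
      fix t
      have "(\<integral>\<^sup>+E. indicator D t * (if \<bar>t - E\<bar> \<le> e then 1 else 0) \<partial>lborel) = (\<integral>\<^sup>+E. indicator D t * indicator (?J t) E \<partial>lborel)"
        by (intro nn_integral_cong) (auto simp: indicator_def)
      also have "\<dots> = indicator D t * ennreal (2 * e)"
        using e by (subst nn_integral_cmult_indicator) auto
      finally show "(\<integral>\<^sup>+E. indicator D t * (if \<bar>t - E\<bar> \<le> e then 1 else 0) \<partial>lborel) = ennreal (2 * e) * indicator D t"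
        by (simp add: mult.commute)
    qed
    also have "\<dots> = ennreal (2 * e) * emeasure lborel D" by (subst nn_integral_cmult_indicator) auto
    also have "\<dots> \<le> ennreal (2 * e) * ennreal ?q" using U(3) unfolding D_def by (intro mult_left_mono) auto
    also have "\<dots> = ennreal e * ennreal (measure lborel K / 4)"
      using e by (simp add: ennreal_mult[symmetric])
    finally have "ennreal e * emeasure lborel T \<le> ennreal e * ennreal (measure lborel K / 4)" .
    then have "emeasure lborel T \<le> ennreal (measure lborel K / 4)"
      using e by (simp add: ennreal_mult_le_mult_iff)
    then show "measure lborel {E\<in>K. Im (m (Complex E e)) < c / 2} \<le> measure lborel K / 4"
      unfolding T_def[symmetric] measure_def[of _ T] by (intro enn2real_leI) auto
  qed
qed

text \<open>At height \<open>e\<close>, the energies in K with Im m < c/2 and those with |m| > r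
  form two sets of measure at most k/4 each, by \<open>boundary_density\<close> and
  \<open>boundary_weak_type\<close>. The remaining set \<open>S\<close> also has measure at most
  k/4, by the level-set bound for \<open>G\<close>. The three cover K, so k <= 3k/4.\<close>

lemma no_ac_on_compact:
  assumes V: "L1_sparse V" and H: "herglotz_measure (weyl_m V) \<mu>" and K: "compact K" "K \<subseteq> {\<alpha>..\<beta>}"
    and ab: "\<alpha> < \<beta>" "\<beta> < 0" and c: "c > 0"
    and low: "\<And>B. B \<in> sets borel \<Longrightarrow> B \<subseteq> K \<Longrightarrow> c * measure lborel B \<le> measure \<mu> B"
  shows "measure lborel K = 0"
proof (rule ccontr)
  assume "measure lborel K \<noteq> 0"
  then have pos: "measure lborel K > 0" by (simp add: zero_less_measure_iff)
  define k where "k = measure lborel K"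
  define m where "m = weyl_m V"
  define L where "L = \<beta> - \<alpha> + 2"
  define R where "R = \<bar>\<alpha>\<bar> + \<bar>\<beta>\<bar> + L + 3"
  define l where "l = 1 / (4 * R)"
  define \<kappa> where "\<kappa> = sqrt (- \<beta>)"
  have k: "k > 0" using pos by (simp add: k_def)
  have L: "L > 0" using ab by (simp add: L_def)
  have R: "R \<ge> 1" using L by (simp add: R_def)
  have l: "l > 0" using R by (simp add: l_def)
  have \<kappa>: "\<kappa> > 0" "\<kappa>\<^sup>2 = - \<beta>" using ab by (simp_all add: \<kappa>_def)
  have lV: "locally_integrable V" using V by (rule L1_sparse_locally_integrable)
  have hol: "m holomorphic_on {z. Im z > 0}" unfolding m_def by (rule herglotz_holomorphic[OF H])
  have mpos: "0 < Im (m z)" if "Im z > 0" for z unfolding m_def by (rule weyl_m_Im_pos[OF V that])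
  obtain C where C: "C > 0" "\<And>z. Im z > 0 \<Longrightarrow> cmod z \<le> R \<Longrightarrow> cmod (m z) \<le> C / Im z"
    using herglotz_bound[OF H R] unfolding m_def by blast
  \<comment> \<open>Makes the weak-type bound 12 L^2 C / r equal to k/4.\<close>
  define r where "r = 48 * L\<^sup>2 * C / k"
  have r: "r > 0" using L C k by (simp add: r_def)
  \<comment> \<open>The reciprocals of the two constants in \<open>green_lower_bound\<close>, taken
    at c/2 and \<open>r\<close>: this many times the imaginary parts of the Green functions bounds
    the squares of both fundamental solutions.\<close>
  define M0 where "M0 = 4 / c + 4 * r\<^sup>2 / c"
  have M0: "M0 > 0" using c by (simp add: M0_def add_pos_nonneg)
  \<comment> \<open>The bound for the measure of \<open>S\<close> without its factor \<tau>^2; 4800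
    is four points times two Green functions times 600. Neither the interval nor the height enters,
    so \<tau> can be fixed now.\<close>
  define K1 where "K1 = 6 * L\<^sup>2 * ((8712 * R\<^sup>2 * M0 / (2 * \<kappa>)) * 4800 / l)"
  have K1: "K1 > 0" using L R M0 \<kappa> l by (simp add: K1_def)
  define \<tau> where "\<tau> = sqrt (k / (4 * K1))"
  have \<tau>: "\<tau> > 0" "\<tau>\<^sup>2 * K1 = k / 4" using k K1 by (simp_all add: \<tau>_def)
  \<comment> \<open>\<tau> is split into halves: \<eta> / \<kappa> is at most \<tau>/2, and
    \<open>N\<close> below makes the exponential at most \<tau>/2.\<close>
  define \<eta> where "\<eta> = min (min \<kappa> (1 / 4)) (\<kappa> * \<tau> / 2)"
  have \<eta>: "\<eta> > 0" "\<eta> \<le> \<kappa>" "\<eta> \<le> 1 / 4" "\<eta> \<le> \<kappa> * \<tau> / 2" using \<kappa> \<tau> by (auto simp: \<eta>_def)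
  define N where "N = max l (- 2 / \<kappa> * ln (\<tau> / 2))"
  have N: "N \<ge> l" "N > 0" using l by (auto simp: N_def)
  have expN: "exp (- \<kappa> * N / 2) \<le> \<tau> / 2"
  proof -
    have "- 2 / \<kappa> * ln (\<tau> / 2) \<le> N" by (simp add: N_def)
    then have "\<kappa> * (- 2 / \<kappa> * ln (\<tau> / 2)) \<le> \<kappa> * N" using \<kappa> by (intro mult_left_mono) auto
    then have "- \<kappa> * N / 2 \<le> ln (\<tau> / 2)" using \<kappa> by simp
    then have "exp (- \<kappa> * N / 2) \<le> exp (ln (\<tau> / 2))" by (simp only: exp_le_cancel_iff)
    then show ?thesis using \<tau> by simp
  qed
  \<comment> \<open>The surplus length \<open>l\<close> keeps the potential small also on
    [y, y + l], as the upper bound for the Green functions at y requires.\<close>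
  obtain x where x: "x \<ge> 0" "integral {x..x+(N+l)} (\<lambda>t. \<bar>V t\<bar>) \<le> \<eta>"
    using L1_sparseD[OF V \<eta>(1), of "N + l" 0] N l by auto
  define y where "y = x + N"
  have xy: "x + l \<le> y" using N by (simp add: y_def)
  have Vi: "(\<lambda>t. \<bar>V t\<bar>) integrable_on {s..s'}" if "0 \<le> s" for s s'
    using locally_integrable_abs_integrable[OF lV that] .
  have sub: "integral {s..s'} (\<lambda>t. \<bar>V t\<bar>) \<le> \<eta>" if "x \<le> s" "s' \<le> x + (N + l)" for s s'
  proof -
    have "integral {s..s'} (\<lambda>t. \<bar>V t\<bar>) \<le> integral {x..x+(N+l)} (\<lambda>t. \<bar>V t\<bar>)"
      using that x by (intro integral_subset_le Vi) auto
    then show ?thesis using x by linarith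
  qed
  let ?P = "{x, x + l, y - l, y}"
  have P: "0 \<le> t" "integral {t..t+l} (\<lambda>t. \<bar>V t\<bar>) \<le> 1 / 4" if "t \<in> ?P" for t
  proof -
    have t: "x \<le> t" "t + l \<le> x + (N + l)" using that xy l by (auto simp: y_def)
    show "0 \<le> t" using t x by linarith
    show "integral {t..t+l} (\<lambda>t. \<bar>V t\<bar>) \<le> 1 / 4" using sub[OF t] \<eta> by linarith
  qed
  have Pn: "0 \<le> x" "0 \<le> x + l" "0 \<le> y - l" "0 \<le> y" using x(1) xy l by linarith+
  define Q where "Q t e \<longleftrightarrow> (\<forall>z. 0 < Im z \<longrightarrow> Im z < e \<longrightarrow> cmod z \<le> R \<longrightarrow> c / 2 \<le> Im (m z) \<longrightarrow> cmod (m z) \<le> r \<longrightarrow>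
     c / 2 / 2 * (cmod (ivp V 0 1 z t))\<^sup>2 \<le> Im (greenD V t z) \<and> c / 2 / (2 * r\<^sup>2) * (cmod (ivp V 1 0 z t))\<^sup>2 \<le> Im (greenN V t z))" for t e
  have "\<forall>t\<in>?P. \<exists>e>0. Q t e"
  proof
    fix t assume "t \<in> ?P"
    from P(1)[OF this] have t: "0 \<le> t" .
    show "\<exists>e>0. Q t e"
      using green_lower_bound[OF V t half_gt_zero[OF c] r, of R] unfolding m_def Q_def by metis
  qed
  then obtain ef where ef: "\<And>t. t \<in> ?P \<Longrightarrow> ef t > 0" "\<And>t. t \<in> ?P \<Longrightarrow> Q t (ef t)" by metis
  obtain d where d: "d > 0" "\<And>e. 0 < e \<Longrightarrow> e < d \<Longrightarrow> measure lborel {E\<in>K. Im (m (Complex E e)) < c / 2} \<le> k / 4"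
    using boundary_density[OF H K(1) c low pos] unfolding m_def k_def by blast
  \<comment> \<open>The height is chosen after the four points, whose thresholds from
    \<open>green_lower_bound\<close> it has to respect.\<close>
  define e0 where "e0 = Min (ef ` ?P)"
  have e0: "e0 > 0" "\<And>t. t \<in> ?P \<Longrightarrow> e0 \<le> ef t" using ef(1) by (auto simp: e0_def)
  define e where "e = min (min e0 d) 1 / 2"
  have e: "0 < e" "e < d" "e \<le> 1" "e < e0" using e0(1) d(1) by (auto simp: e_def)
  \<comment> \<open>Normalises \<open>G\<close> so that \<open>good_interval_lower_bound\<close>
    gives Im G >= 1 over \<open>S\<close>; the small factor \<tau>^2 thereby enters the bound for
    |G|.\<close>
  define \<Omega> where "\<Omega> = \<tau>\<^sup>2 * (8712 * R\<^sup>2 * M0 / (2 * \<kappa>))"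
  have \<Omega>: "\<Omega> > 0" using \<tau> R M0 \<kappa> by (simp add: \<Omega>_def)
  define h where "h t z = greenD V t z + greenN V t z" for t z
  define G where "G z = of_real \<Omega> * (\<Sum>t\<leftarrow>[x, x + l, y - l, y]. h t z)" for z
  have m0: "m z \<noteq> 0" if "Im z > 0" for z using mpos[OF that] by auto
  have hhol: "h t holomorphic_on {z. Im z > 0}" if "0 \<le> t" for t
    unfolding h_def greenD_def greenN_def m_def[symmetric]
    using m0 that by (intro holomorphic_intros hol ivp_holomorphic[OF lV]) auto
  have hpos: "0 \<le> Im (h t z)" if "0 \<le> t" "Im z > 0" for t z
    unfolding h_def using green_nonneg[OF V that(2,1)] by simp
  have hbd: "cmod (h t z) \<le> 600 / (l * Im z) + 600 / (l * Im z)" if "t \<in> ?P" "Im z > 0" "cmod z \<le> R" for t z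
    using green_bounds(4)[OF V that(2) P(1)[OF that(1)] R that(3) l_def P(2)[OF that(1)]]
      norm_triangle_ineq[of "greenD V t z" "greenN V t z"] unfolding h_def by linarith
  define S where "S = {E\<in>K. c / 2 \<le> Im (m (Complex E e)) \<and> cmod (m (Complex E e)) \<le> r}"
  have Kb[measurable]: "K \<in> sets borel" using K(1) by (simp add: borel_compact)
  have [measurable]: "(\<lambda>E. m (Complex E e)) \<in> borel_measurable borel"
    using holomorphic_measurable_line[OF hol e(1)] .
  have S_borel: "S \<in> sets borel" unfolding S_def by measurable
  have "measure lborel S \<le> 6 * (\<beta> - \<alpha> + 2)\<^sup>2 * (\<Omega> * 4800 / l)"
  proof (rule upper_half_plane_level_set_bound[where G = G and R = R and e = e])
    show "G holomorphic_on {z. Im z > 0}"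
      unfolding G_def using Pn by (simp, intro holomorphic_intros hhol) auto
    show "0 \<le> Im (G z)" if "Im z > 0" for z
      unfolding G_def using Pn hpos[OF _ that] \<Omega> by simp
    show "cmod (G z) \<le> \<Omega> * 4800 / l / Im z" if "Im z > 0" "cmod z \<le> R" for z
    proof -
      have "cmod (\<Sum>t\<leftarrow>[x, x + l, y - l, y]. h t z) \<le> cmod (h x z) + (cmod (h (x + l) z) + (cmod (h (y - l) z) + cmod (h y z)))"
        by simp (meson add_left_mono norm_triangle_ineq order_trans)
      also have "\<dots> \<le> (600 / (l * Im z) + 600 / (l * Im z)) + ((600 / (l * Im z) + 600 / (l * Im z)) +
          ((600 / (l * Im z) + 600 / (l * Im z)) + (600 / (l * Im z) + 600 / (l * Im z))))"
        using that by (intro add_mono hbd) auto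
      also have "\<dots> = 4800 / (l * Im z)" by simp
      finally have "\<Omega> * cmod (\<Sum>t\<leftarrow>[x, x + l, y - l, y]. h t z) \<le> \<Omega> * (4800 / (l * Im z))"
        using \<Omega> by (intro mult_left_mono) auto
      then show ?thesis unfolding G_def norm_mult norm_of_real using \<Omega> by simp
    qed
    show "S \<subseteq> {\<alpha>..\<beta>}" using K(2) by (auto simp: S_def)
    fix E assume "E \<in> S"
    then have E: "E \<in> {\<alpha>..\<beta>}" "c / 2 \<le> Im (m (Complex E e))" "cmod (m (Complex E e)) \<le> r"
      using K(2) by (auto simp: S_def)
    let ?z = "Complex E e"
    have z: "0 < Im ?z" "Im ?z < e0" using e by auto
    have "cmod ?z \<le> \<bar>E\<bar> + \<bar>e\<bar>" using cmod_le[of ?z] by simp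
    then have zR: "cmod ?z \<le> R" using E(1) e L by (auto simp: R_def)
    have uv: "(cmod (ivp V 1 0 ?z t))\<^sup>2 + (cmod (ivp V 0 1 ?z t))\<^sup>2 \<le> M0 * Im (h t ?z)" if t: "t \<in> ?P" for t
    proof -
      have g: "c / 2 / 2 * (cmod (ivp V 0 1 ?z t))\<^sup>2 \<le> Im (greenD V t ?z)" "c / 2 / (2 * r\<^sup>2) * (cmod (ivp V 1 0 ?z t))\<^sup>2 \<le> Im (greenN V t ?z)"
        using ef(2)[OF t, unfolded Q_def, rule_format, OF z(1) _ zR E(2,3)] z(2) e0(2)[OF t] by auto
      have gn: "0 \<le> Im (greenD V t ?z)" "0 \<le> Im (greenN V t ?z)" using green_nonneg[OF V z(1) P(1)[OF t]] by auto
      have "(cmod (ivp V 0 1 ?z t))\<^sup>2 \<le> 4 / c * Im (greenD V t ?z)" using g(1) c by (simp add: field_simps)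
      also have "\<dots> \<le> M0 * Im (greenD V t ?z)" using gn c by (intro mult_right_mono) (auto simp: M0_def)
      finally have 1: "(cmod (ivp V 0 1 ?z t))\<^sup>2 \<le> M0 * Im (greenD V t ?z)" .
      have "(cmod (ivp V 1 0 ?z t))\<^sup>2 \<le> 4 * r\<^sup>2 / c * Im (greenN V t ?z)" using g(2) c r by (simp add: field_simps)
      also have "\<dots> \<le> M0 * Im (greenN V t ?z)" using gn c by (intro mult_right_mono) (auto simp: M0_def)
      finally show ?thesis using 1 by (simp add: h_def distrib_left)
    qed
    have \<tau>': "exp (- \<kappa> * (y - x) / 2) + \<eta> / \<kappa> \<le> \<tau>"
    proof -
      have "\<eta> / \<kappa> \<le> \<tau> / 2" using \<eta>(4) \<kappa>(1) by (simp add: field_simps)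
      moreover have "y - x = N" by (simp add: y_def)
      ultimately show ?thesis using expN by (simp only:)
    qed
    let ?Z = "\<Sum>t\<leftarrow>[x, x + l, y - l, y]. (cmod (ivp V 1 0 ?z t))\<^sup>2 + (cmod (ivp V 0 1 ?z t))\<^sup>2"
    have Z: "?Z \<le> M0 * (\<Sum>t\<leftarrow>[x, x + l, y - l, y]. Im (h t ?z))"
      using uv[of x] uv[of "x + l"] uv[of "y - l"] uv[of y] by (simp add: distrib_left)
    have Z0: "0 \<le> ?Z" by simp
    have "2 * \<kappa> \<le> (exp (- \<kappa> * (y - x) / 2) + \<eta> / \<kappa>)\<^sup>2 * (8712 * R\<^sup>2 * ?Z)"
      using E(1) \<kappa> \<eta>
      by (intro good_interval_lower_bound[OF lV x(1) xy sub \<eta>(2,3) R zR l_def]) (auto simp: y_def l less_imp_le)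
    also have "\<dots> \<le> \<tau>\<^sup>2 * (8712 * R\<^sup>2 * ?Z)"
      using \<tau>' Z0 \<eta> \<kappa> by (intro mult_right_mono power_mono) (auto intro!: mult_nonneg_nonneg add_nonneg_nonneg)
    also have "\<dots> \<le> \<tau>\<^sup>2 * (8712 * R\<^sup>2 * (M0 * (\<Sum>t\<leftarrow>[x, x + l, y - l, y]. Im (h t ?z))))"
      using Z by (intro mult_left_mono) auto
    finally have "1 \<le> \<tau>\<^sup>2 * (8712 * R\<^sup>2 * (M0 * (\<Sum>t\<leftarrow>[x, x + l, y - l, y]. Im (h t ?z)))) / (2 * \<kappa>)"
      using \<kappa> by (simp only: pos_le_divide_eq)
    also have "\<dots> = Im (G ?z)" unfolding G_def \<Omega>_def by simp
    finally show "1 \<le> Im (G ?z)" .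
  qed (use S_borel ab e L in \<open>auto simp: R_def L_def\<close>)
  also have "\<dots> = \<tau>\<^sup>2 * K1" by (simp add: K1_def \<Omega>_def L_def)
  finally have S4: "measure lborel S \<le> k / 4" using \<tau> by simp
  let ?T1 = "{E\<in>K. Im (m (Complex E e)) < c / 2}" and ?T2 = "{E\<in>{\<alpha>..\<beta>}. r < cmod (m (Complex E e))}"
  have T1: "measure lborel ?T1 \<le> k / 4" by (rule d(2)[OF e(1,2)])
  have "measure lborel ?T2 \<le> 6 * (\<beta> - \<alpha> + 2)\<^sup>2 * (2 * C / r)"
    by (rule boundary_weak_type[OF hol mpos C(2) _ ab(1) e(1,3) r]) (auto simp: R_def L_def)
  also have "\<dots> = k / 4" using C L k by (simp add: r_def L_def[symmetric])
  finally have T2: "measure lborel ?T2 \<le> k / 4" .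
  have fin: "B \<in> fmeasurable lborel" if "B \<in> sets borel" "B \<subseteq> {\<alpha>..\<beta>}" for B
  proof (rule fmeasurableI2)
    show "{\<alpha>..\<beta>} \<in> fmeasurable lborel" by (rule fmeasurableI) (auto simp: emeasure_lborel_Icc_eq)
  qed (use that in auto)
  have f: "S \<in> fmeasurable lborel" "?T1 \<in> fmeasurable lborel" "?T2 \<in> fmeasurable lborel"
    using K(2) S_borel by (auto intro!: fin simp: S_def)
  have "k \<le> measure lborel (S \<union> (?T1 \<union> ?T2))"
    unfolding k_def using f K(2)
    by (intro measure_mono_fmeasurable fmeasurable.Un) (auto simp: S_def)
  also have "\<dots> \<le> measure lborel S + (measure lborel ?T1 + measure lborel ?T2)"
    using f by (intro order_trans[OF measure_Un_le] add_left_mono measure_Un_le) (auto dest: fmeasurableD)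
  also have "\<dots> \<le> k / 4 + (k / 4 + k / 4)" using S4 T1 T2 by linarith
  finally show False using k by simp
qed

theorem corollary2:
  fixes V :: "real \<Rightarrow> real" and \<mu> \<mu>\<^sub>a\<^sub>c :: "real measure"
  assumes "L2_sparse V"
    and "dirichlet_spectral_measure V \<mu>"
    and "ac_part \<mu> \<mu>\<^sub>a\<^sub>c"
  shows "\<forall>A\<in>sets borel. A \<subseteq> {..<0} \<longrightarrow> emeasure \<mu>\<^sub>a\<^sub>c A = 0"
proof (intro ballI impI)
  fix A :: "real set" assume A[measurable]: "A \<in> sets borel" and A0: "A \<subseteq> {..<0}"
  have V: "L1_sparse V" using assms(1) by (rule L2_sparse_imp_L1_sparse)
  have H: "herglotz_measure (weyl_m V) \<mu>" using assms(2) by (simp add: dirichlet_spectral_measure_def)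
  have \<nu>: "sets \<mu>\<^sub>a\<^sub>c = sets borel" "absolutely_continuous lborel \<mu>\<^sub>a\<^sub>c"
    and le: "\<And>B. B \<in> sets borel \<Longrightarrow> emeasure \<mu>\<^sub>a\<^sub>c B \<le> emeasure \<mu> B"
    using assms(3) unfolding ac_part_def by auto
  obtain f where f[measurable]: "f \<in> borel_measurable borel" and dens: "density lborel f = \<mu>\<^sub>a\<^sub>c"
    using sigma_finite_measure.Radon_Nikodym[OF lborel.sigma_finite_measure_axioms \<nu>(2)] \<nu>(1) by auto
  have em: "emeasure \<mu>\<^sub>a\<^sub>c B = (\<integral>\<^sup>+x. f x * indicator B x \<partial>lborel)" if "B \<in> sets borel" for B
    using that by (simp add: dens[symmetric] emeasure_density)
  \<comment> \<open>Sets bounded away from 0 and from minus infinity on which the density is at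
    least 1 / (n + 1); they exhaust the part of \<open>A\<close> where the density is nonzero. On
    each of them \<mu> dominates a positive multiple of Lebesgue measure.\<close>
  define An where "An n = {x\<in>A. x \<in> {- real (Suc n)..- 1 / real (Suc n)} \<and> ennreal (1 / real (Suc n)) \<le> f x}" for n
  have An[measurable]: "An n \<in> sets borel" for n unfolding An_def by measurable
  have null: "emeasure lborel (An n) = 0" for n
  proof (rule ccontr)
    assume nz: "emeasure lborel (An n) \<noteq> 0"
    define c where "c = 1 / real (Suc n)"
    have c: "c > 0" and c1: "c \<le> 1" by (simp_all add: c_def)
    have sub: "An n \<subseteq> {- real (Suc n)..- c}" by (auto simp: An_def c_def)
    have fin: "emeasure lborel (An n) < \<infinity>"
      using emeasure_mono[OF sub, of lborel] by (simp add: le_less_trans[OF _ ennreal_less_top] emeasure_lborel_Icc_eq split: if_splits)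
    define q where "q = measure lborel (An n)"
    have q: "emeasure lborel (An n) = ennreal q" using fin by (simp add: q_def emeasure_eq_ennreal_measure less_top)
    have "q \<noteq> 0" using nz q by auto
    then have q0: "q > 0" by (simp add: q_def zero_less_measure_iff)
    have Al: "An n \<in> sets lebesgue" using An by (simp add: sets_completionI_sets)
    \<comment> \<open>\<open>K\<close> misses less than the full measure of \<open>An n\<close>, so
      it cannot be a null set; \<open>no_ac_on_compact\<close> says that it is.\<close>
    obtain K where K: "closed K" "K \<subseteq> An n" "emeasure lebesgue (An n - K) < ennreal q"
      by (rule sets_lebesgue_inner_closed[OF Al q0])
    have Kb[measurable]: "K \<in> sets borel" using K(1) by simp
    have cK: "compact K"
      using K(1,2) sub by (meson bounded_closed_interval bounded_subset compact_eq_bounded_closed order_trans)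
    have Kl: "emeasure lborel (An n - K) < ennreal q" using K(3) An by (simp add: emeasure_completion)
    have "measure lborel K = 0"
    proof (rule no_ac_on_compact[OF V H cK _ _ _ c])
      \<comment> \<open>The left end is moved by 1 because for n = 0 the enclosing interval
        degenerates to the point -1.\<close>
      show "K \<subseteq> {- real (Suc n) - 1..- c}" using K(2) sub by fastforce
      show "- real (Suc n) - 1 < - c" "- c < 0" using c c1 by auto
      fix B assume B[measurable]: "B \<in> sets borel" and BK: "B \<subseteq> K"
      have "ennreal c * emeasure lborel B = (\<integral>\<^sup>+x. ennreal c * indicator B x \<partial>lborel)"
        by (simp add: nn_integral_cmult_indicator)
      also have "\<dots> \<le> (\<integral>\<^sup>+x. f x * indicator B x \<partial>lborel)"
        using BK K(2) by (intro nn_integral_mono) (auto simp: indicator_def An_def c_def)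
      also have "\<dots> \<le> emeasure \<mu> B" using em[OF B] le[OF B] by simp
      finally have *: "ennreal c * emeasure lborel B \<le> emeasure \<mu> B" .
      have ms: "sets \<mu> = sets borel" using H by (simp add: herglotz_measure_def)
      have "B \<subseteq> {- real (Suc n)..- c}" using BK K(2) sub by blast
      then have "emeasure \<mu> B \<le> emeasure \<mu> {- real (Suc n)..- c}" using ms by (intro emeasure_mono) auto
      then have fB: "emeasure \<mu> B < \<infinity>" using herglotz_finite_interval(1)[OF H] by (rule le_less_trans)
      then have "enn2real (ennreal c * emeasure lborel B) \<le> enn2real (emeasure \<mu> B)" using * by (intro enn2real_mono) auto
      then show "c * measure lborel B \<le> measure \<mu> B" using c by (simp add: measure_def enn2real_mult)
    qed
    moreover have "emeasure lborel K < \<infinity>"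
      by (rule le_less_trans[OF emeasure_mono[OF K(2)] fin]) simp
    then have "emeasure lborel K = ennreal (measure lborel K)"
      by (intro emeasure_eq_ennreal_measure) simp
    ultimately have "emeasure lborel K = 0" by (simp only: ennreal_0)
    moreover have "emeasure lborel (An n) = emeasure lborel K + emeasure lborel (An n - K)"
      using K(2) by (subst plus_emeasure) (auto intro: arg_cong[where f = "emeasure lborel"])
    ultimately show False using Kl q by simp
  qed
  have cover: "{x\<in>A. f x \<noteq> 0} \<subseteq> (\<Union>n. An n)"
  proof
    fix x assume "x \<in> {x\<in>A. f x \<noteq> 0}"
    then have x: "x \<in> A" "f x \<noteq> 0" "x < 0" using A0 by auto
    \<comment> \<open>A positive real number below f x, which may itself be infinite.\<close>
    obtain s :: real where s: "0 < s" "ennreal s < f x"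
    proof (cases "f x")
      case (real t)
      then show ?thesis using x(2) that[of "t / 2"] by (auto simp: ennreal_less_iff)
    qed (use that[of 1] in simp)
    obtain n where n: "real n > max (- x) (max (1 / - x) (1 / s))" using reals_Archimedean2 by blast
    have "1 / real (Suc n) \<le> - x" "1 / real (Suc n) \<le> s"
      using n x s by (auto simp: field_simps)
    moreover from this(2) have "ennreal (1 / real (Suc n)) \<le> ennreal s" by (rule ennreal_leI)
    then have "ennreal (1 / real (Suc n)) \<le> f x" using s(2) by order
    ultimately have "x \<in> An n" using x s n by (auto simp: An_def)
    then show "x \<in> (\<Union>n. An n)" by blast
  qed
  have "emeasure lborel (\<Union>n. An n) = 0" using null An by (intro emeasure_UN_eq_0) auto
  then have "(\<Union>n. An n) \<in> null_sets lborel" using An by (auto simp: null_sets_def)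
  then have "AE x in lborel. x \<notin> (\<Union>n. An n)" by (rule AE_not_in)
  then have "AE x in lborel. f x * indicator A x = 0"
    using cover by (auto simp: indicator_def elim!: eventually_mono)
  then show "emeasure \<mu>\<^sub>a\<^sub>c A = 0" unfolding em[OF A] by (subst nn_integral_0_iff_AE) auto
qed

end
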